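(* Let $g\ge 1$, let $P\subseteq \mathbb{Z}/g\mathbb{Z}$ be a set of plus positions, let $N=(\mathbb{Z}/g\mathbb{Z})\setminus P$ be the set of nodes and $d=\#N$. For an integer $r$ with $0\le r\le d/2$ put $t_{d,r}=\sum_{i=0}^{r-1}\binom{d}{i}$, and let $\mathfrak{G}^r=(\langle \mathfrak a\,|\,\mathfrak b\rangle)_{\mathfrak a,\mathfrak b\in\mathfrak B^r}$ be the Gram matrix of the Gram product on the set $\mathfrak B^r$ of periodic semi-meanders for $(g,P)$ with $r$ arcs. Then: (1) if $d$ is even, $\det \mathfrak G^{d/2}=\pm (T^2-4)^{t_{d,d/2}}$ in $\mathbb{Q}[T]$; (2) if $r<d/2$, $\det\mathfrak G^{r}=\pm (v^{g}-v^{-g})^{2t_{d,r}}$ in $\mathbb{Q}(v)$.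
   Context: Cylinder and band: let $C=(\mathbb{R}/g\mathbb{Z})\times\mathbb{R}$, and place the $g$ points $(i,0)$, $i\in\mathbb{Z}/g\mathbb{Z}$, on the circle $(\mathbb{R}/g\mathbb{Z})\times\{0\}$; the points with $i\in P$ are "plus signs" and those with $i\in N$ are "nodes". A periodic semi-meander for $(g,P)$ with $r$ arcs is a collection of pairwise disjoint curves in the closed upper half-cylinder $(\mathbb{R}/g\mathbb{Z})\times[0,\infty)$, meeting the circle only at their endpoints, consisting of $r$ simple arcs each joining two distinct nodes and $d-2r$ semi-lines (vertical rays $\{x\}\times[0,\infty)$ going to $+\infty$) starting at nodes, such that every node is the endpoint of exactly one curve and no plus sign lies on a curve; two such are identified if they are isotopic through such configurations. $\mathfrak B^r$ denotes the set of these. Gram product: for $\mathfrak a,\mathfrak b\in\mathfrak B^r$, let $D(\mathfrak a,\mathfrak b)$ be the union of $\mathfrak a$ (upper half-cylinder) and the mirror image of $\mathfrak b$ under $y\mapsto -y$ (lower half-cylinder), glued at the nodes. Its components are closed loops and paths. A loop is contractible if null-homotopic in $C$, non-contractible otherwise; $m_0(\mathfrak a,\mathfrak b)$, $m_T(\mathfrak a,\mathfrak b)$ denote the numbers of contractible, resp. non-contractible, loops. If some path component joins two semi-lines of $\mathfrak a$ or two semi-lines of $\mathfrak b$, set $\langle\mathfrak a|\mathfrak b\rangle=0$. Otherwise each of the $d-2r$ path components joins a semi-line of $\mathfrak a$ at some node to a semi-line of $\mathfrak b$ at some node; lifting the component to the universal cover $\mathbb{R}\times\mathbb{R}$, it starts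 at $x$-coordinate $x_{\rm top}\in\mathbb{Z}$ and ends at $x_{\rm bot}\in\mathbb{Z}$, and its displacement is $x_{\rm bot}-x_{\rm top}$ (measured with all $g$ points, plus signs included); $m_v(\mathfrak a,\mathfrak b)$ is the sum of these displacements. Then $\langle\mathfrak a|\mathfrak b\rangle=(-2)^{m_0(\mathfrak a,\mathfrak b)}v^{m_v(\mathfrak a,\mathfrak b)}$ if $r<d/2$ and $\langle\mathfrak a|\mathfrak b\rangle=(-2)^{m_0(\mathfrak a,\mathfrak b)}T^{m_T(\mathfrak a,\mathfrak b)}$ if $r=d/2$ (non-contractible loops only occur when $r=d/2$). *)

theory Defs
  imports "HOL-Computational_Algebra.Polynomial" "HOL-Computational_Algebra.Fraction_Field"
          "HOL-Combinatorics.Permutations"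
begin

definition nodes :: "int \<Rightarrow> int set \<Rightarrow> int set" where
  "nodes g P = {0..<g} - P"

text \<open>A periodic semi-meander is encoded by its set of arcs, each arc given by its lift
  (i,j) to the universal cover R x [0,oo) with left endpoint 0 \<le> i < g and i < j < i + g:
  the lifted arc joins x-coordinates i and j and encloses the circle segment [i,j].\<close>

definition lift :: "int \<Rightarrow> (int \<times> int) set \<Rightarrow> (int \<times> int) set" where
  "lift g A = {(i + n * g, j + n * g) | i j n. (i, j) \<in> A}"

definition hasArc :: "int \<Rightarrow> (int \<times> int) set \<Rightarrow> int \<Rightarrow> bool" where
  "hasArc g A x \<longleftrightarrow> (\<exists>y. (x, y) \<in> lift g A \<or> (y, x) \<in> lift g A)"

definition semimeander :: "int \<Rightarrow> int set \<Rightarrow> nat \<Rightarrow> (int \<times> int) set \<Rightarrow> bool" where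
  "semimeander g P r A \<longleftrightarrow>
     finite A \<and> card A = r \<and>
     (\<forall>(i, j) \<in> A. 0 \<le> i \<and> i < g \<and> i < j \<and> j < i + g
                   \<and> i mod g \<in> nodes g P \<and> j mod g \<in> nodes g P) \<and>
     (\<forall>(i, j) \<in> A. \<forall>(i', j') \<in> A. (i, j) \<noteq> (i', j') \<longrightarrow>
         {i mod g, j mod g} \<inter> {i' mod g, j' mod g} = {}) \<and>
     (\<forall>(a, b) \<in> lift g A. \<forall>(c, e) \<in> lift g A. \<not> (a < c \<and> c < b \<and> b < e)) \<and>
     (\<forall>x. x mod g \<in> nodes g P \<and> \<not> hasArc g A x \<longrightarrow>
         \<not> (\<exists>(a, b) \<in> lift g A. a < x \<and> x < b))"

definition Bset :: "int \<Rightarrow> int set \<Rightarrow> nat \<Rightarrow> (int \<times> int) set set" where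
  "Bset g P r = {A. semimeander g P r A}"

text \<open>The diagram D(a,b), lifted to the universal cover: top edges from A, bottom edges from B.\<close>

definition dedge :: "int \<Rightarrow> (int \<times> int) set \<Rightarrow> (int \<times> int) set \<Rightarrow> int \<Rightarrow> int \<Rightarrow> bool" where
  "dedge g A B x y \<longleftrightarrow> (x, y) \<in> lift g A \<or> (y, x) \<in> lift g A \<or>
                        (x, y) \<in> lift g B \<or> (y, x) \<in> lift g B"

definition conn :: "int \<Rightarrow> (int \<times> int) set \<Rightarrow> (int \<times> int) set \<Rightarrow> int \<Rightarrow> int \<Rightarrow> bool" where
  "conn g A B = (dedge g A B)\<^sup>*\<^sup>*"

definition lcomp :: "int \<Rightarrow> (int \<times> int) set \<Rightarrow> (int \<times> int) set \<Rightarrow> int \<Rightarrow> int set" where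
  "lcomp g A B x = {y. conn g A B x y}"

definition ccomp :: "int \<Rightarrow> int set \<Rightarrow> (int \<times> int) set \<Rightarrow> (int \<times> int) set \<Rightarrow> int \<Rightarrow> int set" where
  "ccomp g P A B i = {j \<in> nodes g P. \<exists>n. conn g A B i (j + n * g)}"

definition ccomps :: "int \<Rightarrow> int set \<Rightarrow> (int \<times> int) set \<Rightarrow> (int \<times> int) set \<Rightarrow> int set set" where
  "ccomps g P A B = ccomp g P A B ` nodes g P"

text \<open>A component is a closed loop iff every node in it carries an arc of A and an arc of B;
  a loop is contractible iff its lift is finite.\<close>
definition is_loop :: "int \<Rightarrow> (int \<times> int) set \<Rightarrow> (int \<times> int) set \<Rightarrow> int set \<Rightarrow> bool" where
  "is_loop g A B K \<longleftrightarrow> (\<forall>i \<in> K. hasArc g A i \<and> hasArc g B i)"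

definition m0 :: "int \<Rightarrow> int set \<Rightarrow> (int \<times> int) set \<Rightarrow> (int \<times> int) set \<Rightarrow> nat" where
  "m0 g P A B = card {K \<in> ccomps g P A B. is_loop g A B K \<and>
                        (\<exists>i \<in> K. finite (lcomp g A B i))}"

definition mT :: "int \<Rightarrow> int set \<Rightarrow> (int \<times> int) set \<Rightarrow> (int \<times> int) set \<Rightarrow> nat" where
  "mT g P A B = card {K \<in> ccomps g P A B. is_loop g A B K \<and>
                        (\<exists>i \<in> K. infinite (lcomp g A B i))}"

text \<open>Vanishing condition: some (path) component joins two semi-lines of a or two of b.\<close>
definition bad :: "int \<Rightarrow> int set \<Rightarrow> (int \<times> int) set \<Rightarrow> (int \<times> int) set \<Rightarrow> bool" where
  "bad g P A B \<longleftrightarrow> (\<exists>i \<in> nodes g P. \<exists>y \<in> lcomp g A B i. \<exists>z \<in> lcomp g A B i. y \<noteq> z \<and>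
      ((\<not> hasArc g A y \<and> \<not> hasArc g A z) \<or> (\<not> hasArc g B y \<and> \<not> hasArc g B z)))"

text \<open>Sum of displacements: each path component starts at a semi-line of a at a node s
  (x_top = s) and ends at the unique point of its lift carrying a semi-line of b.\<close>
definition mv :: "int \<Rightarrow> int set \<Rightarrow> (int \<times> int) set \<Rightarrow> (int \<times> int) set \<Rightarrow> int" where
  "mv g P A B = (\<Sum>s \<in> {s \<in> nodes g P. \<not> hasArc g A s}.
                   (THE y. y \<in> lcomp g A B s \<and> \<not> hasArc g B y) - s)"

definition varT :: "rat poly" where "varT = [:0, 1:]"

definition varv :: "rat poly fract" where "varv = Fract [:0, 1:] 1"

definition gramT :: "int \<Rightarrow> int set \<Rightarrow> (int \<times> int) set \<Rightarrow> (int \<times> int) set \<Rightarrow> rat poly" where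
  "gramT g P A B = (if bad g P A B then 0 else (-2) ^ m0 g P A B * varT ^ mT g P A B)"

definition gramv :: "int \<Rightarrow> int set \<Rightarrow> (int \<times> int) set \<Rightarrow> (int \<times> int) set \<Rightarrow> rat poly fract" where
  "gramv g P A B = (if bad g P A B then 0 else (-2) ^ m0 g P A B * varv powi mv g P A B)"

definition setdet :: "('a \<Rightarrow> 'a \<Rightarrow> 'b::comm_ring_1) \<Rightarrow> 'a set \<Rightarrow> 'b" where
  "setdet M S = (\<Sum>p \<in> {p. p permutes S}. of_int (sign p) * (\<Prod>a \<in> S. M a (p a)))"

definition tdr :: "nat \<Rightarrow> nat \<Rightarrow> nat" where
  "tdr d r = (\<Sum>i<r. d choose i)"

end

theory Submission
  imports Defs "Jordan_Normal_Form.Determinant"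
begin

text \<open>Give every arc \<open>(i, j)\<close> of a semi-meander the factor \<open>x\<^sub>i - x\<^sub>j\<close>, where \<open>x\<^sub>i\<close> is extended to all integers
  by \<open>x\<^bsub>i+g\<^esub> = q x\<^sub>i\<close>. The expansions of the resulting products in squarefree monomials of degree \<open>r\<close> form
  a square matrix \<open>M(q)\<close>, because a semi-meander is determined by the left ends of its arcs. With arcs
  read as invariants of the symplectic plane, whose loop value is \<open>-2\<close>, the Gram matrix becomes
  \<open>\<plusminus>M(v\<^bsup>-2g\<^esup>) M(v\<^bsup>2g\<^esup>)\<^sup>T\<close> up to conjugation by a diagonal matrix, with \<open>T = v\<^bsup>g\<^esup> + v\<^bsup>-g\<^esup>\<close>; so all rests on
  \<open>det M(q) = (1 - q)\<^bsup>t\<^esup>\<close>. Removing an arc between neighbouring nodes shows, by induction, that modulo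
  the row space a chosen node may be moved to a free neighbour, and moving across the cut costs a
  factor \<open>q\<close>; hence \<open>(1 - q)\<^bsup>r\<^esup>\<close> times every monomial lies in the row space and \<open>det M(q)\<close> is a constant times a power of
  \<open>1 - q\<close>. At \<open>q = 0\<close> and in the top degree the matrix is triangular, so the constant is 1 and the exponent
  is the total number of arcs crossing the cut, which is \<open>t\<close> by a recursion on \<open>r\<close>.\<close>

section \<open>Determinants indexed by finite sets\<close>

text \<open>Reading arcs as invariants makes every sign a topological matter: a contractible loop
  has to carry the sign -1, a path +1, a winding loop +1, and a winding loop has to go around just
  once and cannot coexist with a path from one end of the cylinder to the other. No curve is used
  for this. The lifted diagram becomes a pair of periodic noncrossing involutions of the integers,
  and each of these facts is extracted from products of signs of differences along an alternating
  walk, grouped once by upper and once by lower arcs. The diagonal matrix and the value of q come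
  from v^(j-i) = v^(i+j) v^(-2i): the part that depends on the monomial cancels between the two
  halves, up to the 2g picked up by right ends beyond the cut. That there are as many semi-meanders
  as monomials is not shown by a construction; it falls out of the row space argument at q = 0 over
  the integers. Plus signs keep the induction inside one cylinder: two deleted neighbouring nodes
  become plus signs, with g unchanged. The case r = d/2 is reached through rational values of v,
  with T = v^g + v^(-g).\<close>

lemma setdet_cong:
  assumes "\<And>a b. a \<in> S \<Longrightarrow> b \<in> S \<Longrightarrow> M a b = M' a b"
  shows "setdet M S = setdet M' S"
proof -
  have "of_int (sign p) * (\<Prod>a\<in>S. M a (p a)) = of_int (sign p) * (\<Prod>a\<in>S. M' a (p a))"
    if "p permutes S" for p
    using assms permutes_in_image[OF that] by (metis (no_types, lifting) prod.cong)
  then show ?thesis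
    unfolding setdet_def by (intro sum.cong) auto
qed

lemma setdet_reindex:
  assumes f: "bij_betw f S S'" and fin: "finite S"
  shows "setdet M S' = setdet (\<lambda>a b. M (f a) (f b)) S"
proof -
  have inj: "inj_on f S" and im: "f ` S = S'"
    using f by (auto simp: bij_betw_def)
  define F where "F = (\<lambda>p. map_permutation S f p)"
  have bij: "bij_betw F {p. p permutes S} {p. p permutes S'}"
  proof (rule bij_betwI[where g = "map_permutation S' (inv_into S f)"])
    show "F \<in> {p. p permutes S} \<rightarrow> {p. p permutes S'}"
      unfolding F_def using map_permutation_permutes[OF f] by auto
    show "map_permutation S' (inv_into S f) \<in> {p. p permutes S'} \<rightarrow> {p. p permutes S}"
      using map_permutation_permutes[OF bij_betw_inv_into[OF f]] by auto
    fix p assume "p \<in> {p. p permutes S}"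
    then show "map_permutation S' (inv_into S f) (F p) = p"
      unfolding F_def
      by (intro map_permutation_compose_inv[OF f]) (use inj in auto)
  next
    fix p assume "p \<in> {p. p permutes S'}"
    then show "F (map_permutation S' (inv_into S f) p) = p"
      unfolding F_def
      by (intro map_permutation_compose_inv[OF bij_betw_inv_into[OF f]])
        (use f in \<open>auto simp: bij_betw_inv_into_right\<close>)
  qed
  have "setdet M S' = (\<Sum>p | p permutes S. of_int (sign (F p)) * (\<Prod>a\<in>S'. M a (F p a)))"
    unfolding setdet_def
    by (rule sum.reindex_bij_betw[OF bij, symmetric,
          of "\<lambda>p. of_int (sign p) * (\<Prod>a\<in>S'. M a (p a))"])
  also have "\<dots> = setdet (\<lambda>a b. M (f a) (f b)) S"
    unfolding setdet_def
  proof (rule sum.cong[OF refl])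
    fix p assume "p \<in> {p. p permutes S}"
    then have p: "p permutes S" by simp
    have s: "sign (F p) = sign p"
      unfolding F_def using sign_map_permutation[OF inj p fin] by simp
    have "(\<Prod>a\<in>S'. M a (F p a)) = (\<Prod>a\<in>S. M (f a) (F p (f a)))"
      using prod.reindex_bij_betw[OF f, of "\<lambda>a. M a (F p a)"] by simp
    also have "\<dots> = (\<Prod>a\<in>S. M (f a) (f (p a)))"
      unfolding F_def using map_permutation_apply[OF inj] by (intro prod.cong) auto
    finally show "of_int (sign (F p)) * (\<Prod>a\<in>S'. M a (F p a))
       = of_int (sign p) * (\<Prod>a\<in>S. M (f a) (f (p a)))"
      using s by simp
  qed
  finally show ?thesis .
qed

lemma setdet_mat: "setdet M {0..<n} = det (mat n n (\<lambda>(i, j). M i j))"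
proof -
  have "(\<Prod>i = 0..<n. M i (p i)) = (\<Prod>i = 0..<n. mat n n (\<lambda>(i, j). M i j) $$ (i, p i))"
    if p: "p permutes {0..<n}" for p
    using permutes_in_image[OF p] by (intro prod.cong) auto
  then show ?thesis
    unfolding setdet_def by (subst det_def'[of _ n]) (auto intro!: sum.cong)
qed

text \<open>An enumeration of \<open>S\<close> carries \<open>setdet\<close> to the determinant of
  an ordinary square matrix, where \<open>det_mult\<close> applies.\<close>

lemma setdet_mult:
  assumes fin: "finite S"
  shows "setdet (\<lambda>a b. \<Sum>c\<in>S. M a c * N c b) S = setdet M S * setdet N S"
proof -
  obtain f where f: "bij_betw f {0..<card S} S"
    using ex_bij_betw_nat_finite[OF fin] by blast
  let ?n = "card S"
  let ?A = "mat ?n ?n (\<lambda>(i, j). M (f i) (f j))" and ?B = "mat ?n ?n (\<lambda>(i, j). N (f i) (f j))"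
  have "setdet (\<lambda>a b. \<Sum>c\<in>S. M a c * N c b) S
      = setdet (\<lambda>i j. \<Sum>c\<in>S. M (f i) c * N c (f j)) {0..<?n}"
    by (rule setdet_reindex[OF f]) simp
  also have "\<dots> = det (mat ?n ?n (\<lambda>(i, j). \<Sum>c\<in>S. M (f i) c * N c (f j)))"
    by (rule setdet_mat)
  also have "mat ?n ?n (\<lambda>(i, j). \<Sum>c\<in>S. M (f i) c * N c (f j)) = ?A * ?B"
    by (rule eq_matI)
      (auto simp: scalar_prod_def sum.reindex_bij_betw[OF f, symmetric])
  also have "det (?A * ?B) = det ?A * det ?B"
    by (rule det_mult) auto
  also have "\<dots> = setdet M S * setdet N S"
    by (simp add: setdet_reindex[OF f] setdet_mat)
  finally show ?thesis .
qed

lemma setdet_transpose: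
  assumes fin: "finite S"
  shows "setdet (\<lambda>a b. M b a) S = setdet M S"
proof -
  obtain f where f: "bij_betw f {0..<card S} S"
    using ex_bij_betw_nat_finite[OF fin] by blast
  let ?n = "card S"
  have "mat ?n ?n (\<lambda>(i, j). M (f j) (f i)) = transpose_mat (mat ?n ?n (\<lambda>(i, j). M (f i) (f j)))"
    by (rule eq_matI) auto
  then show ?thesis
    by (simp add: setdet_reindex[OF f] setdet_mat det_transpose[of _ ?n])
qed

lemma setdet_scale_rows:
  assumes fin: "finite S"
  shows "setdet (\<lambda>a b. c a * M a b) S = (\<Prod>a\<in>S. c a) * setdet M S"
  by (simp add: setdet_def prod.distrib sum_distrib_left mult.left_commute)

lemma setdet_scale_cols:
  assumes fin: "finite S"
  shows "setdet (\<lambda>a b. M a b * c b) S = (\<Prod>a\<in>S. c a) * setdet M S"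
  using setdet_transpose[OF fin, of "\<lambda>a b. M a b * c b"]
    setdet_scale_rows[OF fin, of c "\<lambda>a b. M b a"] setdet_transpose[OF fin, of M]
  by (simp add: mult.commute)

lemma setdet_zero_row:
  assumes fin: "finite S" and x: "x \<in> S" and 0: "\<And>b. b \<in> S \<Longrightarrow> M x b = 0"
  shows "setdet M S = 0"
proof -
  have "(\<Prod>a\<in>S. M a (p a)) = 0" if "p permutes S" for p
    by (rule prod_zero[OF fin]) (use x 0 permutes_in_image[OF that] in auto)
  then show ?thesis
    unfolding setdet_def by simp
qed

text \<open>Triangularity in disguise. It serves q = 0 with \<open>p\<close> the identity, and the
  top degree with the permutation that matches right ends with left ends.\<close>

lemma setdet_single_permutation:
  assumes fin: "finite S" and p: "p permutes S"
    and other: "\<And>q. q permutes S \<Longrightarrow> (\<forall>a\<in>S. M a (q a) \<noteq> 0) \<Longrightarrow> q = p"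
  shows "setdet M S = of_int (sign p) * (\<Prod>a\<in>S. M a (p a))"
proof -
  have "setdet M S = (\<Sum>q\<in>{p}. of_int (sign q) * (\<Prod>a\<in>S. M a (q a)))"
    unfolding setdet_def
  proof (rule sum.mono_neutral_right)
    show "finite {p. p permutes S}"
      using fin by (rule finite_permutations)
    show "\<forall>q\<in>{p. p permutes S} - {p}. of_int (sign q) * (\<Prod>a\<in>S. M a (q a)) = 0"
      using other fin by (metis (mono_tags, lifting) DiffD1 DiffD2 insertCI mem_Collect_eq
          mult_zero_right prod_zero)
  qed (use p in auto)
  then show ?thesis by simp
qed

lemma setdet_scalar:
  assumes fin: "finite S"
  shows "setdet (\<lambda>a b. if a = b then c else 0) S = c ^ card S"
proof -
  have "setdet (\<lambda>a b. if a = b then c else 0) S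
      = of_int (sign (id :: 'a \<Rightarrow> 'a)) * (\<Prod>a\<in>S. if a = id a then c else 0)"
  proof (rule setdet_single_permutation[OF fin permutes_id])
    fix q assume q: "q permutes S" and "\<forall>a\<in>S. (if a = q a then c else 0) \<noteq> 0"
    then show "q = id"
      by (metis eq_id_iff permutes_def)
  qed
  then show ?thesis by simp
qed

lemma poly_setdet: "poly (setdet M S) x = setdet (\<lambda>a b. poly (M a b) x) S"
  by (simp add: setdet_def poly_sum poly_prod)

section \<open>Semi-meanders\<close>

lemma lift_iff: "(x, y) \<in> lift g A \<longleftrightarrow> (\<exists>i j n. (i, j) \<in> A \<and> x = i + n * g \<and> y = j + n * g)"
  by (auto simp: lift_def)

lemma lift_shift: "(x + k * g, y + k * g) \<in> lift g A \<longleftrightarrow> (x, y) \<in> lift g A"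
proof -
  have "(x + k * g, y + k * g) \<in> lift g A" if xy: "(x, y) \<in> lift g A" for x y k
  proof -
    obtain i j n where "(i, j) \<in> A" "x = i + n * g" "y = j + n * g"
      using xy by (auto simp: lift_iff)
    then have "(i, j) \<in> A \<and> x + k * g = i + (n + k) * g \<and> y + k * g = j + (n + k) * g"
      by (simp add: algebra_simps)
    then show ?thesis
      unfolding lift_iff by blast
  qed
  from this[of x y k] this[of "x + k * g" "y + k * g" "- k"] show ?thesis
    by auto
qed

lemma lift_insert:
  "(x, y) \<in> lift g (insert (i, j) A) \<longleftrightarrow>
     (x, y) \<in> lift g A \<or> (\<exists>n. x = i + n * g \<and> y = j + n * g)"
  by (auto simp: lift_iff)

lemma lift_mono: "A \<subseteq> A' \<Longrightarrow> (x, y) \<in> lift g A \<Longrightarrow> (x, y) \<in> lift g A'"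
  by (auto simp: lift_iff)

lemma lift_of_arc: "(i, j) \<in> A \<Longrightarrow> (i, j) \<in> lift g A"
  by (metis add.right_neutral lift_iff mult_zero_left)

lemma hasArc_shift: "hasArc g A (x + k * g) \<longleftrightarrow> hasArc g A x"
proof -
  have "hasArc g A (x + k * g)" if h: "hasArc g A x" for x k
    using h unfolding hasArc_def by (metis lift_shift)
  from this[of x k] this[of "x + k * g" "- k"] show ?thesis
    by auto
qed

lemma mod_eq_shift: "x mod g = y mod g \<longleftrightarrow> (\<exists>k. x = y + k * g)" for x y g :: int
  by (metis add.commute mod_eqE mod_mult_self2 mult.commute)

lemma hasArc_mod: "hasArc g A (x mod g) \<longleftrightarrow> hasArc g A x"
proof -
  obtain k where "x = x mod g + k * g"
    using mod_eq_shift[of x g "x mod g"] by auto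
  then show ?thesis
    using hasArc_shift[of g A "x mod g" k] by simp
qed

lemma hasArc_insert:
  "hasArc g (insert (i, j) A) x \<longleftrightarrow> hasArc g A x \<or> x mod g = i mod g \<or> x mod g = j mod g"
  unfolding hasArc_def lift_insert mod_eq_shift by blast

lemma hasArc_iff:
  "hasArc g A x \<longleftrightarrow> (\<exists>(i, j)\<in>A. x mod g = i mod g \<or> x mod g = j mod g)"
proof
  assume "hasArc g A x"
  then show "\<exists>(i, j)\<in>A. x mod g = i mod g \<or> x mod g = j mod g"
    unfolding hasArc_def lift_iff by force
next
  assume "\<exists>(i, j)\<in>A. x mod g = i mod g \<or> x mod g = j mod g"
  then obtain i j where ij: "(i, j) \<in> A" "x mod g = i mod g \<or> x mod g = j mod g"
    by auto
  then have "insert (i, j) A = A" by auto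
  then show "hasArc g A x"
    using hasArc_insert[of g i j A x] ij by auto
qed

lemma hasArc_lift: "(x, y) \<in> lift g A \<Longrightarrow> hasArc g A x \<and> hasArc g A y"
  by (auto simp: hasArc_def)

locale meander =
  fixes g :: int and P :: "int set" and r :: nat and A :: "(int \<times> int) set"
  assumes g_pos: "g > 0" and sm: "semimeander g P r A"
begin

lemma arcs_finite: "finite A" and arcs_card: "card A = r"
  using sm by (auto simp: semimeander_def)

lemma arcD:
  assumes "(i, j) \<in> A"
  shows "0 \<le> i" "i < g" "i < j" "j < i + g" "i \<in> nodes g P" "j mod g \<in> nodes g P" "i \<noteq> j mod g"
proof -
  have "\<forall>(i, j)\<in>A. 0 \<le> i \<and> i < g \<and> i < j \<and> j < i + g
      \<and> i mod g \<in> nodes g P \<and> j mod g \<in> nodes g P"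
    using sm unfolding semimeander_def by (elim conjE)
  from bspec[OF this assms] show *: "0 \<le> i" "i < g" "i < j" "j < i + g" "j mod g \<in> nodes g P"
    and "i \<in> nodes g P"
    by auto
  show "i \<noteq> j mod g"
  proof
    assume "i = j mod g"
    then have "g dvd j - i"
      by (metis mod_0_imp_dvd minus_mod_eq_mult_div dvd_triv_left)
    then show False
      using * zdvd_imp_le[of g "j - i"] by auto
  qed
qed

lemma arc_mod: "(i, j) \<in> A \<Longrightarrow> i mod g = i"
  using arcD by simp

lemma arcs_disjoint:
  assumes "(i, j) \<in> A" "(i', j') \<in> A" "{i, j mod g} \<inter> {i', j' mod g} \<noteq> {}"
  shows "i = i' \<and> j = j'"
proof (rule ccontr)
  assume "\<not> ?thesis"
  moreover have "\<forall>(i, j)\<in>A. \<forall>(i', j')\<in>A. (i, j) \<noteq> (i', j') \<longrightarrow>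
      {i mod g, j mod g} \<inter> {i' mod g, j' mod g} = {}"
    using sm unfolding semimeander_def by (elim conjE)
  ultimately have "{i mod g, j mod g} \<inter> {i' mod g, j' mod g} = {}"
    using assms(1,2) by blast
  then show False
    using assms arc_mod by simp
qed

lemma liftE:
  assumes "(x, y) \<in> lift g A"
  obtains i j n where "(i, j) \<in> A" "x = i + n * g" "y = j + n * g"
  using assms by (auto simp: lift_iff)

lemma liftD:
  assumes "(x, y) \<in> lift g A"
  shows "x < y" "y < x + g" "x mod g \<in> nodes g P" "y mod g \<in> nodes g P"
  using assms by (auto elim!: liftE dest: arcD simp: arc_mod)

lemma lift_eqI:
  assumes xy: "(x, y) \<in> lift g A" and xy': "(x', y') \<in> lift g A"
    and eq: "x mod g = x' mod g \<or> x mod g = y' mod g \<or> y mod g = x' mod g \<or> y mod g = y' mod g"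
  shows "\<exists>k. x' = x + k * g \<and> y' = y + k * g"
proof -
  obtain i j n where ij: "(i, j) \<in> A" "x = i + n * g" "y = j + n * g"
    using xy by (rule liftE)
  obtain i' j' n' where ij': "(i', j') \<in> A" "x' = i' + n' * g" "y' = j' + n' * g"
    using xy' by (rule liftE)
  have "i = i' \<and> j = j'"
    by (rule arcs_disjoint) (use ij ij' eq arc_mod[OF ij(1)] arc_mod[OF ij'(1)] in auto)
  then have "x' = x + (n' - n) * g \<and> y' = y + (n' - n) * g"
    using ij ij' by (simp add: algebra_simps)
  then show ?thesis by blast
qed

lemma lift_left_unique: "(x, y) \<in> lift g A \<Longrightarrow> (x, y') \<in> lift g A \<Longrightarrow> y = y'"
  using lift_eqI[of x y x y'] g_pos by auto

lemma lift_right_unique: "(x, y) \<in> lift g A \<Longrightarrow> (x', y) \<in> lift g A \<Longrightarrow> x = x'"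
  using lift_eqI[of x y x' y] g_pos by auto

text \<open>Two such arcs share a node, so they are translates of each other by some
  \<open>k * g\<close>; but the length of an arc lies strictly between 0 and
  \<open>g\<close>.\<close>

lemma lift_not_both:
  assumes xy: "(x, y) \<in> lift g A" and yz: "(y, z) \<in> lift g A"
  shows False
proof -
  obtain k where k: "y = x + k * g" "z = y + k * g"
    using lift_eqI[OF xy yz] by blast
  have "0 < k * g" "k * g < 1 * g"
    using liftD[OF xy] k by auto
  then show False
    using g_pos by (simp add: zero_less_mult_iff)
qed

lemma noncrossing:
  assumes "(a, b) \<in> lift g A" "(c, e) \<in> lift g A"
  shows "\<not> (a < c \<and> c < b \<and> b < e)"
proof -
  have "\<forall>(a, b)\<in>lift g A. \<forall>(c, e)\<in>lift g A. \<not> (a < c \<and> c < b \<and> b < e)"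
    using sm unfolding semimeander_def by (elim conjE)
  then show ?thesis
    using assms by blast
qed

lemma uncovered:
  assumes "x mod g \<in> nodes g P" "\<not> hasArc g A x" "(a, b) \<in> lift g A"
  shows "\<not> (a < x \<and> x < b)"
proof -
  have "\<forall>x. x mod g \<in> nodes g P \<and> \<not> hasArc g A x \<longrightarrow> \<not> (\<exists>(a, b)\<in>lift g A. a < x \<and> x < b)"
    using sm unfolding semimeander_def by (elim conjE)
  then show ?thesis
    using assms by blast
qed

lemma hasArc_node: "hasArc g A x \<Longrightarrow> x mod g \<in> nodes g P"
  using liftD by (auto simp: hasArc_def)

end

lemma nodes_finite: "finite (nodes g P)"
  by (simp add: nodes_def)

lemma nodes_mod: "x \<in> nodes g P \<Longrightarrow> x mod g = x"
  by (simp add: nodes_def)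

text \<open>Common criterion for the two ways of adding an arc: between neighbouring nodes, and
  around the outside. Only the single lift \<open>(i, j)\<close> has to be compared with the old
  arcs, since periodicity handles the translates, and two translates of the new arc cannot interlock
  because its length is below \<open>g\<close>. The ends of the new arc may lie beneath old arcs, as
  they do when they were plus signs before.\<close>

lemma semimeander_insert:
  assumes g: "g > 0" and fin: "finite A" and card: "card A = r"
    and arcs: "\<And>a b. (a, b) \<in> A \<Longrightarrow>
      0 \<le> a \<and> a < g \<and> a < b \<and> b < a + g \<and> a mod g \<in> nodes g P \<and> b mod g \<in> nodes g P"
    and disj: "\<And>a b c e. (a, b) \<in> A \<Longrightarrow> (c, e) \<in> A \<Longrightarrow> (a, b) \<noteq> (c, e) \<Longrightarrow>
      {a mod g, b mod g} \<inter> {c mod g, e mod g} = {}"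
    and nc: "\<And>a b c e. (a, b) \<in> lift g A \<Longrightarrow> (c, e) \<in> lift g A \<Longrightarrow> \<not> (a < c \<and> c < b \<and> b < e)"
    and ij: "0 \<le> i" "i < g" "i < j" "j < i + g" "i mod g \<in> nodes g P" "j mod g \<in> nodes g P"
    and free: "\<not> hasArc g A i" "\<not> hasArc g A j"
    and nc': "\<And>a b. (a, b) \<in> lift g A \<Longrightarrow>
      \<not> (a < i \<and> i < b \<and> b < j) \<and> \<not> (i < a \<and> a < j \<and> j < b)"
    and unc: "\<And>x a b. x mod g \<in> nodes g P \<Longrightarrow> \<not> hasArc g A x \<Longrightarrow>
      x mod g \<noteq> i mod g \<Longrightarrow> x mod g \<noteq> j mod g \<Longrightarrow> (a, b) \<in> lift g A \<Longrightarrow> \<not> (a < x \<and> x < b)"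
    and unc': "\<And>x. x mod g \<in> nodes g P \<Longrightarrow> \<not> hasArc g A x \<Longrightarrow> \<not> (i < x \<and> x < j)"
  shows "semimeander g P (Suc r) (insert (i, j) A)"
proof -
  have notin: "(i, j) \<notin> A"
    using free lift_of_arc hasArc_lift by blast
  have d1: "{i mod g, j mod g} \<inter> {c mod g, e mod g} = {}" if "(c, e) \<in> A" for c e
    using free that by (auto simp: hasArc_iff)
  have "\<not> (a < c \<and> c < b \<and> b < e)"
    if ab: "(a, b) \<in> lift g (insert (i, j) A)" and ce: "(c, e) \<in> lift g (insert (i, j) A)"
    for a b c e
  proof -
    consider "(a, b) \<in> lift g A" "(c, e) \<in> lift g A"
      | n where "(a, b) \<in> lift g A" "c = i + n * g" "e = j + n * g"
      | n where "(c, e) \<in> lift g A" "a = i + n * g" "b = j + n * g"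
      | n m where "a = i + n * g" "b = j + n * g" "c = i + m * g" "e = j + m * g"
      using ab ce unfolding lift_insert by blast
    then show ?thesis
    proof cases
      case 1
      then show ?thesis by (rule nc)
    next
      case 2
      then have "(a + (- n) * g, b + (- n) * g) \<in> lift g A"
        unfolding lift_shift by simp
      from nc'[OF this] show ?thesis
        using 2 by auto
    next
      case 3
      then have "(c + (- n) * g, e + (- n) * g) \<in> lift g A"
        unfolding lift_shift by simp
      from nc'[OF this] show ?thesis
        using 3 by auto
    next
      case 4
      show ?thesis
      proof
        assume *: "a < c \<and> c < b \<and> b < e"
        then have "0 < (m - n) * g" "(m - n) * g < 1 * g"
          using 4 ij by (auto simp: algebra_simps)
        then show False
          using g by (simp add: zero_less_mult_iff)
      qed
    qed
  qed
  moreover have "\<not> (a < x \<and> x < b)"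
    if x: "x mod g \<in> nodes g P" "\<not> hasArc g (insert (i, j) A) x"
      and ab: "(a, b) \<in> lift g (insert (i, j) A)" for x a b
  proof -
    from ab consider "(a, b) \<in> lift g A" | n where "a = i + n * g" "b = j + n * g"
      unfolding lift_insert by blast
    then show ?thesis
    proof cases
      case 1
      then show ?thesis
        using unc x unfolding hasArc_insert by blast
    next
      case 2
      have "(x + (- n) * g) mod g = x mod g" "hasArc g A (x + (- n) * g) = hasArc g A x"
        unfolding hasArc_shift by (rule mod_mult_self1 refl)+
      then show ?thesis
        using unc'[of "x + (- n) * g"] x 2 unfolding hasArc_insert by auto
    qed
  qed
  moreover have "{a mod g, b mod g} \<inter> {c mod g, e mod g} = {}"
    if "(a, b) \<in> insert (i, j) A" "(c, e) \<in> insert (i, j) A" "(a, b) \<noteq> (c, e)" for a b c e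
    using that disj d1 by (metis inf_commute insert_iff prod.inject)
  moreover have "0 \<le> a \<and> a < g \<and> a < b \<and> b < a + g \<and> a mod g \<in> nodes g P \<and> b mod g \<in> nodes g P"
    if "(a, b) \<in> insert (i, j) A" for a b
    using that arcs ij by blast
  moreover have "finite (insert (i, j) A)" "card (insert (i, j) A) = Suc r"
    using fin card notin by auto
  ultimately show ?thesis
    unfolding semimeander_def by (intro conjI) (blast+)
qed

lemma finite_Bset: "g > 0 \<Longrightarrow> finite (Bset g P r)"
proof -
  assume g: "g > 0"
  have "Bset g P r \<subseteq> Pow ({0..<g} \<times> {0..<2 * g})"
    unfolding Bset_def semimeander_def using g by fastforce
  then show ?thesis
    by (rule finite_subset) simp
qed

section \<open>The transition matrix to monomials\<close>

text \<open>Index sets of the squarefree monomials of degree \<open>r\<close> in the node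
  variables.\<close>

definition rsets :: "int \<Rightarrow> int set \<Rightarrow> nat \<Rightarrow> int set set" where
  "rsets g P r = {S. S \<subseteq> nodes g P \<and> card S = r}"

text \<open>Singles out the monomials that occur in the expanded product of binomials: one end is
  picked from each arc, and no other node appears.\<close>

definition transversal :: "int \<Rightarrow> (int \<times> int) set \<Rightarrow> int set \<Rightarrow> bool" where
  "transversal g A S \<longleftrightarrow> (\<forall>s\<in>S. hasArc g A s) \<and> (\<forall>(i, j)\<in>A. (i \<in> S) \<noteq> (j mod g \<in> S))"

text \<open>Since \<open>j < i + g\<close> and \<open>i < g\<close>, an arc passes the cut at most
  once, so no higher power of \<open>q\<close> can occur.\<close>

definition wrapq :: "int \<Rightarrow> 'a \<Rightarrow> int \<Rightarrow> 'a::comm_ring_1" where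
  "wrapq g q j = (if j \<ge> g then q else 1)"

text \<open>The coefficient of the monomial \<open>x\<^sub>S\<close> in the product of \<open>x\<^sub>i - x\<^sub>j\<close> over the arcs, where
  \<open>x\<^bsub>j+g\<^esub> = q x\<^sub>j\<close>.\<close>

definition transition :: "'a \<Rightarrow> int \<Rightarrow> (int \<times> int) set \<Rightarrow> int set \<Rightarrow> 'a::comm_ring_1" where
  "transition q g A S = (if transversal g A S then \<Prod>(i, j)\<in>A. if i \<in> S then 1 else - wrapq g q j else 0)"

lemma finite_rsets: "finite (rsets g P r)"
proof -
  have "rsets g P r \<subseteq> Pow (nodes g P)"
    by (auto simp: rsets_def)
  then show ?thesis
    using finite_subset nodes_finite by blast
qed

lemma transversal_insert:
  assumes A: "\<And>a b. (a, b) \<in> A \<Longrightarrow> 0 \<le> a \<and> a < g" and S: "S \<subseteq> {0..<g}" and i: "0 \<le> i" "i < g"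
    and free: "\<not> hasArc g A i" "\<not> hasArc g A j" and ne: "i \<noteq> j mod g"
  shows "transversal g (insert (i, j) A) S \<longleftrightarrow>
    (i \<in> S \<and> j mod g \<notin> S \<and> transversal g A (S - {i})) \<or>
    (i \<notin> S \<and> j mod g \<in> S \<and> transversal g A (S - {j mod g}))"
proof -
  have m: "s mod g = s" if "s \<in> S" for s
    using S that by auto
  have d: "a \<noteq> i \<and> a \<noteq> j mod g \<and> b mod g \<noteq> i \<and> b mod g \<noteq> j mod g" if ab: "(a, b) \<in> A" for a b
    using hasArc_lift[OF lift_of_arc[OF ab], of g] free by (metis hasArc_mod)
  have h: "hasArc g (insert (i, j) A) s \<longleftrightarrow> hasArc g A s \<or> s = i \<or> s = j mod g" if "s \<in> S" for s
    using m[OF that] i by (simp add: hasArc_insert)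
  have f: "\<not> hasArc g A (j mod g)"
    using free by (simp add: hasArc_mod)
  have 1: "(\<forall>s\<in>S. hasArc g (insert (i, j) A) s) \<longleftrightarrow> (\<forall>s\<in>S - {i, j mod g}. hasArc g A s)"
    using h by blast
  have 2: "(\<forall>(a, b)\<in>A. (a \<in> S) \<noteq> (b mod g \<in> S)) \<longleftrightarrow>
      (\<forall>(a, b)\<in>A. (a \<in> S - {x}) \<noteq> (b mod g \<in> S - {x}))" if "x = i \<or> x = j mod g" for x
    using d that by (intro ball_cong refl) auto
  have 3: "(\<forall>s\<in>S. hasArc g (insert (i, j) A) s) \<longleftrightarrow> (\<forall>s\<in>S - {x}. hasArc g A s)"
    if "x = i \<or> x = j mod g" "S \<inter> {i, j mod g} \<subseteq> {x}" for x
    unfolding 1 using that by blast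
  have 4: "(\<forall>(a, b)\<in>insert (i, j) A. (a \<in> S) \<noteq> (b mod g \<in> S)) \<longleftrightarrow>
      (i \<in> S) \<noteq> (j mod g \<in> S) \<and> (\<forall>(a, b)\<in>A. (a \<in> S) \<noteq> (b mod g \<in> S))"
    by simp
  consider "i \<in> S" "j mod g \<in> S" | "i \<notin> S" "j mod g \<notin> S" | "i \<in> S" "j mod g \<notin> S" | "i \<notin> S" "j mod g \<in> S"
    by blast
  then show ?thesis
  proof cases
    case c: 3
    then have "transversal g (insert (i, j) A) S \<longleftrightarrow> transversal g A (S - {i})"
      unfolding transversal_def 4 using 2[of i] 3[of i] by simp
    then show ?thesis using c by simp
  next
    case c: 4
    then have "transversal g (insert (i, j) A) S \<longleftrightarrow> transversal g A (S - {j mod g})"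
      unfolding transversal_def 4 using 2[of "j mod g"] 3[of "j mod g"] by simp
    then show ?thesis using c by simp
  qed (simp_all add: transversal_def)
qed

text \<open>This is multiplication by the binomial of the new arc, read off coefficientwise: the
  chosen end is removed from the monomial, with the factor of that end in front.\<close>

lemma transition_insert:
  assumes fin: "finite A"
    and A: "\<And>a b. (a, b) \<in> A \<Longrightarrow> 0 \<le> a \<and> a < g" and S: "S \<subseteq> {0..<g}" and i: "0 \<le> i" "i < g"
    and free: "\<not> hasArc g A i" "\<not> hasArc g A j" and ne: "i \<noteq> j mod g"
  shows "transition q g (insert (i, j) A) S =
    (if i \<in> S \<and> j mod g \<notin> S then transition q g A (S - {i}) else 0) -
    (if i \<notin> S \<and> j mod g \<in> S then wrapq g q j * transition q g A (S - {j mod g}) else 0)"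
proof -
  have notin: "(i, j) \<notin> A"
    using free lift_of_arc hasArc_lift by blast
  have d: "a \<noteq> i \<and> a \<noteq> j mod g" if ab: "(a, b) \<in> A" for a b
    using hasArc_lift[OF lift_of_arc[OF ab], of g] free by (metis hasArc_mod)
  have p: "(\<Prod>(a, b)\<in>A. if a \<in> S - {x} then 1 else - wrapq g q b)
      = (\<Prod>(a, b)\<in>A. if a \<in> S then 1 else - wrapq g q b)" if "x = i \<or> x = j mod g" for x
    using d that by (intro prod.cong) auto
  note t = transversal_insert[OF A S i free ne]
  have "transition q g (insert (i, j) A) S = (if transversal g (insert (i, j) A) S then
      (if i \<in> S then 1 else - wrapq g q j) * (\<Prod>(a, b)\<in>A. if a \<in> S then 1 else - wrapq g q b) else 0)"
    unfolding transition_def using fin notin by simp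
  moreover have "transition q g A (S - {x}) = (if transversal g A (S - {x}) then
      \<Prod>(a, b)\<in>A. if a \<in> S then 1 else - wrapq g q b else 0)" if "x = i \<or> x = j mod g" for x
    unfolding transition_def p[OF that] ..
  ultimately show ?thesis
    using ne by (cases "i \<in> S"; cases "j mod g \<in> S") (simp_all add: t)
qed

text \<open>The coefficients are taken in the ring itself. Over polynomials in q this makes the span
  property a divisibility of determinants, and over the integers at q = 0 an invertibility.\<close>

definition in_row_span :: "'a \<Rightarrow> int \<Rightarrow> int set \<Rightarrow> nat \<Rightarrow> (int set \<Rightarrow> 'a::comm_ring_1) \<Rightarrow> bool" where
  "in_row_span q g P r f \<longleftrightarrow> (\<exists>c. \<forall>S\<in>rsets g P r. f S = (\<Sum>A\<in>Bset g P r. c A * transition q g A S))"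

lemma in_row_span_add: "in_row_span q g P r f \<Longrightarrow> in_row_span q g P r h \<Longrightarrow> in_row_span q g P r (\<lambda>S. f S + h S)"
  unfolding in_row_span_def
proof (elim exE)
  fix c c' assume "\<forall>S\<in>rsets g P r. f S = (\<Sum>A\<in>Bset g P r. c A * transition q g A S)"
    "\<forall>S\<in>rsets g P r. h S = (\<Sum>A\<in>Bset g P r. c' A * transition q g A S)"
  then show "\<exists>c. \<forall>S\<in>rsets g P r. f S + h S = (\<Sum>A\<in>Bset g P r. c A * transition q g A S)"
    by (intro exI[of _ "\<lambda>A. c A + c' A"]) (simp add: sum.distrib distrib_right)
qed

lemma in_row_span_scale: "in_row_span q g P r f \<Longrightarrow> in_row_span q g P r (\<lambda>S. k * f S)"
  unfolding in_row_span_def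
proof (elim exE)
  fix c assume "\<forall>S\<in>rsets g P r. f S = (\<Sum>A\<in>Bset g P r. c A * transition q g A S)"
  then show "\<exists>c. \<forall>S\<in>rsets g P r. k * f S = (\<Sum>A\<in>Bset g P r. c A * transition q g A S)"
    by (intro exI[of _ "\<lambda>A. k * c A"]) (simp add: sum_distrib_left mult.assoc)
qed

lemma in_row_span_cong: "in_row_span q g P r f \<Longrightarrow> (\<And>S. S \<in> rsets g P r \<Longrightarrow> h S = f S) \<Longrightarrow> in_row_span q g P r h"
  unfolding in_row_span_def by simp

lemma nodes_insert: "nodes g (insert x P) = nodes g P - {x}"
  by (auto simp: nodes_def)

text \<open>The smaller semi-meander treats the two nodes as plus signs, which its arcs may pass
  over. As no other node lies between them, the new arc can be squeezed in below everything
  else.\<close>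

lemma adjacent_insert:
  assumes g: "g > 0" and A: "A \<in> Bset g (P \<union> {i, j mod g}) r"
    and ij: "0 \<le> i" "i < g" "i < j" "j < i + g" "i \<in> nodes g P" "j mod g \<in> nodes g P"
    and adj: "\<And>x. i < x \<Longrightarrow> x < j \<Longrightarrow> x mod g \<notin> nodes g P"
  shows "insert (i, j) A \<in> Bset g P (Suc r)"
    and "\<not> hasArc g A i" "\<not> hasArc g A j"
proof -
  interpret meander g "P \<union> {i, j mod g}" r A
    using g A by unfold_locales (auto simp: Bset_def)
  have nd: "x mod g \<in> nodes g P \<and> x mod g \<noteq> i \<and> x mod g \<noteq> j mod g" if "hasArc g A x" for x
    using hasArc_node[OF that] by (auto simp: nodes_insert)
  show free: "\<not> hasArc g A i" "\<not> hasArc g A j"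
    using nd[of i] nd[of j] ij by auto
  have "semimeander g P (Suc r) (insert (i, j) A)"
  proof (rule semimeander_insert[OF g arcs_finite arcs_card])
    show "0 \<le> a \<and> a < g \<and> a < b \<and> b < a + g \<and> a mod g \<in> nodes g P \<and> b mod g \<in> nodes g P"
      if "(a, b) \<in> A" for a b
      using arcD[OF that] by (auto simp: nodes_insert)
    show "{a mod g, b mod g} \<inter> {c mod g, e mod g} = {}"
      if ab: "(a, b) \<in> A" and ce: "(c, e) \<in> A" and ne: "(a, b) \<noteq> (c, e)" for a b c e
      using arcs_disjoint[OF ab ce] ne arc_mod[OF ab] arc_mod[OF ce] by auto
    show "\<not> (a < i \<and> i < b \<and> b < j) \<and> \<not> (i < a \<and> a < j \<and> j < b)"
      if "(a, b) \<in> lift g A" for a b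
      using adj[of a] adj[of b] liftD[OF that] by (auto simp: nodes_insert)
    show "\<not> (a < x \<and> x < b)"
      if "x mod g \<in> nodes g P" "\<not> hasArc g A x" "x mod g \<noteq> i mod g" "x mod g \<noteq> j mod g"
        "(a, b) \<in> lift g A" for x a b
      using uncovered[of x a b] that ij by (auto simp: nodes_insert)
    show "\<not> (i < x \<and> x < j)" if "x mod g \<in> nodes g P" for x
      using adj that by blast
  qed (use ij free noncrossing in auto)
  then show "insert (i, j) A \<in> Bset g P (Suc r)"
    by (simp add: Bset_def)
qed

text \<open>A relation for the smaller node set is multiplied by the binomial of an arc joining two
  neighbours. This is the elementary move of the row space argument: up to the factor
  \<open>wrapq\<close>, a chosen node \<open>i\<close> may be replaced by \<open>j\<close>.\<close>

lemma in_row_span_adjacent: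
  assumes g: "g > 0"
    and ij: "0 \<le> i" "i < g" "i < j" "j < i + g" "i \<in> nodes g P" "j mod g \<in> nodes g P"
    and adj: "\<And>x. i < x \<Longrightarrow> x < j \<Longrightarrow> x mod g \<notin> nodes g P"
    and S0: "S0 \<in> rsets g (P \<union> {i, j mod g}) r"
    and W: "in_row_span q g (P \<union> {i, j mod g}) r (\<lambda>S. if S = S0 then k else 0)"
  shows "in_row_span q g P (Suc r) (\<lambda>S. (if S = insert i S0 then k else 0) -
           wrapq g q j * (if S = insert (j mod g) S0 then k else 0))"
proof -
  let ?P' = "P \<union> {i, j mod g}"
  have ne: "i \<noteq> j mod g"
  proof
    assume "i = j mod g"
    then have "g dvd j - i"
      by (metis mod_0_imp_dvd minus_mod_eq_mult_div dvd_triv_left)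
    then show False
      using ij zdvd_imp_le[of g "j - i"] by auto
  qed
  obtain c where c: "\<And>S. S \<in> rsets g ?P' r \<Longrightarrow>
      (if S = S0 then k else 0) = (\<Sum>A\<in>Bset g ?P' r. c A * transition q g A S)"
    using W unfolding in_row_span_def by blast
  define F where "F = (\<lambda>A :: (int \<times> int) set. insert (i, j) A)"
  have notin: "(i, j) \<notin> A" if "A \<in> Bset g ?P' r" for A
    using adjacent_insert(2)[OF g that ij adj] lift_of_arc hasArc_lift by blast
  have inj: "inj_on F (Bset g ?P' r)"
    unfolding F_def inj_on_def using notin by (metis insert_ident)
  have sub: "F ` Bset g ?P' r \<subseteq> Bset g P (Suc r)"
    unfolding F_def using adjacent_insert(1)[OF g _ ij adj] by blast
  \<comment> \<open>The coefficients are transported along the insertion of \<open>(i, j)\<close>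
    and extended by zero to all remaining semi-meanders.\<close>
  define c' where "c' = (\<lambda>A. if A \<in> F ` Bset g ?P' r then c (A - {(i, j)}) else 0)"
  have "(if S = insert i S0 then k else 0) - wrapq g q j * (if S = insert (j mod g) S0 then k else 0)
      = (\<Sum>A\<in>Bset g P (Suc r). c' A * transition q g A S)" if S: "S \<in> rsets g P (Suc r)" for S
  proof -
    have S0': "i \<notin> S0" "j mod g \<notin> S0"
      using S0 by (auto simp: rsets_def nodes_insert)
    have Sg: "S \<subseteq> {0..<g}" "finite S"
      using S nodes_finite finite_subset by (auto simp: rsets_def nodes_def)
    have "(\<Sum>A\<in>Bset g P (Suc r). c' A * transition q g A S) = (\<Sum>A\<in>F ` Bset g ?P' r. c' A * transition q g A S)"
      by (rule sum.mono_neutral_right) (use finite_Bset[OF g] sub in \<open>auto simp: c'_def\<close>)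
    also have "\<dots> = (\<Sum>A\<in>Bset g ?P' r. c' (F A) * transition q g (F A) S)"
      using sum.reindex[OF inj] by simp
    also have "\<dots> = (\<Sum>A\<in>Bset g ?P' r. c A *
       ((if i \<in> S \<and> j mod g \<notin> S then transition q g A (S - {i}) else 0) -
        (if i \<notin> S \<and> j mod g \<in> S then wrapq g q j * transition q g A (S - {j mod g}) else 0)))"
    proof (rule sum.cong[OF refl])
      fix A assume A: "A \<in> Bset g ?P' r"
      interpret meander g ?P' r A
        using g A by unfold_locales (auto simp: Bset_def)
      have "transition q g (F A) S =
        (if i \<in> S \<and> j mod g \<notin> S then transition q g A (S - {i}) else 0) -
        (if i \<notin> S \<and> j mod g \<in> S then wrapq g q j * transition q g A (S - {j mod g}) else 0)"
        unfolding F_def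
        by (rule transition_insert[OF arcs_finite _ Sg(1) ij(1,2) adjacent_insert(2,3)[OF g A ij adj] ne])
          (use arcD in auto)
      moreover have "c' (F A) = c A"
        using A notin[OF A] by (auto simp: c'_def F_def)
      ultimately show "c' (F A) * transition q g (F A) S = c A *
       ((if i \<in> S \<and> j mod g \<notin> S then transition q g A (S - {i}) else 0) -
        (if i \<notin> S \<and> j mod g \<in> S then wrapq g q j * transition q g A (S - {j mod g}) else 0))"
        by simp
    qed
    also have "\<dots> = (if i \<in> S \<and> j mod g \<notin> S then \<Sum>A\<in>Bset g ?P' r. c A * transition q g A (S - {i}) else 0) -
        wrapq g q j *
          (if i \<notin> S \<and> j mod g \<in> S then \<Sum>A\<in>Bset g ?P' r. c A * transition q g A (S - {j mod g}) else 0)"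
      by (cases "i \<in> S"; cases "j mod g \<in> S")
        (simp_all add: sum_distrib_left sum_negf mult.left_commute)
    also have "\<dots> = (if i \<in> S \<and> j mod g \<notin> S then if S - {i} = S0 then k else 0 else 0) -
        wrapq g q j *
          (if i \<notin> S \<and> j mod g \<in> S then if S - {j mod g} = S0 then k else 0 else 0)"
    proof -
      have rs: "S - {x} \<in> rsets g ?P' r" if "x \<in> S" "{x, y} = {i, j mod g}" "y \<notin> S" for x y
      proof -
        have "nodes g ?P' = nodes g P - {x, y}"
          unfolding that(2) by (auto simp: nodes_def)
        then show ?thesis
          using S Sg(2) that(1,3) by (auto simp: rsets_def)
      qed
      have 1: "(if i \<in> S \<and> j mod g \<notin> S then \<Sum>A\<in>Bset g ?P' r. c A * transition q g A (S - {i}) else 0) =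
          (if i \<in> S \<and> j mod g \<notin> S then if S - {i} = S0 then k else 0 else 0)"
        by (rule if_cong[OF refl c[symmetric] refl]) (rule rs[of i "j mod g"], auto)
      have 2: "(if i \<notin> S \<and> j mod g \<in> S then \<Sum>A\<in>Bset g ?P' r. c A * transition q g A (S - {j mod g}) else 0) =
          (if i \<notin> S \<and> j mod g \<in> S then if S - {j mod g} = S0 then k else 0 else 0)"
        by (rule if_cong[OF refl c[symmetric] refl]) (rule rs[of "j mod g" i], auto)
      show ?thesis
        unfolding 1 2 ..
    qed
    also have "\<dots> = (if S = insert i S0 then k else 0) -
        wrapq g q j * (if S = insert (j mod g) S0 then k else 0)"
    proof -
      have 1: "(i \<in> S \<and> j mod g \<notin> S) \<and> S - {i} = S0 \<longleftrightarrow> S = insert i S0"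
        and 2: "(i \<notin> S \<and> j mod g \<in> S) \<and> S - {j mod g} = S0 \<longleftrightarrow> S = insert (j mod g) S0"
        using S0' ne by auto
      have n: "(if Q then if R then k else 0 else 0) = (if Q \<and> R then k else 0)" for Q R
        by simp
      show ?thesis
        unfolding n 1 2 ..
    qed
    finally show ?thesis ..
  qed
  then show ?thesis
    unfolding in_row_span_def by blast
qed

lemma Bset_0: "g > 0 \<Longrightarrow> Bset g P 0 = {{}}"
  by (auto simp: Bset_def semimeander_def lift_def)

text \<open>A point of one set outside the other lies below all points of the other, so one set
  would be strictly larger. This supplies the normal form of a monomial: the last nodes of the
  fundamental window.\<close>

lemma upset_unique:
  fixes N :: "int set"
  assumes fin: "finite N" and T: "T \<subseteq> N" "T' \<subseteq> N" "card T = card T'"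
    and up: "\<And>x y. x \<in> T \<Longrightarrow> y \<in> N \<Longrightarrow> x < y \<Longrightarrow> y \<in> T"
      "\<And>x y. x \<in> T' \<Longrightarrow> y \<in> N \<Longrightarrow> x < y \<Longrightarrow> y \<in> T'"
  shows "T = T'"
proof -
  have *: "T1 \<subseteq> T2" if "T1 \<subseteq> N" "T2 \<subseteq> N" "card T1 = card T2"
      "\<And>x y. x \<in> T1 \<Longrightarrow> y \<in> N \<Longrightarrow> x < y \<Longrightarrow> y \<in> T1"
      "\<And>x y. x \<in> T2 \<Longrightarrow> y \<in> N \<Longrightarrow> x < y \<Longrightarrow> y \<in> T2" for T1 T2
  proof (rule ccontr)
    assume "\<not> T1 \<subseteq> T2"
    then obtain x where x: "x \<in> T1" "x \<notin> T2" by blast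
    have "T2 \<subset> T1"
      using x that by (metis (full_types) in_mono linorder_less_linear psubsetI subsetI)
    then have "card T2 < card T1"
      using that(1) fin finite_subset psubset_card_mono by metis
    then show False using that by simp
  qed
  have "T \<subseteq> T'"
    by (rule *) (fact assms)+
  moreover have "finite T'"
    using T fin finite_subset by blast
  ultimately show ?thesis
    using T card_subset_eq by blast
qed

text \<open>Modulo the row space all monomials become equal, since chosen nodes can be moved to the right
  until they form the last block; moving one more across the cut gives \<open>f = q f\<close>.\<close>

lemma in_row_span_all:
  assumes g: "g > 0" and "2 * r \<le> card (nodes g P)" and "S \<in> rsets g P r"
  shows "in_row_span q g P r (\<lambda>S'. if S' = S then (1 - q) ^ r else 0)"
  using assms(2,3)
proof (induction r arbitrary: P S)
  case 0
  have "S' = {}" if "S' \<in> rsets g P 0" for S'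
    using that finite_subset[OF _ nodes_finite] by (auto simp: rsets_def)
  with 0 show ?case
    unfolding in_row_span_def by (intro exI[of _ "\<lambda>_. 1"]) (auto simp: Bset_0[OF g] transition_def transversal_def)
next
  case (Suc r)
  define N where "N = nodes g P"
  \<comment> \<open>The multiple of a monomial that the induction hypothesis yields in degree
    \<open>r\<close>; the cut will contribute one further factor.\<close>
  define k where "k = (1 - q) ^ r"
  define f where "f = (\<lambda>S S'. if S' = (S :: int set) then k else 0)"
  define eqW where "eqW = (\<lambda>S T. in_row_span q g P (Suc r) (\<lambda>S'. f S S' - f T S'))"
  have finN: "finite N"
    by (simp add: N_def nodes_finite)
  have refl: "eqW T T" for T
    unfolding eqW_def in_row_span_def by (intro exI[of _ "\<lambda>_. 0"]) simp
  have sym: "eqW T T'" if "eqW T' T" for T T'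
    using in_row_span_scale[OF that[unfolded eqW_def], of "- 1"] unfolding eqW_def
    by (rule in_row_span_cong) simp
  have trans: "eqW T T''" if "eqW T T'" "eqW T' T''" for T T' T''
    using in_row_span_add[OF that[unfolded eqW_def]] unfolding eqW_def
    by (rule in_row_span_cong) simp
  have adj: "in_row_span q g P (Suc r) (\<lambda>S'. f (insert i S0) S' - wrapq g q j * f (insert (j mod g) S0) S')"
    if ij: "0 \<le> i" "i < g" "i < j" "j < i + g" "i \<in> N" "j mod g \<in> N"
      and adj: "\<And>x. i < x \<Longrightarrow> x < j \<Longrightarrow> x mod g \<notin> N"
      and S0: "S0 \<subseteq> N - {i, j mod g}" "card S0 = r" for i j S0
  proof -
    have n: "nodes g (P \<union> {i, j mod g}) = N - {i, j mod g}"
      by (auto simp: N_def nodes_def)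
    have c: "card N - 2 \<le> card (N - {i, j mod g})"
      using diff_card_le_card_Diff[of "{i, j mod g}" N] card_insert_le_m1[of 2 "{j mod g}" i]
      by simp
    have "2 * r \<le> card (nodes g (P \<union> {i, j mod g}))"
      using c Suc.prems(1) unfolding n by (simp add: N_def)
    moreover have "S0 \<in> rsets g (P \<union> {i, j mod g}) r"
      using S0 unfolding rsets_def n by simp
    ultimately have "in_row_span q g (P \<union> {i, j mod g}) r (\<lambda>S. if S = S0 then (1 - q) ^ r else 0)"
      by (rule Suc.IH)
    moreover have "S0 \<in> rsets g (P \<union> {i, j mod g}) r"
      using S0 unfolding rsets_def n by simp
    ultimately show ?thesis
      unfolding f_def k_def using in_row_span_adjacent[OF g] ij adj unfolding N_def by blast
  qed
  have move: "eqW T (insert j (T - {i}))"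
    if T: "T \<in> rsets g P (Suc r)" and ij: "i \<in> T" "j \<in> N" "j \<notin> T" "i < j"
      and no: "\<And>x. i < x \<Longrightarrow> x < j \<Longrightarrow> x \<notin> N" for T i j
  proof -
    have "i \<in> N" "T \<subseteq> N" "finite T"
      using T ij finN finite_subset by (auto simp: rsets_def N_def)
    then have b: "0 \<le> i" "i < g" "j < g" "0 \<le> j" "j mod g = j"
      using ij by (auto simp: N_def nodes_def)
    have x: "x mod g = x" if "i < x" "x < j" for x
      using that b by simp
    have "in_row_span q g P (Suc r) (\<lambda>S'. f (insert i (T - {i})) S'
        - wrapq g q j * f (insert (j mod g) (T - {i})) S')"
      by (rule adj) (use b ij no x T \<open>T \<subseteq> N\<close> \<open>finite T\<close> \<open>i \<in> N\<close> in \<open>auto simp: rsets_def\<close>)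
    then show ?thesis
      using b ij(1) by (simp add: eqW_def wrapq_def insert_absorb)
  qed
  have ups: "\<exists>T\<in>rsets g P (Suc r). eqW S T \<and> (\<forall>x y. x \<in> T \<longrightarrow> y \<in> N \<longrightarrow> x < y \<longrightarrow> y \<in> T)"
    if S: "S \<in> rsets g P (Suc r)" for S
  proof -
    \<comment> \<open>The monomials congruent to \<open>S\<close>. One of largest node sum admits no
      further move to the right, which replaces an explicit sequence of moves.\<close>
    define C where "C = {T \<in> rsets g P (Suc r). eqW S T}"
    have C: "finite C" "S \<in> C"
      using S refl finite_rsets by (auto simp: C_def)
    obtain T where T: "T \<in> C" "\<And>T'. T' \<in> C \<Longrightarrow> \<Sum>T' \<le> \<Sum>T"
    proof -
      have "Max (Sum ` C) \<in> Sum ` C"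
        using C by (intro Max_in) auto
      then show ?thesis
        using that C by (metis (no_types, lifting) Max_ge finite_imageI imageE imageI)
    qed
    have TN: "T \<subseteq> N" "finite T" "card T = Suc r" "T \<in> rsets g P (Suc r)"
      using T finN finite_subset by (auto simp: C_def rsets_def N_def)
    have "y \<in> T" if xy: "x \<in> T" "y \<in> N" "x < y" for x y
    proof (rule ccontr)
      assume "y \<notin> T"
      \<comment> \<open>\<open>j\<close> is the nearest unoccupied node above \<open>x\<close>, and
        \<open>i\<close> the last occupied node before \<open>j\<close>. Hence no node separates
        them and the move from \<open>i\<close> to \<open>j\<close> is legal, raising the node
        sum.\<close>
      define J where "J = {z \<in> N. x < z \<and> z \<notin> T}"
      define j where "j = Min J"
      have J: "finite J" "y \<in> J"
        using xy \<open>y \<notin> T\<close> finN by (auto simp: J_def)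
      have j: "j \<in> J" "\<And>z. z \<in> J \<Longrightarrow> j \<le> z"
        unfolding j_def using J Min_in Min_le by blast+
      define I where "I = {z \<in> T. z < j}"
      define i where "i = Max I"
      have I: "finite I" "x \<in> I"
        using TN xy j by (auto simp: I_def J_def)
      have i: "i \<in> I" "\<And>z. z \<in> I \<Longrightarrow> z \<le> i"
        unfolding i_def using I Max_in Max_ge by blast+
      have no: "z \<notin> N" if "i < z" "z < j" for z
        using i(2)[of z] j(2)[of z] i(2)[OF I(2)] that by (auto simp: I_def J_def)
      have "eqW T (insert j (T - {i}))"
        by (rule move[OF TN(4)]) (use i j no in \<open>auto simp: I_def J_def\<close>)
      moreover have "insert j (T - {i}) \<in> rsets g P (Suc r)"
        using TN i j by (auto simp: rsets_def N_def[symmetric] I_def J_def)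
      ultimately have "insert j (T - {i}) \<in> C"
        using T(1) trans by (auto simp: C_def)
      moreover have "\<Sum>(insert j (T - {i})) > \<Sum>T"
        using TN i j by (auto simp: I_def J_def sum.remove)
      ultimately show False
        using T(2) by fastforce
    qed
    then show ?thesis
      using T by (auto simp: C_def)
  qed
  have all: "eqW S T" if ST: "S \<in> rsets g P (Suc r)" "T \<in> rsets g P (Suc r)" for S T
  proof -
    obtain S1 where S1: "S1 \<in> rsets g P (Suc r)" "eqW S S1"
        "\<And>x y. x \<in> S1 \<Longrightarrow> y \<in> N \<Longrightarrow> x < y \<Longrightarrow> y \<in> S1"
      using ups[OF ST(1)] by blast
    obtain T1 where T1: "T1 \<in> rsets g P (Suc r)" "eqW T T1"
        "\<And>x y. x \<in> T1 \<Longrightarrow> y \<in> N \<Longrightarrow> x < y \<Longrightarrow> y \<in> T1"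
      using ups[OF ST(2)] by blast
    have "S1 = T1"
      by (rule upset_unique[OF finN])
        (use S1 T1 in \<open>auto simp: rsets_def N_def[symmetric]\<close>)
    then show ?thesis
      using S1(2) T1(2) sym trans by blast
  qed
  define a where "a = Min N"
  define b where "b = Max N"
  have N2: "2 \<le> card N"
    using Suc.prems by (simp add: N_def)
  then have "N \<noteq> {}" by auto
  then have ab: "a \<in> N" "b \<in> N" "\<And>x. x \<in> N \<Longrightarrow> a \<le> x \<and> x \<le> b"
    unfolding a_def b_def using finN by auto
  have "a \<noteq> b"
  proof
    assume "a = b"
    then have "N \<subseteq> {a}"
      using ab by (auto intro: order_antisym)
    then show False
      using N2 card_mono[of "{a}" N] by simp
  qed
  then have "a < b"
    using ab by (meson linorder_not_less order_antisym)
  have bnd: "0 \<le> a" "b < g"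
    using ab by (auto simp: N_def nodes_def)
  have "card (N - {b, a}) = card N - 2"
    using \<open>a \<noteq> b\<close> ab finN by (simp add: card_Diff_subset)
  then have "r \<le> card (N - {b, a})"
    using Suc.prems by (simp add: N_def)
  then obtain S0 where S0: "S0 \<subseteq> N - {b, a}" "card S0 = r" "finite S0"
    using obtain_subset_with_card_n by metis
  have in_r: "insert a S0 \<in> rsets g P (Suc r)" "insert b S0 \<in> rsets g P (Suc r)"
    using S0 ab by (auto simp: rsets_def N_def[symmetric] card_insert_if)
  \<comment> \<open>The extreme nodes \<open>b\<close> and \<open>a + g\<close> are neighbours
    across the cut; this is the one place where \<open>wrapq\<close> takes the value
    \<open>q\<close>.\<close>
  have "in_row_span q g P (Suc r) (\<lambda>S'. f (insert b S0) S' - wrapq g q (a + g) * f (insert ((a + g) mod g) S0) S')"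
  proof (rule adj)
    show "x mod g \<notin> N" if x: "b < x" "x < a + g" for x
    proof (cases "x < g")
      case True
      then have "x mod g = x" using x bnd \<open>a < b\<close> by simp
      then show ?thesis using ab(3)[of x] x by auto
    next
      case False
      have "x mod g = (x - g) mod g" by simp
      also have "\<dots> = x - g" using x bnd False \<open>a < b\<close> by (intro mod_pos_pos_trivial) auto
      finally show ?thesis using ab(3)[of "x - g"] x by auto
    qed
  qed (use ab bnd \<open>a < b\<close> S0 in auto)
  then have w: "in_row_span q g P (Suc r) (\<lambda>S'. f (insert b S0) S' - q * f (insert a S0) S')"
    using bnd \<open>a < b\<close> by (simp add: wrapq_def)
  \<comment> \<open>The three differences telescope to \<open>(1 - q) * f S\<close>, and
    \<open>f S\<close> already carries \<open>(1 - q) ^ r\<close>.\<close>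
  have "in_row_span q g P (Suc r) (\<lambda>S'. (f S S' - f (insert b S0) S') + ((f (insert b S0) S' - q * f (insert a S0) S')
      + q * (f (insert a S0) S' - f S S')))"
    by (intro in_row_span_add w in_row_span_scale all[unfolded eqW_def] in_r Suc.prems(2))
  then show ?case
    by (rule in_row_span_cong) (simp add: f_def k_def algebra_simps)
qed

section \<open>Semi-meanders are determined by the left ends, and by the right ends, of their
  arcs\<close>

definition openers :: "(int \<times> int) set \<Rightarrow> int set" where
  "openers A = fst ` A"

definition closers :: "int \<Rightarrow> (int \<times> int) set \<Rightarrow> int set" where
  "closers g A = (\<lambda>(i, j). j mod g) ` A"

context meander
begin

lemma lift_base: "(x, y) \<in> lift g A \<Longrightarrow> 0 \<le> x \<Longrightarrow> x < g \<Longrightarrow> (x, y) \<in> A"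
proof (erule liftE)
  fix i j n assume *: "(i, j) \<in> A" "x = i + n * g" "y = j + n * g" and x: "0 \<le> x" "x < g"
  have "x mod g = i"
    using arcD[OF *(1)] *(2) by simp
  then have "x = i" using x by simp
  then have "n = 0" using * g_pos by simp
  then show "(x, y) \<in> A" using * by simp
qed

lemma opener_iff: "x mod g \<in> openers A \<longleftrightarrow> (\<exists>y. (x, y) \<in> lift g A)"
proof
  assume "x mod g \<in> openers A"
  then obtain j where j: "(x mod g, j) \<in> A"
    by (auto simp: openers_def)
  obtain k where "x = x mod g + k * g"
    using mod_eq_shift[of x g "x mod g"] by auto
  then have "(x, j + k * g) \<in> lift g A"
    using lift_of_arc[OF j, of g] lift_shift[of "x mod g" k g j A] by simp
  then show "\<exists>y. (x, y) \<in> lift g A" ..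
next
  assume "\<exists>y. (x, y) \<in> lift g A"
  then obtain i j n where "(i, j) \<in> A" "x = i + n * g"
    by (auto elim!: liftE)
  then show "x mod g \<in> openers A"
    using arc_mod[of i j] by (auto simp: openers_def intro!: rev_image_eqI)
qed

lemma closer_iff: "y mod g \<in> closers g A \<longleftrightarrow> (\<exists>x. (x, y) \<in> lift g A)"
proof
  assume "y mod g \<in> closers g A"
  then obtain i j where j: "(i, j) \<in> A" "y mod g = j mod g"
    by (auto simp: closers_def)
  obtain k where "y = j + k * g"
    using mod_eq_shift[of y g j] j by auto
  then have "(i + k * g, y) \<in> lift g A"
    using lift_of_arc[OF j(1), of g] lift_shift[of i k g j A] by simp
  then show "\<exists>x. (x, y) \<in> lift g A" ..
next
  assume "\<exists>x. (x, y) \<in> lift g A"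
  then show "y mod g \<in> closers g A"
    unfolding closers_def by (force elim!: liftE dest: arcD)
qed

text \<open>Distinct arcs share no node, so distinct arcs have distinct chosen ends. This turns sums
  and products over a monomial into ones over arcs.\<close>

lemma choice_bij:
  assumes "transversal g A S" "S \<subseteq> {0..<g}"
  shows "bij_betw (\<lambda>(i, j). if i \<in> S then i else j mod g) A S"
  unfolding bij_betw_def
proof
  show "inj_on (\<lambda>(i, j). if i \<in> S then i else j mod g) A"
    by (rule inj_onI) (use arcs_disjoint in \<open>auto split: if_splits\<close>)
  have "s \<in> (\<lambda>(i, j). if i \<in> S then i else j mod g) ` A" if s: "s \<in> S" for s
  proof -
    have sm: "s mod g = s"
      using assms(2) s by auto
    have "hasArc g A s"
      using assms s unfolding transversal_def by auto
    then obtain i j where ij: "(i, j) \<in> A" "s = i \<or> s = j mod g"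
      using sm arc_mod unfolding hasArc_iff by force
    have "(i \<in> S) \<noteq> (j mod g \<in> S)"
      using assms ij unfolding transversal_def by auto
    then show ?thesis
      using ij s by force
  qed
  moreover have "(\<lambda>(i, j). if i \<in> S then i else j mod g) ` A \<subseteq> S"
    using assms unfolding transversal_def by auto
  ultimately show "(\<lambda>(i, j). if i \<in> S then i else j mod g) ` A = S"
    by blast
qed

lemma openers_rsets: "openers A \<in> rsets g P r"
proof -
  have "inj_on fst A"
    by (rule inj_onI) (use arcs_disjoint in auto)
  then show ?thesis
    using arcD arcs_card by (auto simp: openers_def rsets_def card_image)
qed

lemma closers_rsets: "closers g A \<in> rsets g P r"
proof -
  have "inj_on (\<lambda>(i, j). j mod g) A"
    by (rule inj_onI) (use arcs_disjoint in auto)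
  then show ?thesis
    using arcD arcs_card by (auto simp: closers_def rsets_def card_image)
qed

lemma openers_not_closer: "(i, j) \<in> A \<Longrightarrow> j mod g \<notin> openers A"
  using opener_iff[of j] lift_not_both lift_of_arc by blast

lemma closers_not_opener: "(i, j) \<in> A \<Longrightarrow> i \<notin> closers g A"
  using closer_iff[of i] lift_not_both lift_of_arc arc_mod by metis

lemma transversal_openers: "transversal g A (openers A)"
  using openers_not_closer unfolding transversal_def
  by (auto simp: openers_def intro!: rev_image_eqI lift_of_arc hasArc_lift[THEN conjunct1])

lemma transversal_closers: "transversal g A (closers g A)"
proof -
  have "hasArc g A s" if "s \<in> closers g A" for s
    using that hasArc_lift[OF lift_of_arc] unfolding closers_def by (auto simp: hasArc_mod)
  moreover have "j mod g \<in> closers g A" if "(i, j) \<in> A" for i j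
    using that unfolding closers_def by (auto intro: rev_image_eqI)
  ultimately show ?thesis
    using closers_not_opener unfolding transversal_def by blast
qed

end

text \<open>Descent on the length of the arc of \<open>A\<close>. The node \<open>y\<close> lies
  beneath the arc of \<open>B\<close>, so it carries an arc of \<open>B\<close>; it is no left end,
  so it is the right end of an arc from some \<open>k\<close> with \<open>x < k\<close>. The arc of
  \<open>A\<close> that starts at \<open>k\<close> must end before \<open>y\<close>, and the pair of
  arcs from \<open>k\<close> is a smaller counterexample.\<close>

lemma opener_descent:
  assumes A: "meander g P r A" and B: "meander g P r B" and o: "openers A = openers B"
    and "(x, y) \<in> lift g A" "(x, y') \<in> lift g B" "y < y'"
  shows False
  using assms(4-6)
proof (induction "nat (y - x)" arbitrary: x y y' rule: less_induct)
  case less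
  interpret A: meander g P r A by fact
  interpret B: meander g P r B by fact
  have xy: "x < y" using A.liftD less.prems by blast
  have yn: "y mod g \<in> nodes g P" using A.liftD less.prems by blast
  have "hasArc g B y"
    using B.uncovered[OF yn _ less.prems(2)] xy less.prems(3) by blast
  moreover have "\<nexists>z. (y, z) \<in> lift g B"
    using A.opener_iff[of y] B.opener_iff[of y] o A.lift_not_both[OF less.prems(1)] by blast
  ultimately obtain k where k: "(k, y) \<in> lift g B"
    by (auto simp: hasArc_def)
  have "x < k"
    using B.noncrossing[OF k less.prems(2)] B.lift_left_unique[OF _ less.prems(2), of y] k xy
      less.prems(3) by (metis linorder_less_linear less_irrefl)
  have ky: "k < y" using B.liftD k by blast
  obtain m where m: "(k, m) \<in> lift g A"
    using k A.opener_iff[of k] B.opener_iff[of k] o by blast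
  have "m < y"
    using A.noncrossing[OF less.prems(1) m] A.lift_right_unique[OF less.prems(1), of k] m \<open>x < k\<close> ky
    by (metis linorder_less_linear less_irrefl)
  then show False
    using less.hyps[OF _ m k] A.liftD(1)[OF m] \<open>x < k\<close> by simp
qed

text \<open>Mirror image of \<open>opener_descent\<close>: the smaller counterexample consists of
  the two arcs that share the right end \<open>m\<close>.\<close>

lemma closer_descent:
  assumes A: "meander g P r A" and B: "meander g P r B" and o: "closers g A = closers g B"
    and "(x, y) \<in> lift g A" "(x', y) \<in> lift g B" "x' < x"
  shows False
  using assms(4-6)
proof (induction "nat (y - x)" arbitrary: x x' y rule: less_induct)
  case less
  interpret A: meander g P r A by fact
  interpret B: meander g P r B by fact
  have xy: "x < y" using A.liftD less.prems by blast
  have xn: "x mod g \<in> nodes g P" using A.liftD less.prems by blast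
  have "hasArc g B x"
    using B.uncovered[OF xn _ less.prems(2)] xy less.prems(3) by blast
  moreover have "\<nexists>z. (z, x) \<in> lift g B"
    using A.closer_iff[of x] B.closer_iff[of x] o A.lift_not_both[OF _ less.prems(1)] by blast
  ultimately obtain m where m: "(x, m) \<in> lift g B"
    by (auto simp: hasArc_def)
  have "m < y"
    using B.noncrossing[OF less.prems(2) m] B.lift_right_unique[OF _ less.prems(2), of x] m xy
      less.prems(3) by (metis linorder_less_linear less_irrefl)
  have xm: "x < m" using B.liftD m by blast
  obtain k where k: "(k, m) \<in> lift g A"
    using m A.closer_iff[of m] B.closer_iff[of m] o by blast
  have "x < k"
    using A.noncrossing[OF k less.prems(1)] A.lift_left_unique[OF less.prems(1), of m] k \<open>m < y\<close> xm
    by (metis linorder_less_linear less_irrefl)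
  then show False
    using less.hyps[OF _ k m] A.liftD(1)[OF k] \<open>m < y\<close> by simp
qed

lemma openers_eq_imp_subset:
  assumes A: "meander g P r A" and B: "meander g P r B" and o: "openers A = openers B"
  shows "A \<subseteq> B"
proof
  interpret A: meander g P r A by fact
  interpret B: meander g P r B by fact
  fix a assume a: "a \<in> A"
  obtain i j where ij: "a = (i, j)" by (cases a)
  have L: "(i, j) \<in> lift g A" using a ij lift_of_arc by auto
  have "i \<in> openers B" using a ij o unfolding openers_def by force
  then obtain j' where j': "(i, j') \<in> B" by (auto simp: openers_def)
  then have L': "(i, j') \<in> lift g B" by (rule lift_of_arc)
  have "j = j'"
    using opener_descent[OF A B o L L'] opener_descent[OF B A o[symmetric] L' L]
    by (meson linorder_less_linear)
  then show "a \<in> B" using j' ij by simp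
qed

lemma closers_eq_imp_subset:
  assumes A: "meander g P r A" and B: "meander g P r B" and o: "closers g A = closers g B"
  shows "A \<subseteq> B"
proof
  interpret A: meander g P r A by fact
  interpret B: meander g P r B by fact
  fix a assume a: "a \<in> A"
  obtain i j where ij: "a = (i, j)" by (cases a)
  have L: "(i, j) \<in> lift g A" using a ij lift_of_arc by auto
  then obtain i' where L': "(i', j) \<in> lift g B"
    using A.closer_iff[of j] B.closer_iff[of j] o by blast
  have "i = i'"
    using closer_descent[OF A B o L L'] closer_descent[OF B A o[symmetric] L' L]
    by (meson linorder_less_linear)
  then show "a \<in> B" using L' ij A.arcD a B.lift_base by auto
qed

lemma meander_Bset: "g > 0 \<Longrightarrow> A \<in> Bset g P r \<Longrightarrow> meander g P r A"
  by (simp add: Bset_def meander_def)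

lemma inj_openers: "g > 0 \<Longrightarrow> inj_on openers (Bset g P r)"
  using openers_eq_imp_subset meander_Bset by (intro inj_onI) (metis subset_antisym)

lemma inj_closers: "g > 0 \<Longrightarrow> inj_on (closers g) (Bset g P r)"
  using closers_eq_imp_subset meander_Bset by (intro inj_onI) (metis subset_antisym)

text \<open>Surjectivity without building a semi-meander: at q = 0 over the integers every monomial
  lies in the row span, so the matrix of rows would have determinant a unit; an \<open>r\<close>-set
  that is not a set of left ends would leave it with a zero row.\<close>

lemma bij_openers:
  assumes g: "g > 0" and r: "2 * r \<le> card (nodes g P)"
  shows "bij_betw openers (Bset g P r) (rsets g P r)"
  unfolding bij_betw_def
proof
  show inj: "inj_on openers (Bset g P r)"
    using g by (rule inj_openers)
  have sub: "openers ` Bset g P r \<subseteq> rsets g P r"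
    using meander.openers_rsets[OF meander_Bset[OF g]] by blast
  show "openers ` Bset g P r = rsets g P r"
  proof (rule ccontr)
    assume "openers ` Bset g P r \<noteq> rsets g P r"
    then obtain S0 where S0: "S0 \<in> rsets g P r" "S0 \<notin> openers ` Bset g P r"
      using sub by blast
    have "\<forall>S\<in>rsets g P r. \<exists>c. \<forall>S'\<in>rsets g P r.
      (if S' = S then (1 - 0) ^ r else 0) = (\<Sum>A\<in>Bset g P r. c A * transition (0 :: int) g A S')"
      using in_row_span_all[OF g r, of _ "0 :: int"] unfolding in_row_span_def by blast
    from bchoice[OF this] obtain c where c: "\<forall>S'\<in>rsets g P r.
      (if S' = S then (1 - 0) ^ r else 0) = (\<Sum>A\<in>Bset g P r. c S A * transition (0 :: int) g A S')"
      if "S \<in> rsets g P r" for S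
      by blast
    define iv where "iv = inv_into (Bset g P r) openers"
    define Y where "Y = (\<lambda>S T. c S (iv T))"
    \<comment> \<open>Rows are relabelled by \<open>r\<close>-sets to obtain a square matrix; a
      label that is not a set of left ends receives the zero row.\<close>
    define M where "M = (\<lambda>T S. if T \<in> openers ` Bset g P r then transition (0 :: int) g (iv T) S else 0)"
    have "(\<Sum>T\<in>rsets g P r. Y S T * M T S') = (if S = S' then 1 else 0)"
      if S: "S \<in> rsets g P r" "S' \<in> rsets g P r" for S S'
    proof -
      have "(\<Sum>T\<in>rsets g P r. Y S T * M T S') = (\<Sum>T\<in>openers ` Bset g P r. Y S T * M T S')"
        by (rule sum.mono_neutral_right) (use finite_rsets sub in \<open>auto simp: M_def\<close>)
      also have "\<dots> = (\<Sum>A\<in>Bset g P r. c S A * transition 0 g A S')"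
        unfolding sum.reindex[OF inj] by (rule sum.cong) (auto simp: Y_def M_def iv_def inj)
      also have "\<dots> = (if S = S' then 1 else 0)"
        using c[OF S(1), rule_format, OF S(2)] by (cases "S' = S") simp_all
      finally show ?thesis .
    qed
    then have "setdet (\<lambda>S S'. \<Sum>T\<in>rsets g P r. Y S T * M T S') (rsets g P r)
        = setdet (\<lambda>S S'. if S = S' then 1 else 0) (rsets g P r)"
      by (rule setdet_cong)
    also have "\<dots> = 1"
      using setdet_scalar[OF finite_rsets, of "1 :: int"] by simp
    finally have "setdet Y (rsets g P r) * setdet M (rsets g P r) = 1"
      by (simp add: setdet_mult[OF finite_rsets])
    moreover have "setdet M (rsets g P r) = 0"
      by (rule setdet_zero_row[OF finite_rsets S0(1)]) (simp add: M_def S0)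
    ultimately show False by simp
  qed
qed

lemma card_rsets: "card (rsets g P r) = card (nodes g P) choose r"
  unfolding rsets_def by (rule n_subsets[OF nodes_finite])

lemma card_Bset: "g > 0 \<Longrightarrow> 2 * r \<le> card (nodes g P) \<Longrightarrow> card (Bset g P r) = card (nodes g P) choose r"
  using bij_betw_same_card[OF bij_openers] by (simp add: card_rsets)

lemma bij_closers:
  assumes g: "g > 0" and r: "2 * r \<le> card (nodes g P)"
  shows "bij_betw (closers g) (Bset g P r) (rsets g P r)"
  unfolding bij_betw_def
proof
  show "closers g ` Bset g P r = rsets g P r"
  proof (rule card_subset_eq[OF finite_rsets])
    show "closers g ` Bset g P r \<subseteq> rsets g P r"
      using meander.closers_rsets[OF meander_Bset[OF g]] by blast
    show "card (closers g ` Bset g P r) = card (rsets g P r)"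
      using inj_closers[OF g] card_Bset[OF g r] by (simp add: card_image card_rsets)
  qed
qed (rule inj_closers[OF g])

section \<open>The determinant of the transition matrix\<close>

text \<open>The number of arcs across the cut, which is the degree in q of the row of
  \<open>A\<close>.\<close>

definition wraps :: "int \<Rightarrow> (int \<times> int) set \<Rightarrow> nat" where
  "wraps g A = card {a \<in> A. g \<le> snd a}"

lemma degree_prod_le_sum:
  assumes "finite S" and "\<And>a. a \<in> S \<Longrightarrow> degree (f a) \<le> n a"
  shows "degree (\<Prod>a\<in>S. f a) \<le> (\<Sum>a\<in>S. n a)"
  using assms
  by (induction S rule: finite_induct) (auto intro!: order_trans[OF degree_mult_le] add_mono)

lemma coeff_mult_bounds:
  assumes "degree p \<le> m" "degree q \<le> n"
  shows "coeff (p * q) (m + n) = coeff p m * coeff q n"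
proof -
  have "coeff (p * q) (m + n) = (\<Sum>i\<le>m + n. coeff p i * coeff q (m + n - i))"
    by (rule coeff_mult)
  also have "\<dots> = (\<Sum>i\<in>{m}. coeff p i * coeff q (m + n - i))"
  proof (rule sum.mono_neutral_right)
    show "\<forall>i\<in>{..m + n} - {m}. coeff p i * coeff q (m + n - i) = 0"
    proof
      fix i assume i: "i \<in> {..m + n} - {m}"
      then consider "i > m" | "m + n - i > n" by force
      then show "coeff p i * coeff q (m + n - i) = 0"
        using assms by cases (simp_all add: coeff_eq_0)
    qed
  qed auto
  finally show ?thesis by simp
qed

lemma coeff_prod_sum:
  assumes "finite S" and "\<And>a. a \<in> S \<Longrightarrow> degree (f a) \<le> n a"
  shows "coeff (\<Prod>a\<in>S. f a) (\<Sum>a\<in>S. n a) = (\<Prod>a\<in>S. coeff (f a) (n a))"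
  using assms
proof (induction S rule: finite_induct)
  case (insert x S)
  then have "degree (\<Prod>a\<in>S. f a) \<le> (\<Sum>a\<in>S. n a)"
    by (intro degree_prod_le_sum) auto
  then show ?case
    using insert by (simp add: coeff_mult_bounds)
qed simp

text \<open>With degree bounds that depend on the row alone, every term of the Leibniz sum has the
  same total bound, so passing to top coefficients commutes with the determinant.\<close>

lemma coeff_setdet:
  assumes fin: "finite S" and deg: "\<And>a b. a \<in> S \<Longrightarrow> b \<in> S \<Longrightarrow> degree (M a b) \<le> n a"
  shows "coeff (setdet M S) (\<Sum>a\<in>S. n a) = setdet (\<lambda>a b. coeff (M a b) (n a)) S"
    and "degree (setdet M S) \<le> (\<Sum>a\<in>S. n a)"
proof -
  have d: "degree (M a (p a)) \<le> n a" if "p permutes S" "a \<in> S" for p a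
    using deg that permutes_in_image by metis
  have c: "coeff (of_int (sign p) * q) k = of_int (sign p) * coeff q k" for p :: "'a \<Rightarrow> 'a" and q :: "'b poly" and k
    by (simp add: sign_def)
  show "coeff (setdet M S) (\<Sum>a\<in>S. n a) = setdet (\<lambda>a b. coeff (M a b) (n a)) S"
    unfolding setdet_def coeff_sum c
  proof (rule sum.cong[OF refl])
    fix p assume "p \<in> {p. p permutes S}"
    then show "of_int (sign p) * coeff (\<Prod>a\<in>S. M a (p a)) (\<Sum>a\<in>S. n a)
        = of_int (sign p) * (\<Prod>a\<in>S. coeff (M a (p a)) (n a))"
      using coeff_prod_sum[OF fin, of "\<lambda>a. M a (p a)" n] d by simp
  qed
  show "degree (setdet M S) \<le> (\<Sum>a\<in>S. n a)"
    unfolding setdet_def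
  proof (rule degree_sum_le)
    fix p assume "p \<in> {p. p permutes S}"
    then have "degree (\<Prod>a\<in>S. M a (p a)) \<le> (\<Sum>a\<in>S. n a)"
      using d fin by (intro degree_prod_le_sum) auto
    then show "degree (of_int (sign p) * (\<Prod>a\<in>S. M a (p a))) \<le> (\<Sum>a\<in>S. n a)"
      by (simp add: sign_def)
  qed (rule finite_permutations[OF fin])
qed

text \<open>The complementary factor has to vanish at 1, so one factor X - 1 can be cancelled from
  both sides at a time.\<close>

lemma dvd_linear_power_constant:
  fixes p :: "'a::field poly"
  assumes "p dvd [:-1, 1:] ^ k" "poly p 1 \<noteq> 0"
  shows "degree p = 0"
  using assms
proof (induction k)
  case 0
  then have "p dvd 1" "p \<noteq> 0" by auto
  then show ?case using is_unit_iff_degree by blast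
next
  case (Suc k)
  then obtain e where e: "[:-1, 1:] ^ Suc k = p * e" by (auto simp: dvd_def)
  have "poly ([:-1, 1:] ^ Suc k) (1 :: 'a) = 0"
    by (simp only: poly_power) simp
  then have "poly p 1 * poly e 1 = 0"
    unfolding e by simp
  then have "poly e 1 = 0" using Suc.prems by simp
  then obtain e' where e': "e = [:-1, 1:] * e'"
    by (auto simp: poly_eq_0_iff_dvd)
  have "[:-1, 1:] * [:-1, 1:] ^ k = [:-1, 1:] * (p * e')"
    using e unfolding e' by (simp only: power_Suc mult_ac)
  then have "[:-1, 1:] ^ k = p * e'"
    by (subst (asm) mult_cancel_left) simp
  then show ?case using Suc by simp
qed

text \<open>After the root 1 is split off with its multiplicity, the cofactor is constant by the
  preceding lemma, and the value at 0 determines that constant.\<close>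

lemma dvd_linear_power_eq:
  fixes p :: "'a::field poly"
  assumes p: "p dvd [:1, -1:] ^ k" and 0: "poly p 0 = 1"
  shows "p = [:1, -1:] ^ degree p"
proof -
  have "p \<noteq> 0" using 0 by auto
  then obtain e where e: "p = [:-1, 1:] ^ order 1 p * e" "\<not> [:-1, 1:] dvd e"
    using order_decomp[of p 1] by auto
  have l: "[:1, -1:] = (- 1) * ([:-1, 1:] :: 'a poly)" by simp
  have "e dvd [:1, -1:] ^ k"
    using p e(1) dvd_mult_right by metis
  then have "e dvd [:-1, 1:] ^ k"
    unfolding l power_mult_distrib by (simp add: dvd_mult_unit_iff' is_unit_power_iff)
  moreover have "poly e 1 \<noteq> 0"
    using e(2) by (simp add: poly_eq_0_iff_dvd)
  ultimately have "degree e = 0"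
    by (rule dvd_linear_power_constant)
  then obtain c where c: "e = [:c:]" by (rule degree_eq_zeroE)
  let ?m = "order 1 p"
  have pe: "p = [:-1, 1:] ^ ?m * [:c:]"
    using e(1) c by simp
  have "(- 1) ^ ?m * c = 1"
    using 0 arg_cong[OF pe, of "\<lambda>p. poly p 0"] by (simp only: poly_mult poly_power) simp
  then have "c = (- 1) ^ ?m"
    by (metis left_minus_one_mult_self mult.right_neutral)
  moreover have "(- 1) ^ n = [:(- 1) ^ n :: 'a:]" for n
    by (induction n) (simp_all add: one_pCons)
  ultimately have "[:c:] = (- 1) ^ ?m"
    by simp
  then have *: "p = [:1, -1:] ^ ?m"
    unfolding l power_mult_distrib using pe by (simp only: mult.commute)
  then have "degree p = ?m"
    by (metis One_nat_def degree_pCons_eq_if degree_power_eq mult.right_neutral neg_equal_0_iff_equal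
        one_neq_zero pCons_eq_0_iff degree_0 )
  then show ?thesis using * by simp
qed

lemma poly_transition: "poly (transition q g A S) x = transition (poly q x) g A S"
proof -
  have "poly (if i \<in> S then 1 else - wrapq g q j) x = (if i \<in> S then 1 else - wrapq g (poly q x) j)" for i j
    by (simp add: wrapq_def)
  then show ?thesis
    by (simp add: transition_def poly_prod case_prod_beta)
qed

text \<open>A permutation preserves the total of \<open>v\<close>, so the inequalities leave no
  slack. Applied to sums of chosen nodes, this isolates the only permutation that survives in the
  determinant.\<close>

lemma sum_permutes_eqI:
  fixes u v :: "'a \<Rightarrow> int"
  assumes fin: "finite B" and p: "p permutes B" and le: "\<And>a. a \<in> B \<Longrightarrow> u a \<le> v (p a)"
    and eq: "sum u B = sum v B" and a: "a \<in> B"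
  shows "v (p a) = u a"
proof -
  have "(\<Sum>a\<in>B. v (p a)) = sum v B"
    using sum.permute[OF p, of v] by (simp add: o_def)
  then have "(\<Sum>a\<in>B. v (p a) - u a) = 0"
    using eq by (simp add: sum_subtractf)
  then have "\<forall>a\<in>B. v (p a) - u a = 0"
    using le fin by (subst (asm) sum_nonneg_eq_0_iff) auto
  then show ?thesis using a by simp
qed

context meander
begin

text \<open>At q = 0 an arc across the cut can only contribute its left end, and on any other arc
  the right end is the larger choice. So the left ends are the unique monomial of least node
  sum.\<close>

lemma openers_sum_le:
  assumes S: "S \<subseteq> {0..<g}" and nz: "transition 0 g A S \<noteq> (0 :: 'a::idom)"
  shows "\<Sum>(openers A) \<le> \<Sum>S" and "\<Sum>S = \<Sum>(openers A) \<Longrightarrow> S = openers A"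
proof -
  define ch where "ch = (\<lambda>(i, j). if i \<in> S then i else j mod g)"
  have t: "transversal g A S"
    using nz by (rule contrapos_np) (simp add: transition_def)
  then have *: "(\<Prod>(i, j)\<in>A. if i \<in> S then 1 else - wrapq g 0 j) \<noteq> (0 :: 'a)"
    using nz by (simp add: transition_def)
  have w: "j < g" if "(i, j) \<in> A" "i \<notin> S" for i j
  proof (rule ccontr)
    assume "\<not> j < g"
    then have "(\<Prod>(i, j)\<in>A. if i \<in> S then 1 else - wrapq g 0 j) = (0 :: 'a)"
      using that by (intro prod_zero[OF arcs_finite] bexI[of _ "(i, j)"]) (simp_all add: wrapq_def)
    then show False
      using * by simp
  qed
  have le: "fst a \<le> ch a" if a: "a \<in> A" for a
  proof -
    obtain i j where ij: "a = (i, j)" by (cases a)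
    have "j mod g = j" if "i \<notin> S"
      using w[of i j] arcD[of i j] a ij that by simp
    then show ?thesis
      using arcD(3)[of i j] a ij by (simp add: ch_def)
  qed
  have b: "bij_betw ch A S"
    unfolding ch_def using t S by (rule choice_bij)
  have sS: "\<Sum>S = (\<Sum>a\<in>A. ch a)"
    using sum.reindex_bij_betw[OF b, of "\<lambda>x. x"] by simp
  have o: "\<Sum>(openers A) = (\<Sum>a\<in>A. fst a)"
  proof -
    have "inj_on fst A"
      by (rule inj_onI) (use arcs_disjoint in auto)
    then show ?thesis unfolding openers_def by (simp add: sum.reindex)
  qed
  show "\<Sum>(openers A) \<le> \<Sum>S"
    unfolding sS o by (rule sum_mono) (rule le)
  assume "\<Sum>S = \<Sum>(openers A)"
  then have "(\<Sum>a\<in>A. ch a - fst a) = 0"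
    unfolding sS o by (simp add: sum_subtractf)
  then have "\<forall>a\<in>A. ch a - fst a = 0"
    using le sum_nonneg_eq_0_iff[OF arcs_finite, of "\<lambda>a. ch a - fst a"] by simp
  then have "ch ` A = fst ` A"
    by (intro image_cong) auto
  then show "S = openers A"
    using b by (simp add: openers_def bij_betw_def)
qed

lemma transition_openers: "transition q g A (openers A) = 1"
proof -
  have "i \<in> openers A" if "(i, j) \<in> A" for i j
    using that by (force simp: openers_def)
  then show ?thesis
    using transversal_openers by (auto simp: transition_def intro!: prod.neutral)
qed

lemma degree_transition: "degree (transition [:0, 1 :: 'a::idom:] g A S) \<le> wraps g A"
proof (cases "transversal g A S")
  case True
  have "degree (\<Prod>a\<in>A. if fst a \<in> S then 1 else - wrapq g [:0, 1 :: 'a:] (snd a))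
      \<le> (\<Sum>a\<in>A. if g \<le> snd a then 1 else 0)"
    by (rule degree_prod_le_sum[OF arcs_finite]) (simp add: wrapq_def)
  also have "\<dots> = wraps g A"
    using arcs_finite by (simp add: wraps_def sum.If_cases Int_def)
  finally show ?thesis
    using True by (simp add: transition_def case_prod_beta)
qed (simp add: transition_def)

lemma coeff_transition:
  assumes t: "transversal g A S"
  shows "coeff (transition [:0, 1 :: 'a::idom:] g A S) (wraps g A) =
    (\<Prod>(i, j)\<in>A. if g \<le> j then if i \<in> S then 0 else - 1 else if i \<in> S then 1 else - 1)"
proof -
  have "wraps g A = (\<Sum>a\<in>A. if g \<le> snd a then 1 else 0)"
    using arcs_finite by (simp add: wraps_def sum.If_cases Int_def)
  moreover have "coeff (\<Prod>a\<in>A. if fst a \<in> S then 1 else - wrapq g [:0, 1 :: 'a:] (snd a))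
      (\<Sum>a\<in>A. if g \<le> snd a then 1 else 0) = (\<Prod>a\<in>A. coeff (if fst a \<in> S then 1 else
        - wrapq g [:0, 1 :: 'a:] (snd a)) (if g \<le> snd a then 1 else 0))"
    by (rule coeff_prod_sum[OF arcs_finite]) (simp add: wrapq_def)
  ultimately have "coeff (transition [:0, 1 :: 'a::idom:] g A S) (wraps g A) = (\<Prod>a\<in>A. coeff (if fst a \<in> S then 1 else
        - wrapq g [:0, 1 :: 'a:] (snd a)) (if g \<le> snd a then 1 else 0))"
    using t by (simp add: transition_def case_prod_beta)
  also have "\<dots> = (\<Prod>(i, j)\<in>A. if g \<le> j then if i \<in> S then 0 else - 1 else if i \<in> S then 1 else - 1)"
    by (rule prod.cong) (auto simp: wrapq_def)
  finally show ?thesis .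
qed

text \<open>Dual to \<open>openers_sum_le\<close>: in the top power of q an arc across the cut has
  to contribute its right end, and on any other arc the left end is the smaller choice.\<close>

lemma closers_sum_ge:
  assumes S: "S \<subseteq> {0..<g}" and nz: "coeff (transition [:0, 1 :: 'a::idom:] g A S) (wraps g A) \<noteq> 0"
  shows "\<Sum>S \<le> \<Sum>(closers g A)" and "\<Sum>S = \<Sum>(closers g A) \<Longrightarrow> S = closers g A"
proof -
  define ch where "ch = (\<lambda>(i, j). if i \<in> S then i else j mod g)"
  have t: "transversal g A S"
    using nz by (rule contrapos_np) (simp add: transition_def)
  have w: "j < g" if "(i, j) \<in> A" "i \<in> S" for i j
  proof (rule ccontr)
    assume "\<not> j < g"
    then have "(\<Prod>(i, j)\<in>A. if g \<le> j then if i \<in> S then 0 else - 1 else if i \<in> S then 1 else - 1) = (0 :: 'a)"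
      using that by (intro prod_zero[OF arcs_finite] bexI[of _ "(i, j)"]) simp_all
    then show False
      using nz coeff_transition[OF t, where 'a = 'a] by simp
  qed
  have le: "ch a \<le> snd a mod g" if a: "a \<in> A" for a
  proof -
    obtain i j where ij: "a = (i, j)" by (cases a)
    have "j mod g = j" if "i \<in> S"
      using w[of i j] arcD[of i j] a ij that by simp
    then show ?thesis
      using arcD(3)[of i j] a ij by (simp add: ch_def)
  qed
  have b: "bij_betw ch A S"
    unfolding ch_def using t S by (rule choice_bij)
  have sS: "\<Sum>S = (\<Sum>a\<in>A. ch a)"
    using sum.reindex_bij_betw[OF b, of "\<lambda>x. x"] by simp
  have o: "\<Sum>(closers g A) = (\<Sum>a\<in>A. snd a mod g)"
  proof -
    have "inj_on (\<lambda>(i, j). j mod g) A"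
      by (rule inj_onI) (use arcs_disjoint in auto)
    then have "\<Sum>((\<lambda>(i, j). j mod g) ` A) = (\<Sum>a\<in>A. case a of (i, j) \<Rightarrow> j mod g)"
      by (rule sum.reindex_cong[OF _ refl]) simp
    then show ?thesis unfolding closers_def by (simp add: case_prod_beta)
  qed
  show "\<Sum>S \<le> \<Sum>(closers g A)"
    unfolding sS o by (rule sum_mono) (rule le)
  assume "\<Sum>S = \<Sum>(closers g A)"
  then have "(\<Sum>a\<in>A. snd a mod g - ch a) = 0"
    unfolding sS o by (simp add: sum_subtractf)
  then have "\<forall>a\<in>A. snd a mod g - ch a = 0"
    using le sum_nonneg_eq_0_iff[OF arcs_finite, of "\<lambda>a. snd a mod g - ch a"] by simp
  then have "ch ` A = (\<lambda>(i, j). j mod g) ` A"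
    by (intro image_cong) auto
  then show "S = closers g A"
    using b by (simp add: closers_def bij_betw_def)
qed

lemma coeff_transition_closers: "coeff (transition [:0, 1 :: 'a::idom:] g A (closers g A)) (wraps g A) \<noteq> 0"
proof -
  have "(\<Prod>(i, j)\<in>A. if g \<le> j then if i \<in> closers g A then 0 else - 1 else if i \<in> closers g A then 1 else - 1)
      = (\<Prod>(i, j)\<in>A. - 1 :: 'a)"
    using closers_not_opener by (intro prod.cong) auto
  then show ?thesis
    by (simp add: coeff_transition[OF transversal_closers] case_prod_beta)
qed

end

context
  fixes g :: int and P :: "int set" and r :: nat
  assumes g: "g > 0" and r: "2 * r \<le> card (nodes g P)"
begin

text \<open>Columns are labelled by semi-meanders through their left ends. The matrix thereby
  becomes square over \<open>Bset\<close>, with diagonal entries 1.\<close>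

definition "transition_det = setdet (\<lambda>a b. transition [:0, 1 :: 'a::field:] g a (openers b)) (Bset g P r)"

lemma transition_det_0: "poly transition_det 0 = (1 :: 'a::field)"
proof -
  let ?B = "Bset g P r"
  note m = meander_Bset[OF g, of _ P r]
  have "poly transition_det 0 = setdet (\<lambda>a b. transition (0 :: 'a) g a (openers b)) ?B"
    by (simp add: transition_det_def poly_setdet poly_transition)
  also have "\<dots> = of_int (sign (id :: (int \<times> int) set \<Rightarrow> _)) * (\<Prod>a\<in>?B. transition (0 :: 'a) g a (openers (id a)))"
  proof (rule setdet_single_permutation[OF finite_Bset[OF g] permutes_id])
    fix p assume p: "p permutes ?B" and nz: "\<forall>a\<in>?B. transition (0 :: 'a) g a (openers (p a)) \<noteq> 0"
    have sub: "openers (p a) \<subseteq> {0..<g}" if "a \<in> ?B" for a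
      using meander.openers_rsets[OF m, of "p a"] permutes_in_image[OF p] that
      by (auto simp: rsets_def nodes_def)
    have "\<Sum>(openers (p a)) = \<Sum>(openers a)" if "a \<in> ?B" for a
      by (rule sum_permutes_eqI[OF finite_Bset[OF g] p])
        (use meander.openers_sum_le(1)[OF m sub] nz that in auto)
    then have "openers (p a) = openers a" if "a \<in> ?B" for a
      using meander.openers_sum_le(2)[OF m sub] nz that by blast
    then have "p a = a" if "a \<in> ?B" for a
      using inj_onD[OF inj_openers[OF g], of "p a" a] permutes_in_image[OF p] that by blast
    then show "p = id"
      using p by (metis eq_id_iff permutes_not_in)
  qed
  also have "\<dots> = 1"
    using meander.transition_openers[OF m] by (auto intro!: prod.neutral)
  finally show ?thesis .
qed

text \<open>The row degrees bound the degree by the total number of crossing arcs. The bound is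
  attained because the matrix of top coefficients is triangular up to a permutation and so
  contributes a single nonzero term.\<close>

lemma degree_transition_det: "degree (transition_det :: 'a::field poly) = (\<Sum>a\<in>Bset g P r. wraps g a)"
proof -
  let ?B = "Bset g P r" and ?W = "\<Sum>a\<in>Bset g P r. wraps g a"
  let ?q = "[:0, 1 :: 'a:]"
  note m = meander_Bset[OF g, of _ P r]
  note fin = finite_Bset[OF g, of P r]
  have deg: "degree (transition ?q g a (openers b)) \<le> wraps g a" if "a \<in> ?B" for a b
    using meander.degree_transition[OF m[OF that]] .
  have le: "degree (transition_det :: 'a poly) \<le> ?W"
    unfolding transition_det_def by (rule coeff_setdet(2)[OF fin deg])
  \<comment> \<open>\<open>p0 a\<close> is the semi-meander whose left ends are the right ends of
    \<open>a\<close>. It exists, and \<open>p0\<close> is a permutation, because left ends and right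
    ends both run bijectively over all \<open>r\<close>-sets.\<close>
  define p0 where "p0 = (\<lambda>a. if a \<in> ?B then inv_into ?B openers (closers g a) else a)"
  have clin: "closers g a \<in> openers ` ?B" if "a \<in> ?B" for a
    using bij_openers[OF g r] bij_closers[OF g r] that by (auto simp: bij_betw_def)
  have p0: "openers (p0 a) = closers g a" "p0 a \<in> ?B" if "a \<in> ?B" for a
    using f_inv_into_f[OF clin[OF that]] inv_into_into[OF clin[OF that]] that by (auto simp: p0_def)
  have p0_perm: "p0 permutes ?B"
  proof (rule bij_imp_permutes)
    have "bij_betw (inv_into ?B openers \<circ> closers g) ?B ?B"
      by (rule bij_betw_trans[OF bij_closers[OF g r] bij_betw_inv_into[OF bij_openers[OF g r]]])
    then show "bij_betw p0 ?B ?B"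
      by (rule bij_betw_cong[THEN iffD1, rotated]) (simp add: p0_def)
  qed (simp add: p0_def)
  have sums: "(\<Sum>a\<in>?B. \<Sum>(openers a)) = (\<Sum>a\<in>?B. \<Sum>(closers g a))"
    using sum.reindex_bij_betw[OF bij_openers[OF g r], of Sum]
      sum.reindex_bij_betw[OF bij_closers[OF g r], of Sum] by simp
  have "coeff (transition_det :: 'a poly) ?W = setdet (\<lambda>a b. coeff (transition ?q g a (openers b)) (wraps g a)) ?B"
    unfolding transition_det_def by (rule coeff_setdet(1)[OF fin deg])
  also have "\<dots> = of_int (sign p0) * (\<Prod>a\<in>?B. coeff (transition ?q g a (openers (p0 a))) (wraps g a))"
  proof (rule setdet_single_permutation[OF fin p0_perm])
    fix p assume p: "p permutes ?B" and nz: "\<forall>a\<in>?B. coeff (transition ?q g a (openers (p a))) (wraps g a) \<noteq> 0"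
    have sub: "openers (p a) \<subseteq> {0..<g}" if "a \<in> ?B" for a
      using meander.openers_rsets[OF m, of "p a"] permutes_in_image[OF p] that
      by (auto simp: rsets_def nodes_def)
    \<comment> \<open>Right ends maximise the node sum, so the signs are reversed to fit the
      direction of \<open>sum_permutes_eqI\<close>.\<close>
    have "- \<Sum>(openers (p a)) = - \<Sum>(closers g a)" if "a \<in> ?B" for a
      by (rule sum_permutes_eqI[OF fin p, where v = "\<lambda>a. - \<Sum>(openers a)"])
        (use meander.closers_sum_ge(1)[OF m sub] nz that in \<open>auto simp: sum_negf sums\<close>)
    then have s: "\<Sum>(openers (p a)) = \<Sum>(closers g a)" if "a \<in> ?B" for a
      using that by simp
    have "openers (p a) = closers g a" if a: "a \<in> ?B" for a
      by (rule meander.closers_sum_ge(2)[OF m[OF a] sub[OF a] bspec[OF nz a] s[OF a]])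
    then have "p a = p0 a" if "a \<in> ?B" for a
      using inj_onD[OF inj_openers[OF g], of "p a" "p0 a"] permutes_in_image[OF p] that p0[OF that] by metis
    then show "p = p0"
      using p p0_perm by (metis ext permutes_not_in)
  qed
  also have "\<dots> \<noteq> 0"
    using p0 meander.coeff_transition_closers[OF m] fin by (auto simp: sign_def)
  finally show ?thesis
    using le le_degree by (intro antisym) auto
qed

text \<open>Expressing \<open>(1 - q) ^ r\<close> times each monomial through the rows means that
  some matrix times the transition matrix is a scalar matrix; determinants then divide.\<close>

lemma transition_det_dvd: "(transition_det :: 'a::field poly) dvd [:1, -1:] ^ (r * card (Bset g P r))"
proof -
  let ?B = "Bset g P r" and ?q = "[:0, 1 :: 'a:]"
  have q: "1 - ?q = [:1, -1:]" by (simp add: one_pCons)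
  have "\<forall>S\<in>rsets g P r. \<exists>c. \<forall>S'\<in>rsets g P r.
      (if S' = S then (1 - ?q) ^ r else 0) = (\<Sum>A\<in>?B. c A * transition ?q g A S')"
    using in_row_span_all[OF g r, of _ ?q] unfolding in_row_span_def by blast
  from bchoice[OF this] obtain c where c: "\<And>S S'. S \<in> rsets g P r \<Longrightarrow> S' \<in> rsets g P r \<Longrightarrow>
      (\<Sum>A\<in>?B. c S A * transition ?q g A S') = (if S' = S then (1 - ?q) ^ r else 0)"
    by metis
  have "(\<Sum>A\<in>?B. c (openers a) A * transition ?q g A (openers b)) = (if a = b then (1 - ?q) ^ r else 0)"
    if "a \<in> ?B" "b \<in> ?B" for a b
  proof -
    have "openers a \<in> rsets g P r" "openers b \<in> rsets g P r"
      using that meander.openers_rsets[OF meander_Bset[OF g]] by auto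
    moreover have "openers b = openers a \<longleftrightarrow> a = b"
      using inj_openers[OF g] that by (auto dest: inj_onD)
    ultimately show ?thesis
      using c by simp
  qed
  then have "setdet (\<lambda>a b. \<Sum>A\<in>?B. c (openers a) A * transition ?q g A (openers b)) ?B
      = setdet (\<lambda>a b. if a = b then (1 - ?q) ^ r else 0) ?B"
    by (rule setdet_cong)
  then have "setdet (\<lambda>a A. c (openers a) A) ?B * transition_det = (1 - ?q) ^ (r * card ?B)"
    by (simp only: setdet_mult[OF finite_Bset[OF g]] setdet_scalar[OF finite_Bset[OF g]] transition_det_def power_mult)
  then show ?thesis
    unfolding q by (metis dvd_triv_right)
qed

lemma transition_det_eq: "(transition_det :: 'a::field poly) = [:1, -1:] ^ (\<Sum>a\<in>Bset g P r. wraps g a)"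
  using dvd_linear_power_eq[OF transition_det_dvd transition_det_0] by (simp only: degree_transition_det)

end

section \<open>Counting the arcs that cross the cut\<close>

definition free_nodes :: "int \<Rightarrow> int set \<Rightarrow> (int \<times> int) set \<Rightarrow> int set" where
  "free_nodes g P A = {x \<in> nodes g P. \<not> hasArc g A x}"

text \<open>The last free node is joined to the translate of the first one. The new arc encloses
  every other arc across the cut, hence it can be recognised and removed again.\<close>

definition add_outer_arc :: "int \<Rightarrow> int set \<Rightarrow> (int \<times> int) set \<Rightarrow> (int \<times> int) set" where
  "add_outer_arc g P A = insert (Max (free_nodes g P A), Min (free_nodes g P A) + g) A"

context meander
begin

lemma card_free_nodes: "card (free_nodes g P A) + 2 * r = card (nodes g P)"
proof -
  have iff: "hasArc g A x \<longleftrightarrow> x \<in> openers A \<or> x \<in> closers g A" if "x \<in> nodes g P" for x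
    using opener_iff[of x] closer_iff[of x] nodes_mod[OF that] by (auto simp: hasArc_def)
  have sub: "openers A \<subseteq> nodes g P" "closers g A \<subseteq> nodes g P" and card: "card (openers A) = r" "card (closers g A) = r"
    using openers_rsets closers_rsets by (auto simp: rsets_def)
  have fin: "finite (openers A)" "finite (closers g A)"
    using sub nodes_finite finite_subset by blast+
  have disj: "openers A \<inter> closers g A = {}"
    using closers_not_opener by (force simp: openers_def)
  have "nodes g P = free_nodes g P A \<union> (openers A \<union> closers g A)"
    using iff sub by (auto simp: free_nodes_def)
  moreover have "free_nodes g P A \<inter> (openers A \<union> closers g A) = {}"
    using iff by (auto simp: free_nodes_def)
  moreover have "finite (free_nodes g P A)"
    by (simp add: free_nodes_def nodes_finite)
  ultimately have "card (nodes g P) = card (free_nodes g P A) + card (openers A \<union> closers g A)"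
    using fin by (metis card_Un_disjoint finite_Un)
  also have "card (openers A \<union> closers g A) = 2 * r"
    using fin disj card by (simp add: card_Un_disjoint)
  finally show ?thesis by simp
qed

lemma finite_free_nodes: "finite (free_nodes g P A)"
  by (simp add: free_nodes_def nodes_finite)

end

locale big_meander = meander +
  assumes room: "2 * Suc r \<le> card (nodes g P)"
begin

abbreviation "lo \<equiv> Min (free_nodes g P A)"
abbreviation "hi \<equiv> Max (free_nodes g P A)"

lemma lo_hi: "lo \<in> free_nodes g P A" "hi \<in> free_nodes g P A" "lo < hi"
  "x \<in> free_nodes g P A \<Longrightarrow> lo \<le> x" "x \<in> free_nodes g P A \<Longrightarrow> x \<le> hi"
proof -
  have c: "card (free_nodes g P A) \<ge> 2"
    using card_free_nodes room by simp
  then have ne: "free_nodes g P A \<noteq> {}" by auto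
  show l: "lo \<in> free_nodes g P A" and h: "hi \<in> free_nodes g P A"
    using finite_free_nodes ne by (auto intro: Min_in Max_in)
  have b: "lo \<le> x" "x \<le> hi" if "x \<in> free_nodes g P A" for x
    using that finite_free_nodes by auto
  show "x \<in> free_nodes g P A \<Longrightarrow> lo \<le> x" "x \<in> free_nodes g P A \<Longrightarrow> x \<le> hi"
    using b by auto
  show "lo < hi"
  proof (rule ccontr)
    assume "\<not> lo < hi"
    then have "free_nodes g P A \<subseteq> {lo}"
      using b by force
    then show False
      using c card_mono[of "{lo}" "free_nodes g P A"] by simp
  qed
qed

lemma free_nodesD: "x \<in> free_nodes g P A \<Longrightarrow> 0 \<le> x \<and> x < g \<and> x mod g \<in> nodes g P \<and> \<not> hasArc g A x"
  using nodes_mod by (auto simp: free_nodes_def nodes_def)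

text \<open>Otherwise the free node \<open>hi\<close> would lie beneath the arc.\<close>

lemma wrap_inside:
  assumes "(c, e) \<in> A" "g \<le> e" shows "hi < c"
proof (rule ccontr)
  assume "\<not> hi < c"
  moreover have "hasArc g A c"
    using hasArc_lift[OF lift_of_arc] assms by blast
  then have "c \<noteq> hi"
    using free_nodesD lo_hi by auto
  ultimately show False
    using uncovered[of hi c e] free_nodesD lo_hi(2) assms lift_of_arc by fastforce
qed

lemma new_arc: "(hi, lo + g) \<notin> A"
  using free_nodesD[OF lo_hi(2)] hasArc_lift[OF lift_of_arc] by blast

lemma outer_arc_Bset: "add_outer_arc g P A \<in> Bset g P (Suc r)"
proof -
  note l = free_nodesD[OF lo_hi(1)] and h = free_nodesD[OF lo_hi(2)]
  have l': "(lo + g) mod g \<in> nodes g P" "\<not> hasArc g A (lo + g)"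
    using l hasArc_shift[of g A lo 1] by auto
  have "semimeander g P (Suc r) (insert (hi, lo + g) A)"
  proof (rule semimeander_insert[OF g_pos arcs_finite arcs_card])
    show "0 \<le> a \<and> a < g \<and> a < b \<and> b < a + g \<and> a mod g \<in> nodes g P \<and> b mod g \<in> nodes g P"
      if "(a, b) \<in> A" for a b
      using arcD[OF that] by auto
    show "{a mod g, b mod g} \<inter> {c mod g, e mod g} = {}"
      if ab: "(a, b) \<in> A" and ce: "(c, e) \<in> A" and ne: "(a, b) \<noteq> (c, e)" for a b c e
      using arcs_disjoint[OF ab ce] ne arc_mod[OF ab] arc_mod[OF ce] by auto
    show "\<not> (a < hi \<and> hi < b \<and> b < lo + g) \<and> \<not> (hi < a \<and> a < lo + g \<and> lo + g < b)"
      if "(a, b) \<in> lift g A" for a b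
      using uncovered[OF _ _ that, of hi] uncovered[OF _ _ that, of "lo + g"] l' h by blast
    show "\<not> (a < x \<and> x < b)"
      if "x mod g \<in> nodes g P" "\<not> hasArc g A x" "(a, b) \<in> lift g A" for x a b
      using uncovered that by blast
    show "\<not> (hi < x \<and> x < lo + g)" if x: "x mod g \<in> nodes g P" "\<not> hasArc g A x" for x
    proof
      assume b: "hi < x \<and> x < lo + g"
      show False
      proof (cases "x < g")
        case True
        then have "x \<in> free_nodes g P A"
          using x b h by (simp add: free_nodes_def)
        then show False using lo_hi(5) b by force
      next
        case False
        have "x mod g = (x - g) mod g" by simp
        also have "\<dots> = x - g"
          using False b l by (intro mod_pos_pos_trivial) auto
        finally have "x - g \<in> free_nodes g P A"
          using x hasArc_mod[of g A x] by (simp add: free_nodes_def)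
        then show False using lo_hi(4) b by force
      qed
    qed
  qed (use l h l' lo_hi(3) noncrossing in auto)
  then show ?thesis
    by (simp add: Bset_def add_outer_arc_def)
qed

lemma wraps_outer_arc: "wraps g (add_outer_arc g P A) = Suc (wraps g A)"
proof -
  have "{a \<in> add_outer_arc g P A. g \<le> snd a} = insert (hi, lo + g) {a \<in> A. g \<le> snd a}"
    using free_nodesD[OF lo_hi(1)] by (auto simp: add_outer_arc_def)
  then show ?thesis
    using new_arc arcs_finite by (simp add: wraps_def)
qed

end

text \<open>If the two new arcs differed, each would be an old arc across the cut of the other
  semi-meander and so would start strictly to the right of the other.\<close>

lemma outer_arc_inj:
  assumes A: "big_meander g P r A" and B: "big_meander g P r B" and eq: "add_outer_arc g P A = add_outer_arc g P B"
  shows "A = B"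
proof -
  interpret A: big_meander g P r A by fact
  interpret B: big_meander g P r B by fact
  have a: "(A.hi, A.lo + g) \<in> insert (B.hi, B.lo + g) B" and b: "(B.hi, B.lo + g) \<in> insert (A.hi, A.lo + g) A"
    using eq unfolding add_outer_arc_def by (metis insertI1)+
  have le: "g \<le> A.lo + g" "g \<le> B.lo + g"
    using A.free_nodesD[OF A.lo_hi(1)] B.free_nodesD[OF B.lo_hi(1)] by auto
  have "(A.hi, A.lo + g) = (B.hi, B.lo + g)"
  proof (rule ccontr)
    assume "\<not> ?thesis"
    then have "(A.hi, A.lo + g) \<in> B" "(B.hi, B.lo + g) \<in> A"
      using a b by auto
    then show False
      using A.wrap_inside B.wrap_inside le by force
  qed
  then show ?thesis
    using eq A.new_arc B.new_arc unfolding add_outer_arc_def by (metis insert_ident prod.inject)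
qed

text \<open>The arc across the cut with the leftmost left end is removed. Nothing encloses it, so
  its two ends become free nodes, and every node that was free before lies between them in the
  window.\<close>

lemma outer_arc_surj:
  assumes m: "meander g P (Suc r) A" and w: "wraps g A > 0"
  shows "\<exists>B \<in> Bset g P r. A = add_outer_arc g P B"
proof -
  interpret meander g P "Suc r" A by fact
  define W where "W = {a \<in> A. g \<le> snd a}"
  have W: "finite W" "W \<noteq> {}"
    using w arcs_finite unfolding wraps_def W_def by (auto simp: card_gt_0_iff)
  obtain a where a: "a \<in> W" "\<And>b. b \<in> W \<Longrightarrow> fst a \<le> fst b"
  proof -
    have "Min (fst ` W) \<in> fst ` W"
      using W by (intro Min_in) auto
    then show ?thesis
      using that W by (metis (no_types, lifting) Min_le finite_imageI imageE imageI)
  qed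
  obtain i j where ij: "a = (i, j)" by (cases a)
  have aA: "(i, j) \<in> A" "g \<le> j" and min: "\<And>c e. (c, e) \<in> A \<Longrightarrow> g \<le> e \<Longrightarrow> i \<le> c"
    using a ij by (force simp: W_def)+
  note d = arcD[OF aA(1)]
  have L: "(i, j) \<in> lift g A" using aA by (rule_tac lift_of_arc)
  \<comment> \<open>An enclosing arc is shorter than \<open>g\<close>, so its left end is
    nonnegative; it would be an arc of the window across the cut with a smaller left end than
    \<open>i\<close>.\<close>
  have outer: "\<not> (c < i \<and> j < e)" if "(c, e) \<in> lift g A" for c e
  proof
    assume *: "c < i \<and> j < e"
    then have "0 \<le> c"
      using liftD(2)[OF that] aA by linarith
    then have "(c, e) \<in> A"
      using lift_base[OF that] * d by simp
    then show False
      using min[of c e] * aA by simp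
  qed
  define B where "B = A - {(i, j)}"
  have AB: "A = insert (i, j) B" and BA: "B \<subseteq> A"
    using aA by (auto simp: B_def)
  have LB: "(x, y) \<in> lift g A" if "(x, y) \<in> lift g B" for x y
    using lift_mono[OF BA that] .
  have free: "\<not> hasArc g B x" if "x mod g = i mod g \<or> x mod g = j mod g" for x
  proof
    assume "hasArc g B x"
    then obtain c e where ce: "(c, e) \<in> B" "x mod g = c mod g \<or> x mod g = e mod g"
      by (auto simp: hasArc_iff)
    then have "(c, e) \<in> A" "(c, e) \<noteq> (i, j)" by (auto simp: B_def)
    then show False
      using arcs_disjoint[OF aA(1), of c e] ce(2) that arc_mod[of c e] arc_mod[OF aA(1)] by auto
  qed
  have hA: "hasArc g A x \<longleftrightarrow> hasArc g B x \<or> x mod g = i mod g \<or> x mod g = j mod g" for x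
    unfolding AB hasArc_insert ..
  have unc: "\<not> (c < x \<and> x < e)"
    if x: "x mod g \<in> nodes g P" "\<not> hasArc g B x" and ce: "(c, e) \<in> lift g B" for x c e
  proof
    assume cxe: "c < x \<and> x < e"
    consider "\<not> hasArc g A x" | "x mod g = i mod g" | "x mod g = j mod g"
      using x hA by blast
    then show False
    proof cases
      case 1
      then show ?thesis
        using uncovered[OF x(1) _ LB[OF ce]] cxe by blast
    next
      case 2
      then obtain k where k: "i = x + k * g"
        using mod_eq_shift[of i g x] by auto
      have ce': "(c + k * g, e + k * g) \<in> lift g B"
        using ce by (simp add: lift_shift)
      have "e + k * g \<noteq> j"
        using free[of j] hasArc_lift[OF ce'] by auto
      then show ?thesis
        using noncrossing[OF LB[OF ce'] L] outer[OF LB[OF ce']] cxe k by linarith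
    next
      case 3
      then obtain k where k: "j = x + k * g"
        using mod_eq_shift[of j g x] by auto
      have ce': "(c + k * g, e + k * g) \<in> lift g B"
        using ce by (simp add: lift_shift)
      have "c + k * g \<noteq> i"
        using free[of i] hasArc_lift[OF ce'] by auto
      then show ?thesis
        using noncrossing[OF L LB[OF ce']] outer[OF LB[OF ce']] cxe k by linarith
    qed
  qed
  have "semimeander g P r B"
    unfolding semimeander_def
  proof (intro conjI)
    show "finite B" "card B = r"
      using arcs_finite arcs_card aA by (auto simp: B_def)
    show "\<forall>(i, j)\<in>B. 0 \<le> i \<and> i < g \<and> i < j \<and> j < i + g \<and> i mod g \<in> nodes g P \<and> j mod g \<in> nodes g P"
      using BA arcD arc_mod by fastforce
    show "\<forall>(i, j)\<in>B. \<forall>(i', j')\<in>B. (i, j) \<noteq> (i', j') \<longrightarrow> {i mod g, j mod g} \<inter> {i' mod g, j' mod g} = {}"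
    proof (clarify, rule ccontr)
      fix p q p' q'
      assume *: "(p, q) \<in> B" "(p', q') \<in> B" "\<not> (p = p' \<and> q = q')"
        "{p mod g, q mod g} \<inter> {p' mod g, q' mod g} \<noteq> {}"
      then have "(p, q) \<in> A" "(p', q') \<in> A" using BA by auto
      then show False
        using arcs_disjoint[of p q p' q'] * arc_mod by auto
    qed
    show "\<forall>(a, b)\<in>lift g B. \<forall>(c, e)\<in>lift g B. \<not> (a < c \<and> c < b \<and> b < e)"
      using noncrossing LB by blast
    show "\<forall>x. x mod g \<in> nodes g P \<and> \<not> hasArc g B x \<longrightarrow> \<not> (\<exists>(a, b)\<in>lift g B. a < x \<and> x < b)"
      using unc by blast
  qed
  moreover have jm: "j mod g = j - g"
  proof -
    have "j mod g = (j - g) mod g" by simp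
    also have "\<dots> = j - g" using aA d by (intro mod_pos_pos_trivial) auto
    finally show ?thesis .
  qed
  have cases_semi: "x = i \<or> x = j - g \<or> x \<in> nodes g P \<and> \<not> hasArc g A x" if "x \<in> free_nodes g P B" for x
    using that hA[of x] nodes_mod[of x g P] arc_mod[OF aA(1)] jm by (auto simp: free_nodes_def)
  have "i \<in> free_nodes g P B"
    using d free[of i] by (simp add: free_nodes_def)
  moreover have "j - g \<in> free_nodes g P B"
    using d free[of "j - g"] jm by (simp add: free_nodes_def)
  moreover have "j - g \<le> x \<and> x \<le> i" if x: "x \<in> free_nodes g P B" for x
  proof -
    consider "x = i" | "x = j - g" | "x \<in> nodes g P" "\<not> hasArc g A x"
      using cases_semi[OF x] by blast
    then show ?thesis
    proof cases
      case 3
      have "\<not> hasArc g A (x + g)" "(x + g) mod g \<in> nodes g P" "x mod g \<in> nodes g P"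
        using 3 hasArc_shift[of g A x 1] nodes_mod[of x g P] by auto
      moreover have "0 \<le> x" "x < g"
        using 3 by (auto simp: nodes_def)
      ultimately show ?thesis
        using uncovered[OF _ _ L, of x] uncovered[OF _ _ L, of "x + g"] 3 aA d by force
    qed (use d in auto)
  qed
  moreover have "finite (free_nodes g P B)"
    by (simp add: free_nodes_def nodes_finite)
  ultimately have "Max (free_nodes g P B) = i" "Min (free_nodes g P B) = j - g" "semimeander g P r B"
    by (auto intro!: Max_eqI Min_eqI)
  then show ?thesis
    using AB by (auto simp: add_outer_arc_def Bset_def)
qed

text \<open>Adding the outer arc maps the semi-meanders with \<open>r\<close> arcs bijectively onto
  those with \<open>Suc r\<close> arcs that cross the cut at all, and raises the count by one. The
  total therefore grows by the number of semi-meanders with \<open>r\<close> arcs, a binomial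
  coefficient.\<close>

lemma sum_wraps:
  assumes g: "g > 0" and "2 * r \<le> card (nodes g P)"
  shows "(\<Sum>A\<in>Bset g P r. wraps g A) = tdr (card (nodes g P)) r"
  using assms(2)
proof (induction r)
  case 0
  then show ?case by (simp add: Bset_0[OF g] wraps_def tdr_def)
next
  case (Suc r)
  have bm: "big_meander g P r A" if "A \<in> Bset g P r" for A
    using meander_Bset[OF g that] Suc.prems by (simp add: big_meander_def big_meander_axioms_def)
  have inj: "inj_on (add_outer_arc g P) (Bset g P r)"
    by (rule inj_onI) (use outer_arc_inj bm in blast)
  have sub: "add_outer_arc g P ` Bset g P r \<subseteq> Bset g P (Suc r)"
    using big_meander.outer_arc_Bset[OF bm] by blast
  have "(\<Sum>A\<in>Bset g P (Suc r). wraps g A) = (\<Sum>A\<in>add_outer_arc g P ` Bset g P r. wraps g A)"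
  proof (rule sum.mono_neutral_right[OF finite_Bset[OF g] sub], rule ballI)
    fix A assume A: "A \<in> Bset g P (Suc r) - add_outer_arc g P ` Bset g P r"
    then show "wraps g A = 0"
      using outer_arc_surj[OF meander_Bset[OF g], of A P r] by blast
  qed
  also have "\<dots> = (\<Sum>A\<in>Bset g P r. Suc (wraps g A))"
    unfolding sum.reindex[OF inj] using big_meander.wraps_outer_arc[OF bm] by simp
  also have "\<dots> = tdr (card (nodes g P)) (Suc r)"
    using Suc by (simp add: sum_Suc card_Bset[OF g] tdr_def)
  finally show ?case .
qed

theorem det_transition:
  fixes q :: "'a::field"
  assumes g: "g > 0" and r: "2 * r \<le> card (nodes g P)"
  shows "setdet (\<lambda>a b. transition q g a (openers b)) (Bset g P r) = (1 - q) ^ tdr (card (nodes g P)) r"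
proof -
  have "setdet (\<lambda>a b. transition q g a (openers b)) (Bset g P r) = poly (transition_det g P r) q"
    by (simp add: transition_det_def[OF g r] poly_setdet poly_transition)
  also have "\<dots> = (1 - q) ^ tdr (card (nodes g P)) r"
    unfolding transition_det_eq[OF g r] sum_wraps[OF g r] poly_power by simp
  finally show ?thesis .
qed

section \<open>Signs along alternating walks\<close>

lemma prod_pairs: "(\<Prod>j<2 * n. G j) = (\<Prod>t<n. G (2 * t) * G (2 * t + 1))"
  for G :: "nat \<Rightarrow> 'a::comm_monoid_mult"
  by (induction n) (simp_all add: mult.assoc)

lemma prod_odd_pairs: "(\<Prod>j<Suc (2 * n). G j) = G 0 * (\<Prod>t<n. G (2 * t + 1) * G (2 * t + 2))"
  for G :: "nat \<Rightarrow> 'a::comm_monoid_mult"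
  by (induction n) (simp_all add: mult.assoc)

text \<open>The left side is the inversion sign of the sequence. If consecutive pairs do not
  interlock, the four comparisons between two different pairs multiply to 1 and only the comparisons
  inside the pairs remain.\<close>

lemma sgn_prod_pairs:
  fixes f :: "nat \<Rightarrow> int"
  assumes "\<And>t s. t < s \<Longrightarrow> s < n \<Longrightarrow> sgn (f (2 * s) - f (2 * t)) * sgn (f (2 * s) - f (2 * t + 1)) *
      sgn (f (2 * s + 1) - f (2 * t)) * sgn (f (2 * s + 1) - f (2 * t + 1)) = 1"
  shows "(\<Prod>l<2 * n. \<Prod>j<l. sgn (f l - f j)) = (\<Prod>t<n. sgn (f (2 * t + 1) - f (2 * t)))"
  using assms
proof (induction n)
  case (Suc n)
  let ?G = "\<lambda>j. sgn (f (2 * n) - f j) * sgn (f (2 * n + 1) - f j)"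
  have "(\<Prod>j<2 * n. ?G j) = (\<Prod>t<n. ?G (2 * t) * ?G (2 * t + 1))"
    by (rule prod_pairs)
  also have "\<dots> = 1"
    using Suc.prems[of _ n] by (intro prod.neutral) (simp add: mult_ac)
  finally have G: "(\<Prod>j<2 * n. ?G j) = 1" .
  have "(\<Prod>l<2 * Suc n. \<Prod>j<l. sgn (f l - f j))
      = (\<Prod>l<2 * n. \<Prod>j<l. sgn (f l - f j)) * (\<Prod>j<2 * n. ?G j) * sgn (f (2 * n + 1) - f (2 * n))"
    by (simp add: prod.distrib mult_ac)
  also have "(\<Prod>l<2 * n. \<Prod>j<l. sgn (f l - f j)) = (\<Prod>t<n. sgn (f (2 * t + 1) - f (2 * t)))"
    using Suc.prems by (intro Suc.IH) simp
  also note G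
  also have "(\<Prod>t<n. sgn (f (2 * t + 1) - f (2 * t))) * 1 * sgn (f (2 * n + 1) - f (2 * n))
      = (\<Prod>t<Suc n. sgn (f (2 * t + 1) - f (2 * t)))"
    by simp
  finally show ?case .
qed simp

text \<open>Compares the two ways of cutting a walk with alternately noncrossing steps into pairs: both
  inversion signs are given by the directions of the steps, and they differ only in the end points.\<close>

lemma step_signs:
  fixes p :: "nat \<Rightarrow> int"
  assumes k: "2 * m = Suc k" and inj: "inj_on p {1..<2 * m}"
    and even: "\<And>t s. t < s \<Longrightarrow> s < m \<Longrightarrow> sgn (p (2 * s) - p (2 * t)) * sgn (p (2 * s) - p (2 * t + 1)) *
      sgn (p (2 * s + 1) - p (2 * t)) * sgn (p (2 * s + 1) - p (2 * t + 1)) = 1"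
    and odd: "\<And>t s. t < s \<Longrightarrow> s < m \<Longrightarrow> sgn (p (2 * s + 1) - p (2 * t + 1)) *
      sgn (p (2 * s + 1) - p (2 * t + 2)) *
      sgn (p (2 * s + 2) - p (2 * t + 1)) * sgn (p (2 * s + 2) - p (2 * t + 2)) = 1"
  shows "(\<Prod>j<2 * m. sgn (p (Suc j) - p j)) =
    (\<Prod>l<k. sgn (p (Suc l) - p 0)) * (\<Prod>j<k. sgn (p (2 * m) - p (Suc j)))"
proof -
  \<comment> \<open>The inversion sign of the points \<open>p 1\<close> to \<open>p k\<close>, which
    both pairings share; being a sign, it cancels when the two are multiplied.\<close>
  define U where "U = (\<Prod>l<k. \<Prod>j<l. sgn (p (Suc l) - p (Suc j)))"
  have "sgn (p (Suc l) - p (Suc j)) * sgn (p (Suc l) - p (Suc j)) = 1" if "l < k" "j < l" for l j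
  proof -
    have "p (Suc l) \<noteq> p (Suc j)"
      using inj_onD[OF inj, of "Suc l" "Suc j"] that k by auto
    then show ?thesis by (auto simp: sgn_if)
  qed
  then have UU: "U * U = 1"
    by (simp add: U_def prod.distrib[symmetric])
  have "(\<Prod>j<2 * m. sgn (p (Suc j) - p j)) = (\<Prod>t<m. sgn (p (2 * t + 1) - p (2 * t))) *
      (\<Prod>t<m. sgn (p (2 * t + 2) - p (2 * t + 1)))"
    by (simp add: prod_pairs prod.distrib)
  also have "(\<Prod>t<m. sgn (p (2 * t + 1) - p (2 * t))) = (\<Prod>l<2 * m. \<Prod>j<l. sgn (p l - p j))"
    by (rule sgn_prod_pairs[symmetric]) (rule even)
  also have "\<dots> = (\<Prod>l<k. sgn (p (Suc l) - p 0)) * U"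
    unfolding k prod.lessThan_Suc_shift U_def by (simp add: prod.distrib)
  also have "(\<Prod>t<m. sgn (p (2 * t + 2) - p (2 * t + 1))) = (\<Prod>l<2 * m. \<Prod>j<l. sgn (p (Suc l) - p (Suc j)))"
    using sgn_prod_pairs[of m "\<lambda>j. p (Suc j)"] odd by simp
  also have "\<dots> = U * (\<Prod>j<k. sgn (p (2 * m) - p (Suc j)))"
    unfolding k U_def by simp
  finally show ?thesis
    using UU by (simp add: mult_ac)
qed

text \<open>One half of a lifted diagram as an involution: it exchanges the ends of each arc and
  fixes every other integer. The condition \<open>nc\<close> combines two facts, that arcs do not
  cross and that a free node lies beneath no arc. In this form the upper and the lower half are on
  an equal footing.\<close>

locale ncinv =
  fixes g :: int and \<alpha> :: "int \<Rightarrow> int" and N :: "int set"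
  assumes g_pos: "g > 0" and per: "\<alpha> (x + g) = \<alpha> x + g" and inv: "\<alpha> (\<alpha> x) = x"
    and supp: "\<alpha> x \<noteq> x \<Longrightarrow> x \<in> N" and N_per: "x + g \<in> N \<longleftrightarrow> x \<in> N"
    and nc: "x < \<alpha> x \<Longrightarrow> x < y \<Longrightarrow> y < \<alpha> x \<Longrightarrow> y \<in> N \<Longrightarrow> \<alpha> y \<noteq> y \<and> x < \<alpha> y \<and> \<alpha> y < \<alpha> x"
begin

lemma per_k: "\<alpha> (x + k * g) = \<alpha> x + k * g"
proof -
  have 1: "\<alpha> (x + int n * g) = \<alpha> x + int n * g" for n x
  proof (induction n)
    case (Suc n)
    have "\<alpha> (x + int (Suc n) * g) = \<alpha> ((x + int n * g) + g)"
      by (simp add: algebra_simps)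
    then show ?case
      using Suc unfolding per by (simp add: algebra_simps)
  qed simp
  show ?thesis
  proof (cases "k \<ge> 0")
    case True
    then show ?thesis using 1[of x "nat k"] by simp
  next
    case False
    then show ?thesis using 1[of "x + k * g" "nat (- k)"] by simp
  qed
qed

lemma N_per_k: "x + k * g \<in> N \<longleftrightarrow> x \<in> N"
proof -
  have 1: "x + int n * g \<in> N \<longleftrightarrow> x \<in> N" for n x
  proof (induction n)
    case (Suc n)
    have "x + int (Suc n) * g = (x + int n * g) + g"
      by (simp add: algebra_simps)
    then show ?case
      using Suc N_per[of "x + int n * g"] by metis
  qed simp
  show ?thesis
  proof (cases "k \<ge> 0")
    case True
    then show ?thesis using 1[of x "nat k"] by simp
  next
    case False
    then show ?thesis using 1[of "x + k * g" "nat (- k)"] by simp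
  qed
qed

lemma fix_iff: "\<alpha> (\<alpha> x) = \<alpha> x \<longleftrightarrow> \<alpha> x = x"
  using inv by metis

text \<open>Applying the involution twice gives \<open>x = x + 2 * k * g\<close>, so
  \<open>k = 0\<close>.\<close>

lemma eq_shift_imp_fixed: "\<alpha> x = x + k * g \<Longrightarrow> \<alpha> x = x"
  using inv[of x] per_k[of x k] g_pos by auto

lemma in_N: "x \<in> N \<Longrightarrow> \<alpha> x \<in> N"
  using supp fix_iff by metis

text \<open>A longer arc would cover \<open>x + g\<close>, whose mate is the translate of the right
  end and so lies outside.\<close>

lemma dist_lt: "\<alpha> x < x + g" "x < \<alpha> x + g"
proof -
  have *: "\<alpha> x < x + g" for x
  proof (rule ccontr)
    assume a: "\<not> \<alpha> x < x + g"
    moreover have "\<alpha> x \<noteq> x + g"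
      using eq_shift_imp_fixed[of x 1] g_pos by auto
    ultimately have b: "x < \<alpha> x" "x < x + g" "x + g < \<alpha> x"
      using g_pos by auto
    then have "x + g \<in> N"
      using supp[of x] N_per by auto
    from nc[OF b this] show False
      using g_pos by (simp add: per)
  qed
  show "\<alpha> x < x + g" by (rule *)
  show "x < \<alpha> x + g" using *[of "\<alpha> x"] by (simp add: inv)
qed

lemma nc_between:
  assumes "min x (\<alpha> x) < y" "y < max x (\<alpha> x)" "y \<in> N"
  shows "\<alpha> y \<noteq> y" "min x (\<alpha> x) < \<alpha> y" "\<alpha> y < max x (\<alpha> x)"
  using nc[of x y] nc[of "\<alpha> x" y] assms by (auto simp: inv min_def max_def split: if_splits)

lemma sgn_mult_between:
  assumes "y \<noteq> x" "y \<noteq> x'"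
  shows "sgn (y - x) * sgn (y - x') = (if min x x' < y \<and> y < max x x' then - 1 else 1 :: int)"
  using assms by (auto simp: sgn_if min_def max_def)

text \<open>Noncrossing as an identity of signs: the ends of one arc lie both inside or both outside
  the other.\<close>

lemma nc_sgn4:
  assumes x: "\<alpha> x \<noteq> x" and y: "\<alpha> y \<noteq> y" and ne: "y \<noteq> x" "y \<noteq> \<alpha> x"
  shows "sgn (y - x) * sgn (y - \<alpha> x) * sgn (\<alpha> y - x) * sgn (\<alpha> y - \<alpha> x) = 1"
proof -
  have ne': "\<alpha> y \<noteq> x" "\<alpha> y \<noteq> \<alpha> x"
    using ne inv by metis+
  have "(min x (\<alpha> x) < y \<and> y < max x (\<alpha> x)) \<longleftrightarrow> (min x (\<alpha> x) < \<alpha> y \<and> \<alpha> y < max x (\<alpha> x))"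
    using nc_between(2,3)[of x y] nc_between(2,3)[of x "\<alpha> y"] supp[OF y] in_N[OF supp[OF y]]
    unfolding inv by blast
  then show ?thesis
    using sgn_mult_between[OF ne] sgn_mult_between[OF ne'] by (simp add: mult.assoc)
qed

text \<open>A free node lies beneath no arc, so it sees both ends of the arc on the same
  side.\<close>

lemma uncovered_sgn:
  assumes "y \<in> N" "\<alpha> y = y" "\<alpha> x \<noteq> x"
  shows "sgn (y - x) * sgn (y - \<alpha> x) = 1"
proof -
  have "y \<noteq> x" "y \<noteq> \<alpha> x"
    using assms inv by metis+
  moreover have "\<not> (min x (\<alpha> x) < y \<and> y < max x (\<alpha> x))"
    using nc_between(1)[of x y] assms by blast
  ultimately show ?thesis
    by (simp add: sgn_mult_between)
qed

end

text \<open>Traverses a component of the diagram by upper and lower arcs in turn. At a free end the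
  walk stands still for one step and then retraces its way.\<close>

fun walk :: "(int \<Rightarrow> int) \<Rightarrow> (int \<Rightarrow> int) \<Rightarrow> int \<Rightarrow> nat \<Rightarrow> int" where
  "walk \<alpha> \<beta> x 0 = x"
| "walk \<alpha> \<beta> x (Suc j) = (if even j then \<alpha> else \<beta>) (walk \<alpha> \<beta> x j)"

locale ncpair = a: ncinv g \<alpha> N + b: ncinv g \<beta> N for g \<alpha> \<beta> N
begin

lemma swap: "ncpair g \<beta> \<alpha> N"
  by (simp add: ncpair_def a.ncinv_axioms b.ncinv_axioms)

abbreviation "w \<equiv> walk \<alpha> \<beta>"

lemma w_shift: "w (x + k * g) j = w x j + k * g"
  by (induction j) (simp_all add: a.per_k b.per_k)

lemma w_add: "w x (2 * m + j) = w (w x (2 * m)) j"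
  by (induction j) simp_all

lemma w_back: "(if even j then \<alpha> else \<beta>) (w x (Suc j)) = w x j"
  by (simp add: a.inv b.inv)

lemma w_N: "x \<in> N \<Longrightarrow> w x j \<in> N"
  by (induction j) (simp_all add: a.in_N b.in_N)

lemma w_inj: "w x (2 * m) = w y (2 * m) \<Longrightarrow> x = y"
proof (induction m)
  case (Suc m)
  then have "\<beta> (\<alpha> (w x (2 * m))) = \<beta> (\<alpha> (w y (2 * m)))"
    by simp
  then have "\<alpha> (\<beta> (\<beta> (\<alpha> (w x (2 * m))))) = \<alpha> (\<beta> (\<beta> (\<alpha> (w y (2 * m)))))"
    by (rule arg_cong)
  then have "w x (2 * m) = w y (2 * m)"
    unfolding a.inv b.inv .
  then show ?case by (rule Suc.IH)
qed simp

text \<open>Two even times have congruent positions by the pigeonhole principle, and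
  \<open>w_inj\<close> rewinds the coincidence to the start.\<close>

lemma w_return: "\<exists>n k. n \<ge> 1 \<and> w x (2 * n) = x + k * g"
proof -
  let ?f = "\<lambda>n. w x (2 * n) mod g"
  have "range ?f \<subseteq> {0..<g}"
    using a.g_pos by auto
  then have "finite (range ?f)"
    by (rule finite_subset) simp
  then have "\<not> inj ?f"
    using finite_imageD infinite_UNIV_nat by blast
  then obtain i j where "i \<noteq> j" "?f i = ?f j"
    unfolding inj_def by blast
  then obtain i j where ij: "i < j" "?f j = ?f i"
    using that[of i j] that[of j i] by (cases "i < j") auto
  then obtain k where k: "w x (2 * j) = w x (2 * i) + k * g"
    using mod_eq_shift by blast
  have "2 * (j - i) + 2 * i = 2 * j"
    using ij by simp
  then have "w (w x (2 * (j - i))) (2 * i) = w (x + k * g) (2 * i)"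
    using w_add[of x "j - i" "2 * i"] k w_shift[of x k "2 * i"] by metis
  then have "w x (2 * (j - i)) = x + k * g"
    by (rule w_inj)
  then show ?thesis
    using ij by (intro exI[of _ "j - i"]) auto
qed

text \<open>Walking towards each other from two congruent points of opposite parity, one meets at a point
  congruent to its neighbour, hence at a fixed point.\<close>

lemma w_meet:
  assumes "w x (i + 2 * d + 1) = w x i + k * g"
  shows "\<exists>l. i \<le> l \<and> l < i + 2 * d + 1 \<and> w x (Suc l) = w x l"
  using assms
proof (induction d arbitrary: i)
  case 0
  then have "(if even i then \<alpha> else \<beta>) (w x i) = w x i + k * g"
    by simp
  then have "w x (Suc i) = w x i"
    using a.eq_shift_imp_fixed[of "w x i" k] b.eq_shift_imp_fixed[of "w x i" k]
    by (cases "even i") simp_all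
  then show ?case by auto
next
  case (Suc d)
  \<comment> \<open>\<open>i\<close> and \<open>?j\<close> have the same parity, so one step forward
    from the front and one step back from the rear use the same involution.\<close>
  let ?s = "if even i then \<alpha> else \<beta>" and ?j = "i + 2 * d + 2"
  have "w x ?j = ?s (w x (Suc ?j))"
    using w_back[of ?j x] by simp
  also have "w x (Suc ?j) = w x i + k * g"
    using Suc.prems by (simp add: numeral_eq_Suc del: walk.simps)
  also have "?s (w x i + k * g) = w x (Suc i) + k * g"
    by (simp add: a.per_k b.per_k)
  finally have "w x (Suc i + 2 * d + 1) = w x (Suc i) + k * g"
    by (simp del: walk.simps)
  from Suc.IH[OF this] obtain l where "Suc i \<le> l" "l < Suc i + 2 * d + 1" "w x (Suc l) = w x l"
    by blast
  then show ?case by (intro exI[of _ l]) auto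
qed

lemma w_rewind: "w x (i + 2 * d) = w x i + k * g \<Longrightarrow> w x (2 * d) = x + k * g"
proof (induction i)
  case (Suc i)
  let ?s = "if even i then \<alpha> else \<beta>" and ?j = "i + 2 * d"
  have "w x ?j = ?s (w x (Suc ?j))"
    using w_back[of ?j x] by simp
  also have "w x (Suc ?j) = w x (Suc i) + k * g"
    using Suc.prems by (simp del: walk.simps)
  also have "?s (w x (Suc i) + k * g) = ?s (w x (Suc i)) + k * g"
    by (simp add: a.per_k b.per_k)
  also have "?s (w x (Suc i)) = w x i"
    by (rule w_back)
  finally show ?case
    by (rule Suc.IH)
qed simp

end

section \<open>Repetitions along a walk: closed loops and paths\<close>

context ncpair
begin

lemma w_steps:
  "\<alpha> (w x (2 * t)) = w x (2 * t + 1)" "\<alpha> (w x (2 * t + 1)) = w x (2 * t)"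
  "\<beta> (w x (2 * t + 1)) = w x (2 * t + 2)" "\<beta> (w x (2 * t + 2)) = w x (2 * t + 1)"
  by (simp_all add: a.inv b.inv)

lemma walk_sgn4_even:
  assumes "w x (2 * t + 1) \<noteq> w x (2 * t)" "w y (2 * s + 1) \<noteq> w y (2 * s)"
    "w y (2 * s) + c * g \<noteq> w x (2 * t)" "w y (2 * s) + c * g \<noteq> w x (2 * t + 1)"
  shows "sgn (w y (2 * s) + c * g - w x (2 * t)) * sgn (w y (2 * s) + c * g - w x (2 * t + 1)) *
    sgn (w y (2 * s + 1) + c * g - w x (2 * t)) * sgn (w y (2 * s + 1) + c * g - w x (2 * t + 1)) = 1"
  using a.nc_sgn4[of "w x (2 * t)" "w y (2 * s) + c * g"] assms
  unfolding a.per_k w_steps by simp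

lemma walk_sgn4_odd:
  assumes "w x (2 * t + 2) \<noteq> w x (2 * t + 1)" "w y (2 * s + 2) \<noteq> w y (2 * s + 1)"
    "w y (2 * s + 1) + c * g \<noteq> w x (2 * t + 1)" "w y (2 * s + 1) + c * g \<noteq> w x (2 * t + 2)"
  shows "sgn (w y (2 * s + 1) + c * g - w x (2 * t + 1)) * sgn (w y (2 * s + 1) + c * g - w x (2 * t + 2)) *
    sgn (w y (2 * s + 2) + c * g - w x (2 * t + 1)) * sgn (w y (2 * s + 2) + c * g - w x (2 * t + 2)) = 1"
  using b.nc_sgn4[of "w x (2 * t + 1)" "w y (2 * s + 1) + c * g"] assms
  unfolding b.per_k w_steps by simp

text \<open>An instance of \<open>step_signs\<close>: pairs that begin at an even time are upper
  arcs, pairs that begin at an odd time are lower arcs.\<close>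

lemma walk_signs:
  assumes k: "2 * m = Suc k" and nofix: "\<And>j. j < 2 * m \<Longrightarrow> w x (Suc j) \<noteq> w x j"
    and inj0: "inj_on (w x) {..<2 * m}" and inj1: "inj_on (w x) {1..2 * m}"
  shows "(\<Prod>j<2 * m. sgn (w x (Suc j) - w x j)) =
    (\<Prod>l<k. sgn (w x (Suc l) - x)) * (\<Prod>j<k. sgn (w x (2 * m) - w x (Suc j)))"
proof -
  have "(\<Prod>j<2 * m. sgn (w x (Suc j) - w x j)) =
    (\<Prod>l<k. sgn (w x (Suc l) - w x 0)) * (\<Prod>j<k. sgn (w x (2 * m) - w x (Suc j)))"
  proof (rule step_signs[OF k])
    show "inj_on (w x) {1..<2 * m}"
      using inj1 by (rule inj_on_subset) auto
    fix t s assume ts: "t < s" "s < m"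
    have p: "2 * s \<noteq> 2 * t + 1" "2 * s + 1 \<noteq> 2 * t + 2"
      by presburger+
    have ne: "w x (2 * s) \<noteq> w x (2 * t)" "w x (2 * s) \<noteq> w x (2 * t + 1)"
      using inj_onD[OF inj0, of "2 * s" "2 * t"] inj_onD[OF inj0, of "2 * s" "2 * t + 1"] p ts
      by (auto simp del: walk.simps)
    have ne': "w x (2 * s + 1) \<noteq> w x (2 * t + 1)" "w x (2 * s + 1) \<noteq> w x (2 * t + 2)"
      using inj_onD[OF inj1, of "2 * s + 1" "2 * t + 1"] inj_onD[OF inj1, of "2 * s + 1" "2 * t + 2"] p ts
      by (auto simp del: walk.simps)
    show "sgn (w x (2 * s) - w x (2 * t)) * sgn (w x (2 * s) - w x (2 * t + 1)) *
      sgn (w x (2 * s + 1) - w x (2 * t)) * sgn (w x (2 * s + 1) - w x (2 * t + 1)) = 1"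
      using walk_sgn4_even[of x t x s 0] nofix[of "2 * t"] nofix[of "2 * s"] ne ts
      by (simp del: walk.simps)
    show "sgn (w x (2 * s + 1) - w x (2 * t + 1)) * sgn (w x (2 * s + 1) - w x (2 * t + 2)) *
      sgn (w x (2 * s + 2) - w x (2 * t + 1)) * sgn (w x (2 * s + 2) - w x (2 * t + 2)) = 1"
      using walk_sgn4_odd[of x t x s 0] nofix[of "2 * t + 1"] nofix[of "2 * s + 1"] ne' ts
      by (simp del: walk.simps)
  qed
  then show ?thesis by simp
qed

text \<open>\<open>n\<close> is the least return time modulo translation. An earlier repetition at
  even distance would rewind to a smaller return time, and one at odd distance would produce a fixed
  point by \<open>w_meet\<close>.\<close>

lemma loop_data:
  assumes nofix: "\<And>j. w x (Suc j) \<noteq> w x j"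
  obtains n k where "n \<ge> 1" "w x (2 * n) = x + k * g"
    "\<And>i j. i < 2 * n \<Longrightarrow> j < 2 * n \<Longrightarrow> w x i mod g = w x j mod g \<Longrightarrow> i = j"
proof -
  define n where "n = (LEAST n. n \<ge> 1 \<and> (\<exists>k. w x (2 * n) = x + k * g))"
  have n: "n \<ge> 1 \<and> (\<exists>k. w x (2 * n) = x + k * g)"
    unfolding n_def by (rule LeastI_ex) (use w_return in blast)
  have least: "\<not> (m \<ge> 1 \<and> (\<exists>k. w x (2 * m) = x + k * g))" if "m < n" for m
    using not_less_Least that unfolding n_def by blast
  have *: False if ij: "i < j" "j < 2 * n" "w x j mod g = w x i mod g" for i j
  proof -
    obtain k where k: "w x j = w x i + k * g"
      using ij(3) mod_eq_shift by blast
    show False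
    proof (cases "even (j - i)")
      case True
      then obtain d where "j - i = 2 * d" by (elim evenE)
      then have d: "j = i + 2 * d" "d \<ge> 1" "d < n" using ij by auto
      then show False
        using w_rewind[of x i d k] k least[of d] by auto
    next
      case False
      then obtain d where "j - i = 2 * d + 1" by (elim oddE)
      then have d: "j = i + 2 * d + 1" using ij by auto
      show False
        using w_meet[of x i d k] k nofix unfolding d by blast
    qed
  qed
  obtain k where "w x (2 * n) = x + k * g"
    using n by blast
  then show ?thesis
    using that[of n k] n * by (metis linorder_neqE_nat)
qed

text \<open>The last of the \<open>2 * d\<close> steps applies \<beta> and arrives at a translate of
  \<open>x\<close>, which \<beta> fixes; so that step did not move.\<close>

lemma path_fixed:
  assumes "\<beta> x = x" "d \<ge> 1" "w x (2 * d) = x + k * g"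
  shows "w x (Suc (2 * d - 1)) = w x (2 * d - 1)"
proof -
  obtain t where t: "d = Suc t" using assms by (cases d) auto
  have "\<beta> (w x (2 * d)) = w x (2 * d)"
    unfolding assms(3) b.per_k assms(1) ..
  moreover have "2 * d = 2 * t + 2" "2 * d - 1 = 2 * t + 1" using t by auto
  ultimately show ?thesis
    using w_steps(4)[of x t] by (simp del: walk.simps)
qed

text \<open>\<open>e\<close> is the time of the first step that stands still, that is, the other end
  of the path. Any repetition before it would force an earlier such step, through
  \<open>path_fixed\<close> or \<open>w_meet\<close>.\<close>

lemma path_data:
  assumes x: "\<beta> x = x"
  obtains e where "w x (Suc e) = w x e" "\<And>j. j < e \<Longrightarrow> w x (Suc j) \<noteq> w x j"
    "\<And>i j. i \<le> e \<Longrightarrow> j \<le> e \<Longrightarrow> w x i mod g = w x j mod g \<Longrightarrow> i = j"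
proof -
  define e where "e = (LEAST e. w x (Suc e) = w x e)"
  have ex: "\<exists>e. w x (Suc e) = w x e"
    using w_return[of x] path_fixed[OF x] by metis
  have e: "w x (Suc e) = w x e"
    unfolding e_def by (rule LeastI_ex[OF ex])
  have least: "w x (Suc j) \<noteq> w x j" if "j < e" for j
    using not_less_Least that unfolding e_def by blast
  have *: False if ij: "i < j" "j \<le> e" "w x j mod g = w x i mod g" for i j
  proof -
    obtain k where k: "w x j = w x i + k * g"
      using ij(3) mod_eq_shift by blast
    show False
    proof (cases "even (j - i)")
      case True
      then obtain d where "j - i = 2 * d" by (elim evenE)
      then have d: "j = i + 2 * d" "d \<ge> 1" using ij by auto
      then have "w x (2 * d) = x + k * g"
        using w_rewind[of x i d k] k by simp
      then have "w x (Suc (2 * d - 1)) = w x (2 * d - 1)"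
        by (rule path_fixed[OF x d(2)])
      moreover have "2 * d - 1 < e" using d ij by auto
      ultimately show False
        using least by blast
    next
      case False
      then obtain d where "j - i = 2 * d + 1" by (elim oddE)
      then have d: "j = i + 2 * d + 1" using ij by auto
      then obtain l where "l < j" "w x (Suc l) = w x l"
        using w_meet[of x i d k] k by blast
      then show False
        using least[of l] ij by simp
    qed
  qed
  show ?thesis
    using that[OF e least] * by (metis linorder_neqE_nat)
qed

lemma path_closed:
  assumes x: "\<beta> x = x" and e: "w x (Suc e) = w x e" and j: "j \<le> e"
  shows "\<alpha> (w x j) \<in> w x ` {..e}" "\<beta> (w x j) \<in> w x ` {..e}"
proof -
  have f: "w x (Suc j) \<in> w x ` {..e}"
    using j e imageI[of "Suc j" "{..e}" "w x"] by (cases "j = e") (auto simp del: walk.simps)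
  have b: "(if even i then \<alpha> else \<beta>) (w x j) \<in> w x ` {..e}" if "j = Suc i" for i
    using w_back[of i x] that j by (auto simp del: walk.simps)
  have "\<alpha> (w x j) \<in> w x ` {..e} \<and> \<beta> (w x j) \<in> w x ` {..e}"
  proof (cases j)
    case 0
    then show ?thesis using f x imageI[of 0 "{..e}" "w x"] by simp
  next
    case (Suc i)
    then show ?thesis using f b[of i] by (cases "even j") auto
  qed
  then show "\<alpha> (w x j) \<in> w x ` {..e}" "\<beta> (w x j) \<in> w x ` {..e}" by auto
qed

text \<open>Let y be the last point. It lies beneath no upper arc and \<open>x\<close> beneath no
  lower arc, which evaluates both end products of \<open>walk_signs\<close> to sgn (y - x); one of
  them needs a reversal of all its factors, an odd number.\<close>

lemma path_sign:
  assumes xN: "x \<in> N" and x: "\<beta> x = x" and e: "w x (Suc (2 * m)) = w x (2 * m)"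
    and nofix: "\<And>j. j < 2 * m \<Longrightarrow> w x (Suc j) \<noteq> w x j"
    and dist: "\<And>i j. i \<le> 2 * m \<Longrightarrow> j \<le> 2 * m \<Longrightarrow> w x i mod g = w x j mod g \<Longrightarrow> i = j"
  shows "(\<Prod>j<2 * m. sgn (w x (Suc j) - w x j)) = 1"
proof (cases m)
  case (Suc m')
  define k where "k = 2 * m - 1"
  have k: "2 * m = Suc k" and k': "k = Suc (2 * m')" using Suc by (auto simp: k_def)
  let ?y = "w x (2 * m)"
  have dist': "i \<le> 2 * m \<Longrightarrow> j \<le> 2 * m \<Longrightarrow> w x i = w x j \<Longrightarrow> i = j" for i j
    using dist by metis
  have "\<alpha> ?y = ?y" using e by simp
  then have "sgn (?y - w x (2 * t)) * sgn (?y - w x (2 * t + 1)) = 1" if "t < m" for t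
    using a.uncovered_sgn[of ?y "w x (2 * t)"] w_N[OF xN] w_steps(1)[of x t] nofix[of "2 * t"] that
    by (simp del: walk.simps)
  then have "(\<Prod>j<2 * m. sgn (?y - w x j)) = 1"
    by (simp only: prod_pairs) (simp del: walk.simps)
  then have "sgn (?y - x) * (\<Prod>j<k. sgn (?y - w x (Suc j))) = 1"
    unfolding k prod.lessThan_Suc_shift by simp
  moreover have "sgn (x - w x (2 * t + 1)) * sgn (x - w x (2 * t + 2)) = 1" if "t < m" for t
    using b.uncovered_sgn[OF xN x, of "w x (2 * t + 1)"] w_steps(3)[of x t] nofix[of "2 * t + 1"] that
    by (simp del: walk.simps)
  then have "(\<Prod>j<2 * m. sgn (x - w x (Suc j))) = 1"
    by (simp only: prod_pairs) (simp del: walk.simps)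
  then have "(\<Prod>j<k. sgn (x - w x (Suc j))) * sgn (x - ?y) = 1"
    unfolding k by simp
  moreover have "(\<Prod>j<k. sgn (w x (Suc j) - x)) = (\<Prod>j<k. (- 1) * sgn (x - w x (Suc j)))"
    by (rule prod.cong) (auto simp: sgn_if)
  then have "(\<Prod>j<k. sgn (w x (Suc j) - x)) = - (\<Prod>j<k. sgn (x - w x (Suc j)))"
    unfolding prod.distrib by (simp add: k')
  moreover have "(\<Prod>j<2 * m. sgn (w x (Suc j) - w x j)) =
    (\<Prod>l<k. sgn (w x (Suc l) - x)) * (\<Prod>j<k. sgn (?y - w x (Suc j)))"
    by (rule walk_signs[OF k nofix]) (auto intro!: inj_onI dist')
  moreover have "?y \<noteq> x"
    using dist'[of "2 * m" 0] k by auto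
  ultimately show ?thesis
    by (auto simp: sgn_if split: if_splits)
qed simp

end

text \<open>\<open>2 * n\<close> is the number of nodes on the loop, and \<open>k\<close> its
  winding number: one turn translates the lift by \<open>k * g\<close>.\<close>

locale ncloop = ncpair +
  fixes x n k
  assumes xN: "x \<in> N" and nofix: "\<And>j. w x (Suc j) \<noteq> w x j" and n: "n \<ge> 1"
    and ret: "w x (2 * n) = x + k * g"
    and dist: "\<And>i j. i < 2 * n \<Longrightarrow> j < 2 * n \<Longrightarrow> w x i mod g = w x j mod g \<Longrightarrow> i = j"
begin

lemma w_per: "w x (j + 2 * n * m) = w x j + int m * k * g"
proof (induction m)
  case (Suc m)
  have "w x (2 * n + (j + 2 * n * m)) = w (x + k * g) (j + 2 * n * m)"
    unfolding w_add ret ..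
  also have "\<dots> = w x j + int (Suc m) * k * g"
    unfolding w_shift Suc by (simp add: algebra_simps)
  finally show ?case
    by (simp add: algebra_simps)
qed simp

lemma w_mod: "w x j mod g = w x (j mod (2 * n)) mod g"
  using w_per[of "j mod (2 * n)" "j div (2 * n)"] by simp

lemma dist_iff: "w x i mod g = w x j mod g \<longleftrightarrow> i mod (2 * n) = j mod (2 * n)"
proof
  assume "w x i mod g = w x j mod g"
  then have "w x (i mod (2 * n)) mod g = w x (j mod (2 * n)) mod g"
    using w_mod by metis
  then show "i mod (2 * n) = j mod (2 * n)"
    using n by (intro dist) auto
next
  assume "i mod (2 * n) = j mod (2 * n)"
  then show "w x i mod g = w x j mod g"
    using w_mod by metis
qed

lemma w_inj_all: "k \<noteq> 0 \<Longrightarrow> inj (w x)"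
proof (rule injI)
  fix i j assume k: "k \<noteq> 0" and ij: "w x i = w x j"
  then have m: "i mod (2 * n) = j mod (2 * n)"
    using dist_iff by metis
  have "w x i = w x (i mod (2 * n)) + int (i div (2 * n)) * k * g" for i
    using w_per[of "i mod (2 * n)" "i div (2 * n)"] by simp
  from this[of i] this[of j] have "w x (j mod (2 * n)) + int (i div (2 * n)) * k * g
      = w x (j mod (2 * n)) + int (j div (2 * n)) * k * g"
    using ij m by metis
  then have "int (i div (2 * n)) * k * g = int (j div (2 * n)) * k * g"
    by linarith
  then have "i div (2 * n) = j div (2 * n)"
    using k a.g_pos by simp
  then show "i = j"
    using m by (metis div_mult_mod_eq)
qed

text \<open>For winding number zero the walk ends where it started, so the two end products of
  \<open>walk_signs\<close> compare the same pairs of points in opposite order; the number of pairs,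
  \<open>2 * n - 1\<close>, is odd.\<close>

lemma contractible_sign:
  assumes k: "k = 0"
  shows "(\<Prod>j<2 * n. sgn (w x (Suc j) - w x j)) = - 1"
proof -
  define K where "K = 2 * n - 1"
  have K: "2 * n = Suc K" "odd K" using n by (auto simp: K_def)
  have i0: "inj_on (w x) {..<2 * n}"
    using dist by (intro inj_onI) auto
  have i1: "inj_on (w x) {1..2 * n}"
  proof (rule inj_onI)
    fix i j assume ij: "i \<in> {1..2 * n}" "j \<in> {1..2 * n}" "w x i = w x j"
    then have "i mod (2 * n) = j mod (2 * n)"
      using dist_iff by metis
    then show "i = j"
      using ij by (cases "i = 2 * n"; cases "j = 2 * n") auto
  qed
  have "(\<Prod>j<2 * n. sgn (w x (Suc j) - w x j)) =
    (\<Prod>l<K. sgn (w x (Suc l) - x)) * (\<Prod>j<K. sgn (w x (2 * n) - w x (Suc j)))"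
    by (rule walk_signs[OF K(1) nofix i0 i1])
  also have "\<dots> = (\<Prod>l<K. sgn (w x (Suc l) - x) * sgn (x - w x (Suc l)))"
    using ret k by (simp add: prod.distrib)
  also have "\<dots> = (\<Prod>l<K. - 1)"
  proof (rule prod.cong[OF refl])
    fix l assume l: "l \<in> {..<K}"
    then have "w x (Suc l) \<noteq> w x 0"
      using dist[of "Suc l" 0] K by (auto simp del: walk.simps)
    then show "sgn (w x (Suc l) - x) * sgn (x - w x (Suc l)) = - 1"
      by (auto simp: sgn_if)
  qed
  also have "\<dots> = - 1"
    using K by simp
  finally show ?thesis .
qed

end

section \<open>Loops around the cylinder: sign, winding number, and separation of the two
  ends\<close>

lemma prod_lessThan_add: "(\<Prod>j<a + b. f j) = (\<Prod>j<a. f j) * (\<Prod>j<b. f (j + a))"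
  for f :: "nat \<Rightarrow> 'a::comm_monoid_mult"
  by (induction b) (simp_all add: mult.assoc add.commute)

lemma prod_pairs_pairs:
  "(\<Prod>l<2 * n. \<Prod>j<2 * n. F l j) = (\<Prod>s<n. \<Prod>t<n. (F (2 * s) (2 * t) * F (2 * s) (2 * t + 1)) *
     (F (2 * s + 1) (2 * t) * F (2 * s + 1) (2 * t + 1)))"
  for F :: "nat \<Rightarrow> nat \<Rightarrow> 'a::comm_monoid_mult"
  by (simp only: prod_pairs prod.distrib[symmetric])

text \<open>A loop around the cylinder, read off from the left end of one of its longest upper arcs: this
  point and its translates are not covered by any upper arc of the loop.\<close>

locale outerloop = ncloop +
  assumes k0: "k \<noteq> 0" and up: "x < \<alpha> x"
    and longest: "\<And>j. \<alpha> (w x j) - w x j \<le> \<alpha> x - x"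
begin

text \<open>By noncrossing, an upper arc above \<open>x + c * g\<close> would enclose the whole
  translated arc that starts there and so would be longer than the longest one.\<close>

lemma outer_uncovered:
  assumes "x + c * g \<noteq> w x j" "x + c * g \<noteq> \<alpha> (w x j)"
  shows "sgn (x + c * g - w x j) * sgn (x + c * g - \<alpha> (w x j)) = 1"
proof -
  let ?z = "w x j" and ?y = "x + c * g"
  have "\<exists>i. \<alpha> ?z = w x i"
  proof (cases "even j")
    case True
    then show ?thesis by (intro exI[of _ "Suc j"]) simp
  next
    case False
    then obtain i where "j = Suc i" "even i" by (cases j) auto
    then show ?thesis using w_back[of i x] by (intro exI[of _ i]) (simp del: walk.simps)
  qed
  then have l: "\<alpha> ?z - ?z \<le> \<alpha> x - x" "?z - \<alpha> ?z \<le> \<alpha> x - x"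
    using longest[of j] longest a.inv by metis+
  have "\<not> (min ?z (\<alpha> ?z) < ?y \<and> ?y < max ?z (\<alpha> ?z))"
  proof
    assume b: "min ?z (\<alpha> ?z) < ?y \<and> ?y < max ?z (\<alpha> ?z)"
    then have "min ?z (\<alpha> ?z) < \<alpha> ?y \<and> \<alpha> ?y < max ?z (\<alpha> ?z)"
      using a.nc_between[of ?z ?y] xN a.N_per_k by blast
    then show False
      using b l unfolding a.per_k by (auto simp: min_def max_def split: if_splits)
  qed
  then show ?thesis
    using a.sgn_mult_between[OF assms] by simp
qed

text \<open>After the point \<alpha> x, the remaining points pair up into upper arcs of the loop,
  none of which covers \<open>x + c * g\<close>; each pair contributes 1.\<close>

lemma tail_prod:
  assumes m: "2 * m = Suc K" and ne: "\<And>j. 1 \<le> j \<Longrightarrow> j < 2 * m \<Longrightarrow> x + c * g \<noteq> w x j"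
  shows "(\<Prod>l<K. sgn (x + c * g - w x (Suc l))) = sgn (x + c * g - \<alpha> x)"
    and "(\<Prod>l<K. sgn (w x (Suc l) - (x + c * g))) = sgn (\<alpha> x - (x + c * g))"
proof -
  obtain m' where m': "m = Suc m'" using m by (cases m) auto
  have K: "K = Suc (2 * m')" using m m' by simp
  have "sgn (x + c * g - w x (Suc (2 * t + 1))) * sgn (x + c * g - w x (Suc (2 * t + 2))) = 1" if "t < m'" for t
  proof -
    have s: "Suc (2 * t + 1) = 2 * Suc t" "Suc (2 * t + 2) = 2 * Suc t + 1" by auto
    show ?thesis
      unfolding s using outer_uncovered[of c "2 * Suc t"] ne[of "2 * Suc t"] ne[of "2 * Suc t + 1"] that m'
      unfolding w_steps by (simp del: walk.simps)
  qed
  then show 1: "(\<Prod>l<K. sgn (x + c * g - w x (Suc l))) = sgn (x + c * g - \<alpha> x)"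
    unfolding K prod_odd_pairs by (simp add: prod.neutral)
  have "(\<Prod>l<K. sgn (w x (Suc l) - (x + c * g))) = (\<Prod>l<K. (- 1) * sgn (x + c * g - w x (Suc l)))"
    by (rule prod.cong) (auto simp: sgn_if)
  also have "\<dots> = - sgn (x + c * g - \<alpha> x)"
    unfolding prod.distrib 1 by (simp add: K)
  also have "\<dots> = sgn (\<alpha> x - (x + c * g))"
    by (simp add: sgn_if)
  finally show "(\<Prod>l<K. sgn (w x (Suc l) - (x + c * g))) = sgn (\<alpha> x - (x + c * g))" .
qed

text \<open>Of the two end products in \<open>walk_signs\<close> one equals 1, as \<open>x\<close>
  is a left end, and the other records on which side of \<alpha> x the walk ends, which is the
  direction of winding. The number of turns is kept general so that one and two turns can be
  compared.\<close>

lemma outer_sign: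
  assumes m: "m \<ge> 1"
  shows "(\<Prod>j<2 * (n * m). sgn (w x (Suc j) - w x j)) = sgn k"
proof -
  let ?M = "n * m"
  define K where "K = 2 * ?M - 1"
  have K: "2 * ?M = Suc K" using n m by (auto simp: K_def)
  have inj: "inj_on (w x) A" for A
    using w_inj_all[OF k0] inj_on_subset by blast
  have fin: "w x (2 * ?M) = x + int m * k * g"
    using w_per[of 0 m] by (simp add: mult.assoc)
  have ne0: "x + 0 * g \<noteq> w x j" if "1 \<le> j" for j
    using injD[OF w_inj_all[OF k0], of 0 j] that by auto
  have ne1: "x + (int m * k) * g \<noteq> w x j" if "j < 2 * ?M" for j
    using injD[OF w_inj_all[OF k0], of "2 * ?M" j] that fin by auto
  have "(\<Prod>j<2 * ?M. sgn (w x (Suc j) - w x j)) =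
    (\<Prod>l<K. sgn (w x (Suc l) - x)) * (\<Prod>j<K. sgn (w x (2 * ?M) - w x (Suc j)))"
    by (rule walk_signs[OF K nofix inj inj])
  also have "(\<Prod>l<K. sgn (w x (Suc l) - x)) = sgn (\<alpha> x - x)"
    using tail_prod(2)[OF K, of 0] ne0 by simp
  also have "(\<Prod>j<K. sgn (w x (2 * ?M) - w x (Suc j))) = sgn (x + (int m * k) * g - \<alpha> x)"
    using tail_prod(1)[OF K ne1] fin by simp
  also have "sgn (x + (int m * k) * g - \<alpha> x) = sgn k"
  proof (cases "k > 0")
    case True
    then have "1 * 1 \<le> int m * k" using m by (intro mult_mono) auto
    then have "1 * g \<le> (int m * k) * g" using a.g_pos by (intro mult_right_mono) auto
    then show ?thesis using a.dist_lt(1)[of x] True by simp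
  next
    case False
    then have "(int m * k) * g < 0"
      using k0 m a.g_pos by (simp add: mult_less_0_iff zero_less_mult_iff)
    then show ?thesis using up False k0 by simp
  qed
  finally show ?thesis using up by simp
qed

text \<open>The sign of two turns is the square of the sign of one turn, yet both equal
  \<open>sgn k\<close>.\<close>

lemma k_pos: "k > 0"
proof (rule ccontr)
  assume "\<not> k > 0"
  then have k: "sgn k = - 1" using k0 by simp
  let ?f = "\<lambda>j. sgn (w x (Suc j) - w x j)"
  have per: "?f (j + 2 * n) = ?f j" for j
    using w_per[of j 1] w_per[of "Suc j" 1] by (simp del: walk.simps)
  have "(\<Prod>j<2 * n + 2 * n. ?f j) = (\<Prod>j<2 * n. ?f j) * (\<Prod>j<2 * n. ?f (j + 2 * n))"
    by (rule prod_lessThan_add)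
  also have "\<dots> = (\<Prod>j<2 * n. ?f j) * (\<Prod>j<2 * n. ?f j)"
    unfolding per ..
  finally have "(\<Prod>j<2 * (n * 2). ?f j) = (\<Prod>j<2 * (n * 1). ?f j) * (\<Prod>j<2 * (n * 1). ?f j)"
    by (simp del: walk.simps add: mult_2 mult_2_right)
  then show False
    using outer_sign[of 1] outer_sign[of 2] k by simp
qed

lemma outer_sign1: "(\<Prod>j<2 * n. sgn (w x (Suc j) - w x j)) = 1"
  using outer_sign[of 1] k_pos by simp

text \<open>Compares the loop with its translate by one period: the sign of their mutual position,
  computed with the upper and with the lower arcs, is consistent only for winding number one.\<close>

lemma k_eq_1: "k = 1"
proof (rule ccontr)
  assume "k \<noteq> 1"
  then have k2: "k \<ge> 2" using k_pos by simp
  define q where "q = (\<lambda>l. w x l + 1 * g)"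
  define K where "K = 2 * n - 1"
  have K: "2 * n = Suc K" using n by (auto simp: K_def)
  have ne: "w x i + c * g \<noteq> w x j" if "i mod (2 * n) \<noteq> j mod (2 * n)" for i j c
    using that dist_iff[of i j] by (metis mod_mult_self1)
  have ne0: "x + c * g \<noteq> w x j" if "1 \<le> j" "j < 2 * n" for c j
    using ne[of 0 j c] that by simp
  have neq: "w x j \<noteq> q l" if "j < 2 * n \<and> l < 2 * n \<or> 1 \<le> j \<and> j \<le> 2 * n \<and> 1 \<le> l \<and> l \<le> 2 * n" for j l
  proof (cases "j = l")
    case True
    then show ?thesis using a.g_pos by (simp add: q_def)
  next
    case False
    then have "l mod (2 * n) \<noteq> j mod (2 * n)"
      using that by (cases "j = 2 * n"; cases "l = 2 * n") auto
    then show ?thesis using ne[of l j 1] by (auto simp: q_def)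
  qed
  \<comment> \<open>The comparisons common to both groupings. The grouping by upper arcs will give
    \<open>C = 1\<close>, the one by lower arcs \<open>C = - 1\<close>.\<close>
  define C where "C = (\<Prod>j<K. \<Prod>l<K. sgn (q (Suc l) - w x (Suc j)))"
  have T0: "(\<Prod>l<2 * n. \<Prod>j<2 * n. sgn (q l - w x j)) = 1"
  proof -
    have "(\<Prod>l<2 * n. \<Prod>j<2 * n. sgn (q l - w x j)) = (\<Prod>s<n. \<Prod>t<n.
        (sgn (q (2 * s) - w x (2 * t)) * sgn (q (2 * s) - w x (2 * t + 1))) *
        (sgn (q (2 * s + 1) - w x (2 * t)) * sgn (q (2 * s + 1) - w x (2 * t + 1))))"
      by (rule prod_pairs_pairs)
    also have "\<dots> = 1"
    proof (intro prod.neutral ballI)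
      fix s t assume "s \<in> {..<n}" "t \<in> {..<n}"
      then show "(sgn (q (2 * s) - w x (2 * t)) * sgn (q (2 * s) - w x (2 * t + 1))) *
        (sgn (q (2 * s + 1) - w x (2 * t)) * sgn (q (2 * s + 1) - w x (2 * t + 1))) = 1"
        using walk_sgn4_even[of x t x s 1] nofix[of "2 * s"] nofix[of "2 * t"]
          neq[of "2 * t" "2 * s"] neq[of "2 * t + 1" "2 * s"]
        by (simp add: q_def mult.assoc del: walk.simps)
    qed
    finally show ?thesis .
  qed
  have T1: "(\<Prod>l<2 * n. \<Prod>j<2 * n. sgn (q (Suc l) - w x (Suc j))) = 1"
  proof -
    have "(\<Prod>l<2 * n. \<Prod>j<2 * n. sgn (q (Suc l) - w x (Suc j))) = (\<Prod>s<n. \<Prod>t<n.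
        (sgn (q (Suc (2 * s)) - w x (Suc (2 * t))) * sgn (q (Suc (2 * s)) - w x (Suc (2 * t + 1)))) *
        (sgn (q (Suc (2 * s + 1)) - w x (Suc (2 * t))) * sgn (q (Suc (2 * s + 1)) - w x (Suc (2 * t + 1)))))"
      by (rule prod_pairs_pairs)
    also have "\<dots> = 1"
    proof (intro prod.neutral ballI)
      fix s t assume "s \<in> {..<n}" "t \<in> {..<n}"
      then show "(sgn (q (Suc (2 * s)) - w x (Suc (2 * t))) * sgn (q (Suc (2 * s)) - w x (Suc (2 * t + 1)))) *
        (sgn (q (Suc (2 * s + 1)) - w x (Suc (2 * t))) * sgn (q (Suc (2 * s + 1)) - w x (Suc (2 * t + 1)))) = 1"
        using walk_sgn4_odd[of x t x s 1] nofix[of "2 * s + 1"] nofix[of "2 * t + 1"]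
          neq[of "2 * t + 1" "2 * s + 1"] neq[of "2 * t + 2" "2 * s + 1"]
        by (simp add: q_def mult.assoc del: walk.simps)
    qed
    finally show ?thesis .
  qed
  have C': "C = (\<Prod>l<K. \<Prod>j<K. sgn (q (Suc l) - w x (Suc j)))"
    unfolding C_def by (rule prod.swap)
  have kg: "2 * g \<le> k * g" using k2 a.g_pos by (intro mult_right_mono) auto
  have xa: "x < \<alpha> x" "\<alpha> x < x + g" using up a.dist_lt by auto
  have e: "w x (Suc K) = x + k * g" using ret K by simp
  have "(\<Prod>l<2 * n. \<Prod>j<2 * n. sgn (q l - w x j)) =
      sgn (q 0 - x) * (\<Prod>j<K. sgn (q 0 - w x (Suc j))) * ((\<Prod>l<K. sgn (q (Suc l) - x)) * C)"
    unfolding K prod.lessThan_Suc_shift C' by (simp add: prod.distrib del: walk.simps(2))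
  also have "(\<Prod>j<K. sgn (q 0 - w x (Suc j))) = 1"
    using tail_prod(1)[OF K ne0, of 1] xa by (simp add: q_def)
  also have "(\<Prod>l<K. sgn (q (Suc l) - x)) = 1"
  proof -
    have "(\<Prod>l<K. sgn (w x (Suc l) - (x + (- 1) * g))) = sgn (\<alpha> x - (x + (- 1) * g))"
      by (rule tail_prod(2)[OF K ne0])
    then show ?thesis
      using xa a.g_pos by (simp add: q_def algebra_simps del: walk.simps)
  qed
  finally have c1: "C = 1"
    using T0 a.g_pos by (simp add: q_def)
  have "(\<Prod>l<2 * n. \<Prod>j<2 * n. sgn (q (Suc l) - w x (Suc j))) =
      (C * (\<Prod>l<K. sgn (q (Suc l) - w x (Suc K)))) *
      ((\<Prod>j<K. sgn (q (Suc K) - w x (Suc j))) * sgn (q (Suc K) - w x (Suc K)))"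
    unfolding K C' by (simp add: prod.distrib del: walk.simps)
  also have "(\<Prod>l<K. sgn (q (Suc l) - w x (Suc K))) = - 1"
  proof -
    have "(\<Prod>l<K. sgn (w x (Suc l) - (x + (k - 1) * g))) = sgn (\<alpha> x - (x + (k - 1) * g))"
      by (rule tail_prod(2)[OF K ne0])
    \<comment> \<open>Here \<open>k \<ge> 2\<close> is decisive: \<alpha> x lies before
      \<open>x + g\<close>. For winding number one this sign would be positive and the contradiction
      would vanish.\<close>
    also have "\<alpha> x - (x + (k - 1) * g) < 0"
      using xa kg by (simp only: left_diff_distrib)
    then have "sgn (\<alpha> x - (x + (k - 1) * g)) = - 1"
      by (rule sgn_neg)
    finally show ?thesis
      unfolding e by (simp add: q_def algebra_simps del: walk.simps)
  qed
  also have "(\<Prod>j<K. sgn (q (Suc K) - w x (Suc j))) = 1"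
  proof -
    have "(\<Prod>j<K. sgn (x + (k + 1) * g - w x (Suc j))) = sgn (x + (k + 1) * g - \<alpha> x)"
      by (rule tail_prod(1)[OF K ne0])
    also have "x + (k + 1) * g - \<alpha> x > 0"
      using xa kg a.g_pos by (simp only: distrib_right)
    then have "sgn (x + (k + 1) * g - \<alpha> x) = 1"
      by (rule sgn_pos)
    finally show ?thesis
      unfolding q_def e by (simp add: algebra_simps del: walk.simps)
  qed
  finally show False
    using T1 c1 a.g_pos by (simp add: q_def)
qed

end

context ncloop
begin

definition onloop :: "int \<Rightarrow> bool" where
  "onloop z \<longleftrightarrow> (\<exists>j. z mod g = w x j mod g)"

lemma onloop_w: "onloop (w x j)"
  by (auto simp: onloop_def)

lemma onloop_shift: "onloop (z + c * g) \<longleftrightarrow> onloop z"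
  by (simp add: onloop_def)

lemma onloopE:
  assumes "onloop z"
  obtains i c where "z = w x (Suc i) + c * g"
proof -
  obtain j where "z mod g = w x j mod g"
    using assms by (auto simp: onloop_def)
  also have "\<dots> = w x (j + 2 * n) mod g"
    using dist_iff[of j "j + 2 * n"] by simp
  also have "j + 2 * n = Suc (j + 2 * n - 1)"
    using n by simp
  finally obtain c where "z = w x (Suc (j + 2 * n - 1)) + c * g"
    using mod_eq_shift by metis
  then show ?thesis by (rule that)
qed

lemma onloop_step:
  assumes "onloop z"
  shows "onloop (\<alpha> z) \<and> \<alpha> z \<noteq> z \<and> onloop (\<beta> z) \<and> \<beta> z \<noteq> z"
proof -
  obtain i c where z: "z = w x (Suc i) + c * g"
    using assms by (rule onloopE)
  have f: "w x (Suc (Suc i)) \<noteq> w x (Suc i)" "w x i \<noteq> w x (Suc i)"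
    using nofix[of "Suc i"] nofix[of i] by metis+
  show ?thesis
  proof (cases "even i")
    case True
    then have "\<alpha> (w x (Suc i)) = w x i" "\<beta> (w x (Suc i)) = w x (Suc (Suc i))"
      using w_back[of i x] by auto
    then show ?thesis
      using f onloop_w[of i] onloop_w[of "Suc (Suc i)"]
      unfolding z a.per_k b.per_k onloop_shift by (simp del: walk.simps)
  next
    case False
    then have "\<beta> (w x (Suc i)) = w x i" "\<alpha> (w x (Suc i)) = w x (Suc (Suc i))"
      using w_back[of i x] by auto
    then show ?thesis
      using f onloop_w[of i] onloop_w[of "Suc (Suc i)"]
      unfolding z a.per_k b.per_k onloop_shift by (simp del: walk.simps)
  qed
qed

text \<open>Both neighbours of a point on the loop are on the loop. Going back along the path would
  put \<open>t\<close> on the loop, whose points are moved by \<alpha>.\<close>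

lemma not_onloop_path:
  assumes "\<alpha> t = t"
  shows "\<not> onloop (walk \<beta> \<alpha> t i)"
proof (induction i)
  case 0
  then show ?case using assms onloop_step[of t] by auto
next
  case (Suc i)
  show ?case
  proof
    assume "onloop (walk \<beta> \<alpha> t (Suc i))"
    then have "onloop ((if even i then \<beta> else \<alpha>) (walk \<beta> \<alpha> t (Suc i)))"
      using onloop_step[of "walk \<beta> \<alpha> t (Suc i)"] by (simp del: walk.simps)
    then show False
      using Suc ncpair.w_back[OF swap, of i t] by (simp del: walk.simps)
  qed
qed

end

text \<open>A loop around the cylinder separates the two ends: with respect to a long enough window of the
  loop, the sign \<open>F\<close> below is constant along the path, but differs for its two end points.\<close>

lemma (in outerloop) no_through_path:
  assumes tN: "t \<in> N" and t: "\<alpha> t = t" and e: "\<beta> (walk \<beta> \<alpha> t (2 * m)) = walk \<beta> \<alpha> t (2 * m)"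
    and nofix': "\<And>i. i < 2 * m \<Longrightarrow> walk \<beta> \<alpha> t (Suc i) \<noteq> walk \<beta> \<alpha> t i"
  shows False
proof -
  let ?y = "walk \<beta> \<alpha> t"
  \<comment> \<open>Chosen so large that the entire path stays within distance \<open>D * g\<close>
    of \<open>x\<close>.\<close>
  define D where "D = nat (\<Sum>i\<le>2 * m. \<bar>?y i - x\<bar>) + 1"
  have D: "\<bar>?y i - x\<bar> < int D * g" if "i \<le> 2 * m" for i
  proof -
    have "\<bar>?y i - x\<bar> \<le> (\<Sum>i\<le>2 * m. \<bar>?y i - x\<bar>)"
      by (rule member_le_sum) (use that in auto)
    also have "\<dots> < int D"
      by (simp add: D_def sum_nonneg)
    also have "int D * 1 \<le> int D * g"
      using a.g_pos by (intro mult_left_mono) auto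
    finally show ?thesis by simp
  qed
  define x0 where "x0 = x + (- int D) * g"
  \<comment> \<open>\<open>2 * D\<close> turns, each of which advances by exactly \<open>g\<close>
    because the winding number is one; the window thus reaches from \<open>x - D * g\<close> to
    \<open>x + D * g\<close>.\<close>
  define R where "R = n * (2 * D)"
  have wx0: "w x0 j = w x j + (- int D) * g" for j
    unfolding x0_def by (rule w_shift)
  have end0: "w x0 (2 * R) = x + int D * g"
    using w_per[of 0 "2 * D"] k_eq_1 by (simp add: wx0 R_def mult.assoc algebra_simps)
  have on: "onloop (w x0 j)" for j
    unfolding wx0 onloop_shift by (rule onloop_w)
  \<comment> \<open>\<open>F\<close> groups the window into upper arcs and is therefore unchanged by
    \<alpha>; \<open>F1\<close>, shifted by one step, groups it into lower arcs and is unchanged by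
    \<beta>.\<close>
  define F where "F = (\<lambda>y. \<Prod>j<2 * R. sgn (y - w x0 j))"
  define F1 where "F1 = (\<lambda>y. \<Prod>j<2 * R. sgn (y - w x0 (Suc j)))"
  have ne: "y \<noteq> w x0 j" if "\<not> onloop y" for y j
    using on that by metis
  have nf: "\<alpha> (w x0 j) \<noteq> w x0 j" "\<beta> (w x0 j) \<noteq> w x0 j" for j
    using onloop_step[OF on[of j]] by auto
  have F: "F y * F (\<alpha> y) = 1" if "\<not> onloop y" "\<alpha> y \<noteq> y" for y
  proof -
    have "F y * F (\<alpha> y) = (\<Prod>s<R. (sgn (y - w x0 (2 * s)) * sgn (y - w x0 (2 * s + 1))) *
        (sgn (\<alpha> y - w x0 (2 * s)) * sgn (\<alpha> y - w x0 (2 * s + 1))))"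
      unfolding F_def by (simp only: prod_pairs prod.distrib[symmetric])
    also have "\<dots> = 1"
    proof (intro prod.neutral ballI)
      fix s
      have "\<alpha> (w x0 (2 * s)) = w x0 (2 * s + 1)" by simp
      then show "(sgn (y - w x0 (2 * s)) * sgn (y - w x0 (2 * s + 1))) *
        (sgn (\<alpha> y - w x0 (2 * s)) * sgn (\<alpha> y - w x0 (2 * s + 1))) = 1"
        using a.nc_sgn4[OF nf(1)[of "2 * s"] that(2)] ne[OF that(1)] by (simp add: mult.assoc del: walk.simps)
    qed
    finally show ?thesis .
  qed
  have F1: "F1 y * F1 (\<beta> y) = 1" if "\<not> onloop y" "\<beta> y \<noteq> y" for y
  proof -
    have "F1 y * F1 (\<beta> y) = (\<Prod>s<R. (sgn (y - w x0 (Suc (2 * s))) * sgn (y - w x0 (Suc (2 * s + 1)))) *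
        (sgn (\<beta> y - w x0 (Suc (2 * s))) * sgn (\<beta> y - w x0 (Suc (2 * s + 1)))))"
      unfolding F1_def by (simp only: prod_pairs prod.distrib[symmetric])
    also have "\<dots> = 1"
    proof (intro prod.neutral ballI)
      fix s
      have "\<beta> (w x0 (Suc (2 * s))) = w x0 (Suc (2 * s + 1))" by simp
      then show "(sgn (y - w x0 (Suc (2 * s))) * sgn (y - w x0 (Suc (2 * s + 1)))) *
        (sgn (\<beta> y - w x0 (Suc (2 * s))) * sgn (\<beta> y - w x0 (Suc (2 * s + 1)))) = 1"
        using b.nc_sgn4[OF nf(2)[of "Suc (2 * s)"] that(2)] ne[OF that(1)] by (simp add: mult.assoc del: walk.simps)
    qed
    finally show ?thesis .
  qed
  \<comment> \<open>The two products differ only in the end points of the window, and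
    \<open>y\<close> lies strictly between these. So the free upper end yields \<open>F = 1\<close>
    all along the path, while the free lower end demands \<open>F1 = 1\<close>.\<close>
  have rel: "F1 y = - F y" if "\<bar>y - x\<bar> < int D * g" for y
  proof -
    have "F1 y * sgn (y - w x0 0) = (\<Prod>j<Suc (2 * R). sgn (y - w x0 j))"
      unfolding prod.lessThan_Suc_shift F1_def by (simp del: walk.simps)
    also have "\<dots> = F y * sgn (y - w x0 (2 * R))"
      by (simp add: F_def del: walk.simps)
    finally show ?thesis
      using that unfolding end0 by (simp add: x0_def sgn_if abs_if split: if_splits)
  qed
  have yN: "?y i \<in> N" for i
    using ncpair.w_N[OF swap tN] .
  have nl: "\<not> onloop (?y i)" for i
    using not_onloop_path[OF t] .
  have F0: "F t = 1"
  proof -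
    have "F t = (\<Prod>s<R. sgn (t - w x0 (2 * s)) * sgn (t - w x0 (2 * s + 1)))"
      unfolding F_def by (rule prod_pairs)
    also have "\<dots> = 1"
    proof (intro prod.neutral ballI)
      fix s
      have "\<alpha> (w x0 (2 * s)) = w x0 (2 * s + 1)" by simp
      then show "sgn (t - w x0 (2 * s)) * sgn (t - w x0 (2 * s + 1)) = 1"
        using a.uncovered_sgn[OF tN t nf(1)[of "2 * s"]] by (simp del: walk.simps)
    qed
    finally show ?thesis .
  qed
  have Fi: "F (?y i) = 1" if "i \<le> 2 * m" for i
    using that
  proof (induction i)
    case 0
    then show ?case using F0 by simp
  next
    case (Suc i)
    have n1: "?y (Suc i) \<noteq> ?y i" using nofix' Suc by simp
    show ?case
    proof (cases "even i")
      case True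
      then have s: "?y (Suc i) = \<beta> (?y i)" by simp
      have "F1 (?y i) * F1 (?y (Suc i)) = 1"
        using F1[OF nl, of i] n1 unfolding s by simp
      then show ?thesis
        using rel[OF D, of i] rel[OF D, of "Suc i"] Suc by (simp del: walk.simps)
    next
      case False
      then have s: "?y (Suc i) = \<alpha> (?y i)" by simp
      have "F (?y i) * F (?y (Suc i)) = 1"
        using F[OF nl, of i] n1 unfolding s by simp
      then show ?thesis
        using Suc by (simp del: walk.simps)
    qed
  qed
  have "F1 (?y (2 * m)) = 1"
  proof -
    have "F1 (?y (2 * m)) = (\<Prod>s<R. sgn (?y (2 * m) - w x0 (Suc (2 * s))) * sgn (?y (2 * m) - w x0 (Suc (2 * s + 1))))"
      unfolding F1_def by (rule prod_pairs)
    also have "\<dots> = 1"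
    proof (intro prod.neutral ballI)
      fix s
      have "\<beta> (w x0 (Suc (2 * s))) = w x0 (Suc (2 * s + 1))" by simp
      then show "sgn (?y (2 * m) - w x0 (Suc (2 * s))) * sgn (?y (2 * m) - w x0 (Suc (2 * s + 1))) = 1"
        using b.uncovered_sgn[OF yN e nf(2)[of "Suc (2 * s)"]] by (simp del: walk.simps)
    qed
    finally show ?thesis .
  qed
  then show False
    using rel[OF D, of "2 * m"] Fi[of "2 * m"] by simp
qed

section \<open>State sums\<close>

text \<open>Choosing \<open>S\<close> amounts to an independent choice in every block, so the sum
  over states is a product over blocks.\<close>

lemma sum_prod_partition:
  fixes u :: "'b \<Rightarrow> 'a::comm_semiring_1"
  assumes "finite F" and "\<And>K. K \<in> F \<Longrightarrow> finite K"
    and "\<And>K L. K \<in> F \<Longrightarrow> L \<in> F \<Longrightarrow> K \<noteq> L \<Longrightarrow> K \<inter> L = {}"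
    and "\<And>K S. K \<in> F \<Longrightarrow> V K S \<Longrightarrow> S \<subseteq> K"
  shows "(\<Sum>S | S \<subseteq> \<Union>F \<and> (\<forall>K\<in>F. V K (S \<inter> K)). \<Prod>s\<in>S. u s) = (\<Prod>K\<in>F. \<Sum>S | V K S. \<Prod>s\<in>S. u s)"
  using assms
proof (induction F rule: finite_induct)
  case empty
  have "{S. S \<subseteq> \<Union>{} \<and> (\<forall>K\<in>{}. V K (S \<inter> K))} = {{}}" by auto
  then show ?case by simp
next
  case (insert L F)
  define Z where "Z = {S. S \<subseteq> \<Union>F \<and> (\<forall>K\<in>F. V K (S \<inter> K))}"
  define Y where "Y = {S. V L S}"
  have disj: "L \<inter> \<Union>F = {}"
    using insert.hyps(2) insert.prems(2)[of L] by blast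
  have subF: "K \<subseteq> \<Union>F" "K \<inter> L = {}" if "K \<in> F" for K
    using that disj by auto
  have fin: "finite L" "finite (\<Union>F)"
    using insert by auto
  have bij: "bij_betw (\<lambda>(S, T). S \<union> T) (Y \<times> Z)
      {S. S \<subseteq> \<Union>(insert L F) \<and> (\<forall>K\<in>insert L F. V K (S \<inter> K))}"
  proof (rule bij_betwI[where g = "\<lambda>S. (S \<inter> L, S \<inter> \<Union>F)"])
    show "(\<lambda>(S, T). S \<union> T) \<in> Y \<times> Z \<rightarrow> {S. S \<subseteq> \<Union>(insert L F) \<and> (\<forall>K\<in>insert L F. V K (S \<inter> K))}"
    proof
      fix p assume p: "p \<in> Y \<times> Z"
      obtain S T where ST: "p = (S, T)" "V L S" "S \<subseteq> L" "T \<subseteq> \<Union>F" "\<forall>K\<in>F. V K (T \<inter> K)"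
        using p insert.prems(3) by (auto simp: Z_def Y_def)
      have "(S \<union> T) \<inter> L = S" "\<And>K. K \<in> F \<Longrightarrow> (S \<union> T) \<inter> K = T \<inter> K"
        using ST disj subF by blast+
      then show "(case p of (S, T) \<Rightarrow> S \<union> T) \<in> {S. S \<subseteq> \<Union>(insert L F) \<and> (\<forall>K\<in>insert L F. V K (S \<inter> K))}"
        using ST by auto
    qed
    show "(\<lambda>S. (S \<inter> L, S \<inter> \<Union>F)) \<in> {S. S \<subseteq> \<Union>(insert L F) \<and> (\<forall>K\<in>insert L F. V K (S \<inter> K))} \<rightarrow> Y \<times> Z"
    proof
      fix S assume S: "S \<in> {S. S \<subseteq> \<Union>(insert L F) \<and> (\<forall>K\<in>insert L F. V K (S \<inter> K))}"
      have "S \<inter> \<Union>F \<inter> K = S \<inter> K" if "K \<in> F" for K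
        using that by blast
      then show "(S \<inter> L, S \<inter> \<Union>F) \<in> Y \<times> Z"
        using S by (auto simp: Z_def Y_def)
    qed
    show "(\<lambda>S. (S \<inter> L, S \<inter> \<Union>F)) (case p of (S, T) \<Rightarrow> S \<union> T) = p" if pYX: "p \<in> Y \<times> Z" for p
    proof -
      obtain S T where ST: "p = (S, T)" "S \<in> Y" "T \<in> Z"
        using pYX by blast
      then have "S \<subseteq> L" "T \<subseteq> \<Union>F"
        using insert.prems(3)[of L S] by (auto simp: Z_def Y_def)
      then show ?thesis using disj ST(1) by auto
    qed
    show "(case (S \<inter> L, S \<inter> \<Union>F) of (S, T) \<Rightarrow> S \<union> T) = S"
      if "S \<in> {S. S \<subseteq> \<Union>(insert L F) \<and> (\<forall>K\<in>insert L F. V K (S \<inter> K))}" for S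
      using that by auto
  qed
  have "(\<Sum>S | S \<subseteq> \<Union>(insert L F) \<and> (\<forall>K\<in>insert L F. V K (S \<inter> K)). \<Prod>s\<in>S. u s)
      = (\<Sum>(S, T)\<in>Y \<times> Z. \<Prod>s\<in>S \<union> T. u s)"
    using sum.reindex_bij_betw[OF bij, of "\<lambda>S. \<Prod>s\<in>S. u s"] by (simp add: case_prod_beta)
  also have "\<dots> = (\<Sum>(S, T)\<in>Y \<times> Z. (\<Prod>s\<in>S. u s) * (\<Prod>s\<in>T. u s))"
  proof (rule sum.cong[OF refl], clarify)
    fix S T assume "S \<in> Y" "T \<in> Z"
    then have "S \<subseteq> L" "T \<subseteq> \<Union>F"
      using insert.prems(3) by (auto simp: Z_def Y_def)
    then show "(\<Prod>s\<in>S \<union> T. u s) = (\<Prod>s\<in>S. u s) * (\<Prod>s\<in>T. u s)"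
      using disj fin finite_subset by (intro prod.union_disjoint) blast+
  qed
  also have "\<dots> = (\<Sum>S\<in>Y. \<Prod>s\<in>S. u s) * (\<Sum>T\<in>Z. \<Prod>s\<in>T. u s)"
    by (simp add: sum_product sum.cartesian_product)
  also have "(\<Sum>T\<in>Z. \<Prod>s\<in>T. u s) = (\<Prod>K\<in>F. \<Sum>S | V K S. \<Prod>s\<in>S. u s)"
    unfolding Z_def using insert.prems by (intro insert.IH) auto
  finally show ?case
    using insert.hyps by (simp add: Y_def)
qed

definition linked :: "(int \<Rightarrow> int) \<Rightarrow> (int \<Rightarrow> int) \<Rightarrow> int \<Rightarrow> int \<Rightarrow> bool" where
  "linked \<alpha> \<beta> = (\<lambda>x y. y = \<alpha> x \<or> y = \<beta> x)\<^sup>*\<^sup>*"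

definition fund :: "int \<Rightarrow> int set \<Rightarrow> int set" where
  "fund g N = {x \<in> N. 0 \<le> x \<and> x < g}"

definition comp :: "int \<Rightarrow> int set \<Rightarrow> (int \<Rightarrow> int) \<Rightarrow> (int \<Rightarrow> int) \<Rightarrow> int \<Rightarrow> int set" where
  "comp g N \<alpha> \<beta> i = {j \<in> fund g N. \<exists>m. linked \<alpha> \<beta> i (j + m * g)}"

text \<open>The condition of \<open>transversal\<close> as seen from a single node, which makes it
  local to components.\<close>

definition alternating :: "int \<Rightarrow> (int \<Rightarrow> int) \<Rightarrow> int set \<Rightarrow> int \<Rightarrow> bool" where
  "alternating g f S i \<longleftrightarrow> (if f i = i then i \<notin> S else (i \<in> S) \<noteq> (f i mod g \<in> S))"

text \<open>The states on \<open>K\<close>. On the whole fundamental window they are the monomials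
  that occur in the upper as well as in the lower product.\<close>

definition valid :: "int \<Rightarrow> (int \<Rightarrow> int) \<Rightarrow> (int \<Rightarrow> int) \<Rightarrow> int set \<Rightarrow> int set \<Rightarrow> bool" where
  "valid g \<alpha> \<beta> K S \<longleftrightarrow> S \<subseteq> K \<and> (\<forall>i\<in>K. alternating g \<alpha> S i \<and> alternating g \<beta> S i)"

text \<open>The contribution of a chosen end \<open>s\<close> of an upper and of a lower arc; along a component the powers
  of \<open>v\<close> telescope to the displacement.\<close>

definition weight :: "'a::field \<Rightarrow> (int \<Rightarrow> int) \<Rightarrow> (int \<Rightarrow> int) \<Rightarrow> int \<Rightarrow> 'a" where
  "weight v \<alpha> \<beta> s = - of_int (sgn (\<alpha> s - s) * sgn (\<beta> s - s)) * v powi (\<alpha> s - \<beta> s)"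

lemma linked_swap: "linked \<beta> \<alpha> = linked \<alpha> \<beta>"
  by (simp add: linked_def disj_commute)

lemma comp_swap: "comp g N \<beta> \<alpha> = comp g N \<alpha> \<beta>"
  by (simp add: comp_def linked_swap fun_eq_iff)

lemma valid_swap: "valid g \<beta> \<alpha> = valid g \<alpha> \<beta>"
  by (auto simp: valid_def fun_eq_iff)

lemma finite_fund: "finite (fund g N)"
proof -
  have "fund g N \<subseteq> {0..<g}" by (auto simp: fund_def)
  then show ?thesis by (rule finite_subset) simp
qed

lemma fund_mod: "x \<in> fund g N \<Longrightarrow> x mod g = x"
  by (simp add: fund_def)

context ncpair
begin

abbreviation "lk \<equiv> linked \<alpha> \<beta>"
abbreviation "cp \<equiv> comp g N \<alpha> \<beta>"

lemma fund_modI: "x \<in> N \<Longrightarrow> x mod g \<in> fund g N"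
proof -
  assume x: "x \<in> N"
  obtain k where "x = x mod g + k * g"
    using mod_eq_shift[of x g "x mod g"] by auto
  then have "x mod g \<in> N"
    using x a.N_per_k[of "x mod g" k] by simp
  then show ?thesis
    using a.g_pos by (simp add: fund_def)
qed

lemma lk_refl: "lk x x"
  by (simp add: linked_def)

lemma lk_step: "lk x (\<alpha> x)" "lk x (\<beta> x)"
  by (auto simp: linked_def)

lemma lk_trans: "lk x y \<Longrightarrow> lk y z \<Longrightarrow> lk x z"
  by (simp add: linked_def)

lemma lk_induct:
  assumes "lk x y" "P x" "\<And>y. P y \<Longrightarrow> P (\<alpha> y) \<and> P (\<beta> y)"
  shows "P y"
  using assms(1) unfolding linked_def
  by (induction rule: rtranclp_induct) (use assms(2,3) in auto)

lemma lk_sym: "lk x y \<Longrightarrow> lk y x"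
proof (erule lk_induct)
  show "lk x x" by (rule lk_refl)
  fix y assume y: "lk y x"
  have "lk (\<alpha> y) y" "lk (\<beta> y) y"
    using lk_step(1)[of "\<alpha> y"] lk_step(2)[of "\<beta> y"] by (simp_all add: a.inv b.inv)
  then show "lk (\<alpha> y) x \<and> lk (\<beta> y) x"
    using y lk_trans by blast
qed

lemma lk_shift: "lk (x + k * g) (y + k * g) \<longleftrightarrow> lk x y"
proof -
  have "lk (x + k * g) (y + k * g)" if "lk x y" for x y k
    using that
  proof (rule lk_induct)
    show "lk (x + k * g) (x + k * g)" by (rule lk_refl)
    fix y assume y: "lk (x + k * g) (y + k * g)"
    have "lk (y + k * g) (\<alpha> y + k * g)" "lk (y + k * g) (\<beta> y + k * g)"
      using lk_step[of "y + k * g"] by (simp_all add: a.per_k b.per_k)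
    then show "lk (x + k * g) (\<alpha> y + k * g) \<and> lk (x + k * g) (\<beta> y + k * g)"
      using y lk_trans by blast
  qed
  from this[of x y k] this[of "x + k * g" "y + k * g" "- k"] show ?thesis by auto
qed

lemma lk_w: "lk x (w x j)"
proof (induction j)
  case (Suc j)
  then show ?case
    using lk_trans lk_step by auto
qed (simp add: lk_refl)

lemma cp_iff: "j \<in> cp i \<longleftrightarrow> j \<in> fund g N \<and> (\<exists>m. lk i (j + m * g))"
  by (simp add: comp_def)

lemma cp_sub: "cp i \<subseteq> fund g N"
  by (auto simp: cp_iff)

lemma cp_memI: "lk i y \<Longrightarrow> y \<in> N \<Longrightarrow> y mod g \<in> cp i"
proof -
  assume y: "lk i y" "y \<in> N"
  obtain k where "y = y mod g + k * g"
    using mod_eq_shift[of y g "y mod g"] by auto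
  then have "lk i (y mod g + k * g)" using y by simp
  then show ?thesis
    using fund_modI[OF y(2)] cp_iff by blast
qed

lemma cp_refl: "i \<in> fund g N \<Longrightarrow> i \<in> cp i"
  using lk_refl[of i] by (auto simp: cp_iff intro: exI[of _ 0])

lemma cp_eq:
  assumes "j \<in> cp i" shows "cp j = cp i"
proof -
  obtain m where m: "lk i (j + m * g)"
    using assms by (auto simp: cp_iff)
  have "(\<exists>c. lk j (l + c * g)) \<longleftrightarrow> (\<exists>c. lk i (l + c * g))" for l
  proof
    assume "\<exists>c. lk j (l + c * g)"
    then obtain c where "lk (j + m * g) (l + c * g + m * g)"
      by (auto simp: lk_shift)
    then have "lk i (l + (c + m) * g)"
      using lk_trans[OF m] by (simp add: algebra_simps)
    then show "\<exists>c. lk i (l + c * g)" ..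
  next
    assume "\<exists>c. lk i (l + c * g)"
    then obtain c where "lk (j + m * g) (l + c * g)"
      using lk_trans[OF lk_sym[OF m]] by blast
    then have "lk (j + m * g + (- m) * g) (l + c * g + (- m) * g)"
      unfolding lk_shift .
    then have "lk j (l + (c - m) * g)"
      by (simp add: algebra_simps)
    then show "\<exists>c. lk j (l + c * g)" ..
  qed
  then show ?thesis
    by (auto simp: cp_iff)
qed

lemma cp_step:
  assumes "j \<in> cp i"
  shows "\<alpha> j mod g \<in> cp i" "\<beta> j mod g \<in> cp i"
proof -
  have "j \<in> N" using assms by (auto simp: cp_iff fund_def)
  then show "\<alpha> j mod g \<in> cp i" "\<beta> j mod g \<in> cp i"
    using cp_memI[OF lk_step(1)] cp_memI[OF lk_step(2)] a.in_N b.in_N cp_eq[OF assms] by blast+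
qed

lemma sum_valid:
  fixes u :: "int \<Rightarrow> 'a::comm_semiring_1"
  shows "(\<Sum>S | valid g \<alpha> \<beta> (fund g N) S. \<Prod>s\<in>S. u s) =
    (\<Prod>K\<in>cp ` fund g N. \<Sum>S | valid g \<alpha> \<beta> K S. \<Prod>s\<in>S. u s)"
proof -
  have Un: "\<Union>(cp ` fund g N) = fund g N"
    using cp_refl by (auto simp: cp_iff)
  have loc: "alternating g f (S \<inter> K) i \<longleftrightarrow> alternating g f S i" if "i \<in> K" "f i mod g \<in> K" for f S K i
    using that by (auto simp: alternating_def)
  have "valid g \<alpha> \<beta> (fund g N) S \<longleftrightarrow>
      S \<subseteq> \<Union>(cp ` fund g N) \<and> (\<forall>K\<in>cp ` fund g N. valid g \<alpha> \<beta> K (S \<inter> K))" for S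
  proof -
    have "(\<forall>i\<in>fund g N. Q i) \<longleftrightarrow> (\<forall>K\<in>cp ` fund g N. \<forall>i\<in>K. Q i)" for Q
      using Un by blast
    moreover have "valid g \<alpha> \<beta> (cp i) (S \<inter> cp i) \<longleftrightarrow>
        (\<forall>j\<in>cp i. alternating g \<alpha> S j \<and> alternating g \<beta> S j)" for i
      using loc cp_step unfolding valid_def by (metis inf_le2)
    ultimately show ?thesis
      unfolding Un by (simp add: valid_def)
  qed
  then have "(\<Sum>S | valid g \<alpha> \<beta> (fund g N) S. \<Prod>s\<in>S. u s) =
      (\<Sum>S | S \<subseteq> \<Union>(cp ` fund g N) \<and> (\<forall>K\<in>cp ` fund g N. valid g \<alpha> \<beta> K (S \<inter> K)). \<Prod>s\<in>S. u s)"
    by simp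
  also have "\<dots> = (\<Prod>K\<in>cp ` fund g N. \<Sum>S | valid g \<alpha> \<beta> K S. \<Prod>s\<in>S. u s)"
  proof (rule sum_prod_partition)
    show "finite (cp ` fund g N)" using finite_fund by blast
    show "finite K" if "K \<in> cp ` fund g N" for K
      using that cp_sub finite_subset[OF _ finite_fund] by blast
    show "K \<inter> L = {}" if "K \<in> cp ` fund g N" "L \<in> cp ` fund g N" "K \<noteq> L" for K L
      using that cp_eq by blast
  qed (simp add: valid_def)
  finally show ?thesis .
qed

end

section \<open>State sums of single loops and paths\<close>

lemma prod_powi_telescope:
  fixes v :: "'a::field"
  assumes "v \<noteq> 0"
  shows "(\<Prod>t<n. v powi (f (Suc t) - f t)) = v powi (f n - f 0)"
proof (induction n)
  case (Suc n)
  have "(\<Prod>t<Suc n. v powi (f (Suc t) - f t)) = v powi (f n - f 0) * v powi (f (Suc n) - f n)"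
    using Suc by simp
  also have "\<dots> = v powi ((f n - f 0) + (f (Suc n) - f n))"
    using assms by (subst power_int_add) auto
  finally show ?case by simp
qed simp

text \<open>Lets results about walks from a lower free end serve for walks from an upper
  one.\<close>

lemma weight_swap: "weight v \<alpha> \<beta> s = weight (inverse v) \<beta> \<alpha> s"
proof -
  have "v powi (\<alpha> s - \<beta> s) = inverse v powi (\<beta> s - \<alpha> s)"
    using power_int_minus[of v "\<beta> s - \<alpha> s"] by (simp add: power_int_inverse)
  then show ?thesis
    by (simp add: weight_def mult.commute)
qed

context ncinv
begin

lemma mod_shift: "\<alpha> (z mod g) = \<alpha> z + (z mod g - z)"
proof -
  obtain k where "z = z mod g + k * g"
    using mod_eq_shift[of z g "z mod g"] by auto
  then show ?thesis
    using per_k[of "z mod g" k] by simp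
qed

lemma mod_fixed: "\<alpha> (z mod g) = z mod g \<longleftrightarrow> \<alpha> z = z"
  by (simp add: mod_shift)

lemma mod_mod: "\<alpha> (z mod g) mod g = \<alpha> z mod g"
proof -
  obtain k where "z mod g - z = k * g"
    by (metis add_diff_cancel_left' mod_eq_shift mod_mod_trivial)
  then show ?thesis
    by (simp add: mod_shift)
qed

lemma alternating_mod:
  "alternating g \<alpha> S (z mod g) \<longleftrightarrow> (if \<alpha> z = z then z mod g \<notin> S else (z mod g \<in> S) \<noteq> (\<alpha> z mod g \<in> S))"
  by (simp add: alternating_def mod_fixed mod_mod)

end

context ncpair
begin

lemma weight_mod: "weight v \<alpha> \<beta> (z mod g) = weight v \<alpha> \<beta> z"
  by (simp add: weight_def a.mod_shift b.mod_shift)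

text \<open>The minus sign of \<open>weight\<close> is spent on orienting both steps along the walk.
  The first form fits odd times, where the walk arrives by \<alpha> and leaves by \<beta>; the
  second fits even times.\<close>

lemma weight_step:
  assumes "\<alpha> z = p" "\<beta> z = q"
  shows "weight v \<alpha> \<beta> z = of_int (sgn (z - p) * sgn (q - z)) * v powi (p - q)"
    and "weight v \<alpha> \<beta> z = of_int (sgn (p - z) * sgn (z - q)) * v powi (p - q)"
  by (simp_all add: weight_def assms sgn_if)

lemma w_mem_comp:
  assumes "x \<in> N" "x mod g \<in> cp i" shows "w x j mod g \<in> cp i"
proof (induction j)
  case (Suc j)
  then show ?case
    using cp_step[OF Suc] a.mod_mod[of "w x j"] b.mod_mod[of "w x j"] by auto
qed (use assms in simp)

lemma linked_finite_shift: "finite {y. lk (x + m * g) y} \<longleftrightarrow> finite {y. lk x y}"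
proof -
  have "{y. lk (x + m * g) y} = (\<lambda>y. y + m * g) ` {y. lk x y}"
  proof (rule subset_antisym; rule subsetI)
    fix y assume "y \<in> {y. lk (x + m * g) y}"
    then have "lk x (y - m * g)"
      using lk_shift[of x m "y - m * g"] by simp
    then show "y \<in> (\<lambda>y. y + m * g) ` {y. lk x y}"
      by (intro image_eqI[of _ _ "y - m * g"]) auto
  qed (auto simp: lk_shift)
  moreover have "inj_on (\<lambda>y. y + m * g) {y. lk x y}"
    by (rule inj_onI) simp
  ultimately show ?thesis
    by (simp add: finite_image_iff)
qed

lemma linked_finite_cong: "lk x y \<Longrightarrow> finite {z. lk x z} \<longleftrightarrow> finite {z. lk y z}"
proof -
  assume "lk x y"
  then have "lk x z \<longleftrightarrow> lk y z" for z
    using lk_trans lk_sym by blast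
  then show ?thesis by simp
qed

lemma linked_finite_comp: "j \<in> cp i \<Longrightarrow> finite {y. lk j y} \<longleftrightarrow> finite {y. lk i y}"
  using linked_finite_shift linked_finite_cong by (metis cp_iff)

end

context ncloop
begin

lemma linked_onloop: "lk x y \<Longrightarrow> onloop y"
  by (erule lk_induct) (use onloop_w[of 0] onloop_step in auto)

lemma comp_loop: "cp (x mod g) = {w x j mod g | j. True}"
proof
  have x: "x mod g \<in> fund g N"
    using xN by (rule fund_modI)
  have "x mod g \<in> cp (x mod g)"
    using x by (rule cp_refl)
  then show "{w x j mod g | j. True} \<subseteq> cp (x mod g)"
    using w_mem_comp[OF xN] by blast
  show "cp (x mod g) \<subseteq> {w x j mod g | j. True}"
  proof
    fix l assume l: "l \<in> cp (x mod g)"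
    then obtain m where m: "lk (x mod g) (l + m * g)"
      by (auto simp: cp_iff)
    obtain k' where k': "x = x mod g + k' * g"
      using mod_eq_shift[of x g "x mod g"] by auto
    then have "lk x (l + m * g + k' * g)"
      using m lk_shift[of "x mod g" k' "l + m * g"] by simp
    then have "onloop l"
      using linked_onloop onloop_shift by metis
    moreover have "l mod g = l"
      using l by (auto simp: cp_iff fund_mod)
    ultimately show "l \<in> {w x j mod g | j. True}"
      by (auto simp: onloop_def)
  qed
qed

definition "Ev = {w x j mod g | j. even j}"
definition "Od = {w x j mod g | j. odd j}"

lemma parity_iff: "w x j mod g \<in> Ev \<longleftrightarrow> even j" "w x j mod g \<in> Od \<longleftrightarrow> odd j"
proof -
  have p: "even i = even j" if "w x i mod g = w x j mod g" for i j
  proof -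
    have "i mod (2 * n) = j mod (2 * n)"
      using that dist_iff by simp
    then have "i mod (2 * n) mod 2 = j mod (2 * n) mod 2"
      by simp
    then show ?thesis
      by (simp add: mod_mod_cancel even_iff_mod_2_eq_zero)
  qed
  show "w x j mod g \<in> Ev \<longleftrightarrow> even j" "w x j mod g \<in> Od \<longleftrightarrow> odd j"
    using p unfolding Ev_def Od_def by blast+
qed

lemma steps_Suc:
  "even j \<Longrightarrow> \<alpha> (w x (Suc j)) = w x j \<and> \<beta> (w x (Suc j)) = w x (Suc (Suc j))"
  "odd j \<Longrightarrow> \<beta> (w x (Suc j)) = w x j \<and> \<alpha> (w x (Suc j)) = w x (Suc (Suc j))"
  using w_back[of j x] by auto

lemma comp_loop_Suc: "l \<in> cp (x mod g) \<Longrightarrow> \<exists>j. l = w x (Suc j) mod g"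
proof -
  assume "l \<in> cp (x mod g)"
  then obtain j where "l = w x j mod g"
    by (auto simp: comp_loop)
  also have "\<dots> = w x (j + 2 * n) mod g"
    using dist_iff[of j "j + 2 * n"] by simp
  also have "j + 2 * n = Suc (j + 2 * n - 1)"
    using n by simp
  finally show ?thesis by blast
qed

text \<open>Membership alternates along the walk, so a state is fixed by whether it contains the
  start; the even length of the loop makes both choices consistent.\<close>

lemma valid_loop: "valid g \<alpha> \<beta> (cp (x mod g)) S \<longleftrightarrow> S = Ev \<or> S = Od"
proof
  assume v: "valid g \<alpha> \<beta> (cp (x mod g)) S"
  have sub: "S \<subseteq> {w x j mod g | j. True}"
    using v by (simp add: valid_def comp_loop)
  have st: "(w x (Suc j) mod g \<in> S) \<noteq> (w x j mod g \<in> S)" for j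
  proof -
    have "w x j mod g \<in> cp (x mod g)"
      by (auto simp: comp_loop)
    then have "alternating g \<alpha> S (w x j mod g)" "alternating g \<beta> S (w x j mod g)"
      using v by (auto simp: valid_def)
    then show ?thesis
      using nofix[of j] unfolding a.alternating_mod b.alternating_mod
      by (cases "even j") (simp_all split: if_splits)
  qed
  have iff: "w x j mod g \<in> S \<longleftrightarrow> (even j \<longleftrightarrow> x mod g \<in> S)" for j
  proof (induction j)
    case (Suc j)
    then show ?case using st[of j] by (simp del: walk.simps) blast
  qed simp
  show "S = Ev \<or> S = Od"
  proof (cases "x mod g \<in> S")
    case True
    then have "S = Ev"
      using sub iff unfolding Ev_def by blast
    then show ?thesis ..
  next
    case False
    then have "S = Od"
      using sub iff unfolding Od_def by blast
    then show ?thesis ..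
  qed
next
  assume S: "S = Ev \<or> S = Od"
  have st: "(w x (Suc j) mod g \<in> S) \<noteq> (w x j mod g \<in> S)" for j
    using S parity_iff[of j] parity_iff[of "Suc j"] by (auto simp del: walk.simps)
  have "alternating g \<alpha> S l \<and> alternating g \<beta> S l" if l: "l \<in> cp (x mod g)" for l
  proof -
    obtain j where j: "l = w x (Suc j) mod g"
      using comp_loop_Suc[OF l] by blast
    show ?thesis
      using steps_Suc[of j] nofix[of j] nofix[of "Suc j"] st[of j] st[of "Suc j"]
      unfolding j a.alternating_mod b.alternating_mod
      by (cases "even j") (simp_all del: walk.simps)
  qed
  moreover have "S \<subseteq> cp (x mod g)"
    using S unfolding comp_loop Ev_def Od_def by auto
  ultimately show "valid g \<alpha> \<beta> (cp (x mod g)) S"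
    by (simp add: valid_def)
qed

text \<open>Even times are counted from 2 instead of 0, so that each has a preceding point
  \<open>w x (2 * t + 1)\<close>.\<close>

lemma Ev_image: "bij_betw (\<lambda>t. w x (2 * t + 2) mod g) {..<n} Ev"
  and Od_image: "bij_betw (\<lambda>t. w x (2 * t + 1) mod g) {..<n} Od"
proof -
  have inj2: "s = t" if "(2 * s + 2) mod (2 * n) = (2 * t + 2) mod (2 * n)" "s < n" "t < n" for s t
    using that by (cases "Suc s = n"; cases "Suc t = n") auto
  have inj1: "s = t" if "(2 * s + 1) mod (2 * n) = (2 * t + 1) mod (2 * n)" "s < n" "t < n" for s t
    using that by simp
  have ex1: "\<exists>t<n. j mod (2 * n) = (2 * t + 1) mod (2 * n)" if "odd j" for j
  proof -
    have "odd (j mod (2 * n))" using that by (simp add: dvd_mod_iff)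
    then obtain t where t: "j mod (2 * n) = 2 * t + 1" by (elim oddE)
    moreover have "j mod (2 * n) < 2 * n" using n by simp
    ultimately show ?thesis by (intro exI[of _ t]) auto
  qed
  have ex2: "\<exists>t<n. j mod (2 * n) = (2 * t + 2) mod (2 * n)" if "even j" for j
  proof -
    have "even (j mod (2 * n))" using that by (simp add: dvd_mod_iff)
    then obtain r where r: "j mod (2 * n) = 2 * r" by (elim evenE)
    have "j mod (2 * n) < 2 * n" using n by simp
    then have "r < n" using r by simp
    show ?thesis
    proof (cases r)
      case 0
      then have "(2 * (n - 1) + 2) mod (2 * n) = j mod (2 * n)"
        using n r by (cases n) auto
      then show ?thesis using n by (intro exI[of _ "n - 1"]) auto
    next
      case (Suc t)
      then show ?thesis using r \<open>r < n\<close> by (intro exI[of _ t]) auto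
    qed
  qed
  show "bij_betw (\<lambda>t. w x (2 * t + 2) mod g) {..<n} Ev"
    unfolding bij_betw_def
  proof
    show "inj_on (\<lambda>t. w x (2 * t + 2) mod g) {..<n}"
    proof (rule inj_onI)
      fix s t assume st: "s \<in> {..<n}" "t \<in> {..<n}" "w x (2 * s + 2) mod g = w x (2 * t + 2) mod g"
      show "s = t"
        by (rule inj2[OF iffD1[OF dist_iff st(3)]]) (use st in auto)
    qed
    show "(\<lambda>t. w x (2 * t + 2) mod g) ` {..<n} = Ev"
    proof
      show "(\<lambda>t. w x (2 * t + 2) mod g) ` {..<n} \<subseteq> Ev"
      proof (rule image_subsetI)
        show "w x (2 * t + 2) mod g \<in> Ev" for t
          using parity_iff(1)[of "2 * t + 2"] by (simp del: walk.simps)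
      qed
      show "Ev \<subseteq> (\<lambda>t. w x (2 * t + 2) mod g) ` {..<n}"
      proof
        fix l assume "l \<in> Ev"
        then obtain j where j: "l = w x j mod g" "even j" by (auto simp: Ev_def)
        then obtain t where t: "t < n" "j mod (2 * n) = (2 * t + 2) mod (2 * n)"
          using ex2[of j] by blast
        have "l = w x (2 * t + 2) mod g"
          unfolding j(1) by (rule iffD2[OF dist_iff t(2)])
        then show "l \<in> (\<lambda>t. w x (2 * t + 2) mod g) ` {..<n}"
          using t(1) by blast
      qed
    qed
  qed
  show "bij_betw (\<lambda>t. w x (2 * t + 1) mod g) {..<n} Od"
    unfolding bij_betw_def
  proof
    show "inj_on (\<lambda>t. w x (2 * t + 1) mod g) {..<n}"
    proof (rule inj_onI)
      fix s t assume st: "s \<in> {..<n}" "t \<in> {..<n}" "w x (2 * s + 1) mod g = w x (2 * t + 1) mod g"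
      show "s = t"
        by (rule inj1[OF iffD1[OF dist_iff st(3)]]) (use st in auto)
    qed
    show "(\<lambda>t. w x (2 * t + 1) mod g) ` {..<n} = Od"
    proof
      show "(\<lambda>t. w x (2 * t + 1) mod g) ` {..<n} \<subseteq> Od"
      proof (rule image_subsetI)
        show "w x (2 * t + 1) mod g \<in> Od" for t
          using parity_iff(2)[of "2 * t + 1"] by (simp del: walk.simps)
      qed
      show "Od \<subseteq> (\<lambda>t. w x (2 * t + 1) mod g) ` {..<n}"
      proof
        fix l assume "l \<in> Od"
        then obtain j where j: "l = w x j mod g" "odd j" by (auto simp: Od_def)
        then obtain t where t: "t < n" "j mod (2 * n) = (2 * t + 1) mod (2 * n)"
          using ex1[of j] by blast
        have "l = w x (2 * t + 1) mod g"
          unfolding j(1) by (rule iffD2[OF dist_iff t(2)])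
        then show "l \<in> (\<lambda>t. w x (2 * t + 1) mod g) ` {..<n}"
          using t(1) by blast
      qed
    qed
  qed
qed

text \<open>In the even state the exponents telescope to the displacement \<open>k * g\<close> of
  one turn, in the odd state to its negative; both states carry the product of all step directions.
  With the signs found before, this becomes -2 for \<open>k = 0\<close> and v^g + v^(-g) for
  \<open>k = 1\<close>.\<close>

lemma loop_value:
  fixes v :: "'a::field"
  assumes v: "v \<noteq> 0"
  shows "(\<Sum>S | valid g \<alpha> \<beta> (cp (x mod g)) S. \<Prod>s\<in>S. weight v \<alpha> \<beta> s) =
    of_int (\<Prod>j<2 * n. sgn (w x (Suc j) - w x j)) * (v powi (k * g) + v powi (- (k * g)))"
proof -
  let ?st = "\<lambda>j. sgn (w x (Suc j) - w x j)"
  have "(\<Prod>s\<in>Ev. weight v \<alpha> \<beta> s) = (\<Prod>t<n. weight v \<alpha> \<beta> (w x (2 * t + 2)))"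
    unfolding prod.reindex_bij_betw[OF Ev_image, symmetric] weight_mod ..
  also have "\<dots> = (\<Prod>t<n. of_int (?st (Suc (2 * t + 1)) * ?st (Suc (2 * t))) *
      v powi (w x (2 * Suc t + 1) - w x (2 * t + 1)))"
  proof (rule prod.cong[OF refl])
    fix t
    have "\<alpha> (w x (2 * t + 2)) = w x (2 * Suc t + 1)" "\<beta> (w x (2 * t + 2)) = w x (2 * t + 1)"
      using w_steps(4)[of x t] by simp_all
    from weight_step(2)[OF this, of v]
    show "weight v \<alpha> \<beta> (w x (2 * t + 2)) = of_int (?st (Suc (2 * t + 1)) * ?st (Suc (2 * t))) *
      v powi (w x (2 * Suc t + 1) - w x (2 * t + 1))"
      by (simp del: walk.simps)
  qed
  also have "\<dots> = of_int (\<Prod>j<2 * n. ?st (Suc j)) * v powi (w x (2 * n + 1) - w x 1)"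
  proof -
    have A: "(\<Prod>j<2 * n. ?st (Suc j)) = (\<Prod>t<n. ?st (Suc (2 * t + 1)) * ?st (Suc (2 * t)))"
      unfolding prod_pairs by (rule prod.cong[OF refl]) (rule mult.commute)
    have "(\<Prod>t<n. v powi (w x (2 * Suc t + 1) - w x (2 * t + 1))) = v powi (w x (2 * n + 1) - w x (2 * 0 + 1))"
      by (rule prod_powi_telescope[OF v, of "\<lambda>t. w x (2 * t + 1)"])
    then show ?thesis
      unfolding A of_int_prod by (subst prod.distrib) (simp only: mult_0_right add_0)
  qed
  \<comment> \<open>The step at time \<open>2 * n\<close> repeats the step at time 0, so a full turn
    may be counted from either.\<close>
  also have "(\<Prod>j<2 * n. ?st (Suc j)) = (\<Prod>j<2 * n. ?st j)"
  proof -
    have "?st 0 * (\<Prod>j<2 * n. ?st (Suc j)) = (\<Prod>j<2 * n. ?st j) * ?st (2 * n)"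
      using prod.lessThan_Suc_shift[of ?st "2 * n"] prod.lessThan_Suc[of ?st "2 * n"] by simp
    moreover have "?st (2 * n) = ?st 0"
      using w_per[of 0 1] w_per[of 1 1] by (simp del: walk.simps)
    moreover have "?st 0 \<noteq> 0"
      using nofix[of 0] by (simp add: sgn_eq_0_iff)
    ultimately have "?st 0 * (\<Prod>j<2 * n. ?st (Suc j)) = ?st 0 * (\<Prod>j<2 * n. ?st j)"
      by (simp only: mult.commute)
    then show ?thesis
      using \<open>?st 0 \<noteq> 0\<close> by (simp only: mult_cancel_left) blast
  qed
  also have "w x (2 * n + 1) - w x 1 = k * g"
    using w_per[of 1 1] by (simp del: walk.simps)
  finally have E: "(\<Prod>s\<in>Ev. weight v \<alpha> \<beta> s) = of_int (\<Prod>j<2 * n. ?st j) * v powi (k * g)" .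
  have "(\<Prod>s\<in>Od. weight v \<alpha> \<beta> s) = (\<Prod>t<n. weight v \<alpha> \<beta> (w x (2 * t + 1)))"
    unfolding prod.reindex_bij_betw[OF Od_image, symmetric] weight_mod ..
  also have "\<dots> = (\<Prod>t<n. of_int (?st (2 * t) * ?st (2 * t + 1)) *
      v powi ((- w x (2 * Suc t)) - (- w x (2 * t))))"
  proof (rule prod.cong[OF refl])
    fix t
    have "\<alpha> (w x (2 * t + 1)) = w x (2 * t)" "\<beta> (w x (2 * t + 1)) = w x (2 * Suc t)"
      using w_steps(2,3)[of x t] by simp_all
    from weight_step(1)[OF this, of v]
    show "weight v \<alpha> \<beta> (w x (2 * t + 1)) = of_int (?st (2 * t) * ?st (2 * t + 1)) *
      v powi ((- w x (2 * Suc t)) - (- w x (2 * t)))"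
      by (simp del: walk.simps)
  qed
  also have "\<dots> = of_int (\<Prod>j<2 * n. ?st j) * v powi (- w x (2 * n) - (- w x (2 * 0)))"
    using prod_powi_telescope[OF v, of "\<lambda>t. - w x (2 * t)" n]
    by (simp add: prod.distrib prod_pairs del: walk.simps)
  also have "- w x (2 * n) - (- w x (2 * 0)) = - (k * g)"
    using ret by simp
  finally have O: "(\<Prod>s\<in>Od. weight v \<alpha> \<beta> s) = of_int (\<Prod>j<2 * n. ?st j) * v powi (- (k * g))" .
  have "{S. valid g \<alpha> \<beta> (cp (x mod g)) S} = {Ev, Od}"
    unfolding valid_loop by auto
  moreover have "Ev \<noteq> Od"
    using parity_iff[of 0] by auto
  ultimately show ?thesis
    using E O by (simp add: distrib_left)
qed

end

context ncpair
begin

abbreviation "csum v K \<equiv> (\<Sum>S | valid g \<alpha> \<beta> K S. \<Prod>s\<in>S. weight v \<alpha> \<beta> s)"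

text \<open>A lifted component is finite exactly when its winding number vanishes, which matches the
  encoding of contractibility.\<close>

lemma comp_loop_value:
  fixes v :: "'a::field"
  assumes v: "v \<noteq> 0" and i: "i \<in> fund g N"
    and loop: "\<And>j. j \<in> cp i \<Longrightarrow> \<alpha> j \<noteq> j \<and> \<beta> j \<noteq> j"
  shows "finite {y. lk i y} \<Longrightarrow> csum v (cp i) = - 2"
    and "infinite {y. lk i y} \<Longrightarrow> csum v (cp i) = v powi g + v powi (- g) \<and>
      (\<exists>z n k. outerloop g \<alpha> \<beta> N z n k)"
proof -
  have nofix: "w z (Suc j) \<noteq> w z j" if z: "z \<in> cp i" for z j
  proof -
    have "z \<in> N" "z mod g = z"
      using z by (auto simp: cp_iff fund_def)
    then have "w z j mod g \<in> cp i"
      using w_mem_comp z by simp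
    then show ?thesis
      using loop[of "w z j mod g"] a.mod_fixed b.mod_fixed by auto
  qed
  have ncl: "\<exists>n k. ncloop g \<alpha> \<beta> N z n k" if z: "z \<in> cp i" for z
  proof -
    obtain n k where "n \<ge> 1" "w z (2 * n) = z + k * g"
      "\<And>i j. i < 2 * n \<Longrightarrow> j < 2 * n \<Longrightarrow> w z i mod g = w z j mod g \<Longrightarrow> i = j"
      using loop_data[OF nofix[OF z]] by blast
    moreover have "z \<in> N" using z by (auto simp: cp_iff fund_def)
    ultimately have "ncloop g \<alpha> \<beta> N z n k"
      using nofix[OF z] by unfold_locales auto
    then show ?thesis by blast
  qed
  have fin_k: "finite {y. lk z y}" if "ncloop g \<alpha> \<beta> N z n 0" for z n
  proof -
    interpret L: ncloop g \<alpha> \<beta> N z n 0 by fact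
    have "w z j \<in> w z ` {..<2 * n}" for j
    proof -
      have "w z j = w z (j mod (2 * n))"
        using L.w_per[of "j mod (2 * n)" "j div (2 * n)"] by simp
      then show ?thesis using L.n by auto
    qed
    then have "range (w z) \<subseteq> w z ` {..<2 * n}"
      by blast
    then have fw: "finite (range (w z))"
      by (rule finite_subset) simp
    have step: "\<alpha> (w z j) \<in> range (w z) \<and> \<beta> (w z j) \<in> range (w z)" for j
    proof -
      have "w z j = w z (j + 2 * n)"
        using L.w_per[of j 1] by simp
      also have "j + 2 * n = Suc (j + 2 * n - 1)"
        using L.n by simp
      finally obtain i where i: "w z j = w z (Suc i)" by blast
      show ?thesis
        unfolding i using L.steps_Suc[of i] by (cases "even i") (simp_all del: walk.simps)
    qed
    have "y \<in> range (w z)" if "lk z y" for y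
      using that
    proof (rule lk_induct)
      show "z \<in> range (w z)" by (metis rangeI walk.simps(1))
    qed (use step in blast)
    then show ?thesis
      using fw finite_subset[of "{y. lk z y}"] by blast
  qed
  have inf_k: "infinite {y. lk z y}" if "ncloop g \<alpha> \<beta> N z n k" "k \<noteq> 0" for z n k
  proof -
    interpret L: ncloop g \<alpha> \<beta> N z n k by fact
    have "infinite (range (w z))"
      using L.w_inj_all[OF that(2)] finite_imageD infinite_UNIV_nat by blast
    moreover have "range (w z) \<subseteq> {y. lk z y}"
      using lk_w by blast
    ultimately show ?thesis
      using finite_subset by blast
  qed
  have im: "i mod g = i" "i \<in> cp i"
    using i fund_mod cp_refl by auto
  show "csum v (cp i) = - 2" if fin: "finite {y. lk i y}"
  proof -
    obtain n k where L: "ncloop g \<alpha> \<beta> N i n k"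
      using ncl[OF im(2)] by blast
    have "k = 0" using inf_k[OF L] fin by blast
    show ?thesis
      using ncloop.loop_value[OF L v] unfolding ncloop.contractible_sign[OF L \<open>k = 0\<close>] im(1)
      by (simp add: \<open>k = 0\<close>)
  qed
  show "csum v (cp i) = v powi g + v powi (- g) \<and> (\<exists>z n k. outerloop g \<alpha> \<beta> N z n k)"
    if inf: "infinite {y. lk i y}"
  proof -
    \<comment> \<open>The signed length of the upper arc at a point. Its maximum over the loop is
      positive, since the two ends of an arc have opposite values; the loop is restarted there to
      meet the requirements of \<open>outerloop\<close>.\<close>
    define f where "f = (\<lambda>z. \<alpha> z - z)"
    have fmod: "f (z mod g) = f z" for z
      by (simp add: f_def a.mod_shift)
    have finK: "finite (cp i)"
      using cp_sub finite_fund finite_subset by blast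
    obtain z where z: "z \<in> cp i" "\<And>j. j \<in> cp i \<Longrightarrow> f j \<le> f z"
    proof -
      have "Max (f ` cp i) \<in> f ` cp i"
        using finK im(2) by (intro Max_in) auto
      then show ?thesis
        using that finK by (metis (no_types, lifting) Max_ge finite_imageI imageE imageI)
    qed
    have zz: "z mod g = z" "z \<in> N"
      using z(1) by (auto simp: cp_iff fund_def)
    have "f (\<alpha> i mod g) = - f i"
      unfolding fmod by (simp add: f_def a.inv)
    then have "f z > 0"
      using z(2)[OF im(2)] z(2)[OF cp_step(1)[OF im(2)]] loop[OF im(2)] by (auto simp: f_def)
    obtain n k where L: "ncloop g \<alpha> \<beta> N z n k"
      using ncl[OF z(1)] by blast
    have k0: "k \<noteq> 0"
      using fin_k[of z n] L inf linked_finite_comp[OF z(1)] by blast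
    have "f (w z j) \<le> f z" for j
      using z(2)[OF w_mem_comp[OF zz(2), of i j]] z(1) zz(1) unfolding fmod by simp
    then have "outerloop g \<alpha> \<beta> N z n k"
      using L k0 \<open>f z > 0\<close> by (simp add: outerloop_def outerloop_axioms_def f_def)
    then interpret O: outerloop g \<alpha> \<beta> N z n k .
    have "csum v (cp z) = v powi g + v powi (- g)"
      using O.loop_value[OF v] unfolding O.outer_sign1 zz(1) by (simp add: O.k_eq_1)
    then show ?thesis
      using cp_eq[OF z(1)] \<open>outerloop g \<alpha> \<beta> N z n k\<close> by auto
  qed
qed

text \<open>The free start lies outside every state, so alternation forces a state to consist of the
  points at odd times. The far end is free as well and must also be left out: this is impossible for
  odd \<open>e\<close>, and leaves a single state for even \<open>e\<close>, with the sign given by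
  \<open>path_sign\<close>.\<close>

lemma path_comp:
  fixes v :: "'a::field"
  assumes t: "t \<in> fund g N" and fix_t: "\<beta> t = t"
    and e: "w t (Suc e) = w t e" and nofix: "\<And>j. j < e \<Longrightarrow> w t (Suc j) \<noteq> w t j"
    and dist: "\<And>i j. i \<le> e \<Longrightarrow> j \<le> e \<Longrightarrow> w t i mod g = w t j mod g \<Longrightarrow> i = j"
  shows "{y. lk t y} = w t ` {..e}"
    and "odd e \<Longrightarrow> \<not> valid g \<alpha> \<beta> (cp t) S"
    and "even e \<Longrightarrow> v \<noteq> 0 \<Longrightarrow> csum v (cp t) = v powi (t - w t e)"
proof -
  have tN: "t \<in> N" and tm: "t mod g = t"
    using t by (auto simp: fund_def)
  show lkt: "{y. lk t y} = w t ` {..e}"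
  proof
    show "w t ` {..e} \<subseteq> {y. lk t y}" using lk_w by auto
    have "y \<in> w t ` {..e}" if "lk t y" for y
      using that
    proof (rule lk_induct)
      show "t \<in> w t ` {..e}" by (metis atMost_iff imageI le0 walk.simps(1))
    qed (use path_closed[OF fix_t e] in auto)
    then show "{y. lk t y} \<subseteq> w t ` {..e}" by blast
  qed
  have comp: "cp t = (\<lambda>j. w t j mod g) ` {..e}"
  proof
    show "(\<lambda>j. w t j mod g) ` {..e} \<subseteq> cp t"
      using w_mem_comp[OF tN] cp_refl[OF t] tm by auto
    show "cp t \<subseteq> (\<lambda>j. w t j mod g) ` {..e}"
    proof
      fix l assume l: "l \<in> cp t"
      then obtain m where "lk t (l + m * g)" by (auto simp: cp_iff)
      then obtain j where j: "j \<le> e" "l + m * g = w t j"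
        using lkt by auto
      have "l = (l + m * g) mod g"
        using l fund_mod[of l g N] by (simp add: cp_iff)
      then show "l \<in> (\<lambda>j. w t j mod g) ` {..e}"
        using j by auto
    qed
  qed
  have alt: "w t j mod g \<in> S \<longleftrightarrow> odd j" if v: "valid g \<alpha> \<beta> (cp t) S" and j: "j \<le> e" for S j
    using j
  proof (induction j)
    case 0
    have "alternating g \<beta> S (t mod g)"
      using v cp_refl[OF t] tm by (simp add: valid_def)
    then show ?case
      unfolding b.alternating_mod using fix_t by simp
  next
    case (Suc j)
    have "w t j mod g \<in> cp t"
      using Suc comp by auto
    then have "alternating g \<alpha> S (w t j mod g)" "alternating g \<beta> S (w t j mod g)"
      using v by (auto simp: valid_def)
    then have "(w t (Suc j) mod g \<in> S) \<noteq> (w t j mod g \<in> S)"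
      using nofix[of j] Suc unfolding a.alternating_mod b.alternating_mod
      by (cases "even j") (simp_all split: if_splits)
    then show ?case
      using Suc by (simp del: walk.simps)
  qed
  show "\<not> valid g \<alpha> \<beta> (cp t) S" if o: "odd e"
  proof
    assume v: "valid g \<alpha> \<beta> (cp t) S"
    have "w t e mod g \<in> cp t" using comp by auto
    then have "alternating g \<beta> S (w t e mod g)"
      using v by (auto simp: valid_def)
    then have "w t e mod g \<notin> S"
      using o e unfolding b.alternating_mod by simp
    then show False
      using alt[OF v, of e] o by simp
  qed
  show "csum v (cp t) = v powi (t - w t e)" if ev: "even e" and v: "v \<noteq> 0"
  proof -
    obtain m where m: "e = 2 * m" using ev by (elim evenE)
    define S0 where "S0 = {w t j mod g | j. j \<le> e \<and> odd j}"
    have S0: "w t j mod g \<in> S0 \<longleftrightarrow> odd j" if "j \<le> e" for j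
      using that dist unfolding S0_def by blast
    have "S = S0" if S: "valid g \<alpha> \<beta> (cp t) S" for S
    proof -
      have "S \<subseteq> cp t" "S0 \<subseteq> cp t"
        using S comp by (auto simp: valid_def S0_def)
      moreover have "l \<in> S \<longleftrightarrow> l \<in> S0" if "l \<in> cp t" for l
        using that alt[OF S] S0 unfolding comp by auto
      ultimately show ?thesis by blast
    qed
    moreover have "valid g \<alpha> \<beta> (cp t) S0"
    proof -
      have st: "(w t (Suc j) mod g \<in> S0) \<noteq> (w t j mod g \<in> S0)" if "j < e" for j
        using S0[of j] S0[of "Suc j"] that by (simp del: walk.simps)
      have "alternating g \<alpha> S0 l \<and> alternating g \<beta> S0 l" if l: "l \<in> cp t" for l
      proof -
        obtain j where j: "l = w t j mod g" "j \<le> e"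
          using l comp by auto
        have fwd: "alternating g (if even j then \<alpha> else \<beta>) S0 l"
        proof (cases "j = e")
          case True
          then show ?thesis
            using e ev S0[of e] unfolding j(1) by (simp add: a.alternating_mod)
        next
          case False
          then show ?thesis
            using st[of j] nofix[of j] j unfolding j(1)
            by (cases "even j") (simp_all add: a.alternating_mod b.alternating_mod)
        qed
        have bwd: "alternating g (if even j then \<beta> else \<alpha>) S0 l"
        proof (cases j)
          case 0
          then show ?thesis
            using S0[of 0] fix_t b.alternating_mod[of S0 t] unfolding j(1) by simp
        next
          case (Suc i)
          have "(if even i then \<alpha> else \<beta>) (w t j) = w t i"
            using w_back[of i t] Suc by simp
          then show ?thesis
            using st[of i] nofix[of i] j Suc unfolding j(1)
            by (cases "even i") (simp_all add: a.alternating_mod b.alternating_mod del: walk.simps)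
        qed
        show ?thesis using fwd bwd by (cases "even j") auto
      qed
      moreover have "S0 \<subseteq> cp t"
        using comp by (auto simp: S0_def)
      ultimately show ?thesis by (simp add: valid_def)
    qed
    ultimately have vs: "{S. valid g \<alpha> \<beta> (cp t) S} = {S0}" by blast
    have bij: "bij_betw (\<lambda>s. w t (2 * s + 1) mod g) {..<m} S0"
      unfolding bij_betw_def
    proof
      show "inj_on (\<lambda>s. w t (2 * s + 1) mod g) {..<m}"
      proof (rule inj_onI)
        fix r s assume "r \<in> {..<m}" "s \<in> {..<m}" "w t (2 * r + 1) mod g = w t (2 * s + 1) mod g"
        then have "2 * r + 1 = 2 * s + 1"
          using m by (intro dist) auto
        then show "r = s" by simp
      qed
      show "(\<lambda>s. w t (2 * s + 1) mod g) ` {..<m} = S0"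
      proof
        show "(\<lambda>s. w t (2 * s + 1) mod g) ` {..<m} \<subseteq> S0"
        proof (rule image_subsetI)
          fix s assume "s \<in> {..<m}"
          then show "w t (2 * s + 1) mod g \<in> S0"
            using S0[of "2 * s + 1"] m by simp
        qed
        show "S0 \<subseteq> (\<lambda>s. w t (2 * s + 1) mod g) ` {..<m}"
        proof
          fix l assume "l \<in> S0"
          then obtain j where j: "l = w t j mod g" "j \<le> e" "odd j" by (auto simp: S0_def)
          then obtain s where "j = 2 * s + 1" by (elim oddE)
          then show "l \<in> (\<lambda>s. w t (2 * s + 1) mod g) ` {..<m}"
            using j m by auto
        qed
      qed
    qed
    let ?st = "\<lambda>j. sgn (w t (Suc j) - w t j)"
    have "(\<Prod>s\<in>S0. weight v \<alpha> \<beta> s) = (\<Prod>s<m. weight v \<alpha> \<beta> (w t (2 * s + 1)))"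
      unfolding prod.reindex_bij_betw[OF bij, symmetric] weight_mod ..
    also have "\<dots> = (\<Prod>s<m. of_int (?st (2 * s) * ?st (2 * s + 1)) *
        v powi ((- w t (2 * Suc s)) - (- w t (2 * s))))"
    proof (rule prod.cong[OF refl])
      fix s
      have "\<alpha> (w t (2 * s + 1)) = w t (2 * s)" "\<beta> (w t (2 * s + 1)) = w t (2 * Suc s)"
        using w_steps(2,3)[of t s] by simp_all
      from weight_step(1)[OF this, of v]
      show "weight v \<alpha> \<beta> (w t (2 * s + 1)) = of_int (?st (2 * s) * ?st (2 * s + 1)) *
        v powi ((- w t (2 * Suc s)) - (- w t (2 * s)))"
        by (simp del: walk.simps)
    qed
    also have "\<dots> = of_int (\<Prod>j<2 * m. ?st j) * v powi (- w t (2 * m) - (- w t (2 * 0)))"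
      using prod_powi_telescope[OF v, of "\<lambda>s. - w t (2 * s)" m]
      by (simp add: prod.distrib prod_pairs del: walk.simps)
    also have "(\<Prod>j<2 * m. ?st j) = 1"
      by (rule path_sign[OF tN fix_t]) (use e nofix dist m in auto)
    finally show ?thesis
      unfolding vs by (simp add: m)
  qed
qed

end

section \<open>The state sum of a diagram equals its Gram product\<close>

context ncpair
begin

lemma lk_N: "lk x y \<Longrightarrow> x \<in> N \<Longrightarrow> y \<in> N"
  by (erule lk_induct) (use a.in_N b.in_N in auto)

text \<open>The second lower free end can only be the far end of the walk, reached at an odd time,
  so no state exists.\<close>

lemma csum_two_ends:
  fixes v :: "'a::field"
  assumes t: "t \<in> fund g N" "\<beta> t = t" and z: "lk t z" "z \<noteq> t" "\<beta> z = z"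
  shows "csum v (cp t) = 0"
proof -
  obtain e where e: "w t (Suc e) = w t e" and nf: "\<And>j. j < e \<Longrightarrow> w t (Suc j) \<noteq> w t j"
    and d: "\<And>i j. i \<le> e \<Longrightarrow> j \<le> e \<Longrightarrow> w t i mod g = w t j mod g \<Longrightarrow> i = j"
    using path_data[OF t(2)] by blast
  have "z \<in> w t ` {..e}"
    using path_comp(1)[OF t e nf d] z(1) by blast
  then obtain j where j: "z = w t j" "j \<le> e"
    by blast
  then obtain i where i: "j = Suc i"
    using z(2) by (cases j) auto
  have "odd j"
  proof
    assume "even j"
    then have "\<beta> (w t (Suc i)) = w t i"
      using w_back[of i t] i by simp
    then show False
      using z(3) nf[of i] j i by simp
  qed
  moreover have "j = e"
  proof (rule ccontr)
    assume "j \<noteq> e"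
    then show False
      using nf[of j] j z(3) \<open>odd j\<close> by simp
  qed
  ultimately have "{S. valid g \<alpha> \<beta> (cp t) S} = {}"
    using path_comp(2)[OF t e nf d] by blast
  then show ?thesis by simp
qed

lemma csum_one_end:
  fixes v :: "'a::field"
  assumes v: "v \<noteq> 0" and t: "t \<in> fund g N" "\<beta> t = t"
    and one: "\<And>z. lk t z \<Longrightarrow> \<beta> z = z \<Longrightarrow> z = t"
  obtains m where "\<alpha> (w t (2 * m)) = w t (2 * m)" "\<And>j. j < 2 * m \<Longrightarrow> w t (Suc j) \<noteq> w t j"
    "csum v (cp t) = v powi (t - w t (2 * m))"
proof -
  obtain e where e: "w t (Suc e) = w t e" and nf: "\<And>j. j < e \<Longrightarrow> w t (Suc j) \<noteq> w t j"
    and d: "\<And>i j. i \<le> e \<Longrightarrow> j \<le> e \<Longrightarrow> w t i mod g = w t j mod g \<Longrightarrow> i = j"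
    using path_data[OF t(2)] by blast
  have "even e"
  proof (rule ccontr)
    assume o: "odd e"
    then have "\<beta> (w t e) = w t e" using e by simp
    then have "w t e = w t 0"
      using one lk_w by simp
    then show False
      using d[of e 0] o by simp
  qed
  then obtain m where m: "e = 2 * m" by (elim evenE)
  show ?thesis
  proof (rule that[of m])
    show "\<alpha> (w t (2 * m)) = w t (2 * m)"
      using e unfolding m by simp
    show "w t (Suc j) \<noteq> w t j" if "j < 2 * m" for j
      using nf that unfolding m .
    show "csum v (cp t) = v powi (t - w t (2 * m))"
      using path_comp(3)[OF t e nf d \<open>even e\<close> v] unfolding m .
  qed
qed

definition "bad_pair \<longleftrightarrow> (\<exists>i\<in>fund g N. \<exists>y z. lk i y \<and> lk i z \<and> y \<noteq> z \<and>
  (\<alpha> y = y \<and> \<alpha> z = z \<or> \<beta> y = y \<and> \<beta> z = z))"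

lemma csum_swap:
  fixes v :: "'a::field"
  shows "ncpair.csum g \<beta> \<alpha> (inverse v) K = csum v K"
  by (simp add: valid_swap weight_swap[of v \<alpha> \<beta>])

lemma bad_pair_sum:
  fixes v :: "'a::field"
  assumes bad_pair
  shows "\<exists>K\<in>cp ` fund g N. csum v K = 0"
proof -
  interpret S: ncpair g \<beta> \<alpha> N by (rule swap)
  obtain i y z where i: "i \<in> fund g N" and yz: "lk i y" "lk i z" "y \<noteq> z"
      "\<alpha> y = y \<and> \<alpha> z = z \<or> \<beta> y = y \<and> \<beta> z = z"
    using assms unfolding bad_pair_def by blast
  define t where "t = y mod g"
  have yN: "y \<in> N" using lk_N yz(1) i by (auto simp: fund_def)
  have t: "t \<in> fund g N" unfolding t_def using yN by (rule fund_modI)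
  obtain m where m: "t = y + m * g"
    unfolding t_def by (metis mod_eq_shift mod_mod_trivial)
  have "lk y z" using yz lk_sym lk_trans by blast
  then have l: "lk t (z + m * g)" "z + m * g \<noteq> t"
    using yz(3) unfolding m lk_shift by auto
  from yz(4) have "csum v (cp t) = 0"
  proof
    assume "\<alpha> y = y \<and> \<alpha> z = z"
    then have "\<alpha> t = t" "\<alpha> (z + m * g) = z + m * g"
      unfolding m by (simp_all add: a.per_k)
    then have "S.csum (inverse v) (S.cp t) = 0"
      using S.csum_two_ends[OF t] l by (simp add: linked_swap)
    then show ?thesis
      by (simp add: csum_swap comp_swap del: sum.neutral_const)
  next
    assume "\<beta> y = y \<and> \<beta> z = z"
    then have "\<beta> t = t" "\<beta> (z + m * g) = z + m * g"
      unfolding m by (simp_all add: b.per_k)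
    then show ?thesis
      using csum_two_ends[OF t] l by simp
  qed
  then show ?thesis using t by blast
qed

text \<open>Displacements are measured from the upper end, whereas the walk results start at a point
  fixed by the second involution. Hence the pair is swapped and \<open>v\<close> inverted. The far
  end of the walk is the point that the definite description selects.\<close>

lemma through_path:
  fixes v :: "'a::field"
  assumes v: "v \<noteq> 0" and good: "\<not> bad_pair" and s: "s \<in> fund g N" "\<alpha> s = s"
  shows "csum v (cp s) = v powi ((THE y. lk s y \<and> \<beta> y = y) - s)"
    and "\<not> outerloop g \<alpha> \<beta> N z n k"
proof -
  interpret S: ncpair g \<beta> \<alpha> N by (rule swap)
  have one: "z = s" if "S.lk s z" "\<alpha> z = z" for z
    using good s that lk_refl[of s] unfolding bad_pair_def linked_swap[of \<beta> \<alpha>] by blast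
  have iv: "inverse v \<noteq> 0" using v by simp
  obtain m where m: "\<beta> (S.w s (2 * m)) = S.w s (2 * m)"
      "\<And>j. j < 2 * m \<Longrightarrow> S.w s (Suc j) \<noteq> S.w s j"
      "S.csum (inverse v) (S.cp s) = inverse v powi (s - S.w s (2 * m))"
    using S.csum_one_end[OF iv s one] by blast
  have l: "lk s (S.w s (2 * m))"
    using S.lk_w[of s "2 * m"] unfolding linked_swap[of \<beta> \<alpha>] .
  have "(THE y. lk s y \<and> \<beta> y = y) = S.w s (2 * m)"
  proof (rule the_equality)
    show "lk s (S.w s (2 * m)) \<and> \<beta> (S.w s (2 * m)) = S.w s (2 * m)"
      using l m(1) by blast
    show "y = S.w s (2 * m)" if "lk s y \<and> \<beta> y = y" for y
      using good that l m(1) s(1) unfolding bad_pair_def by blast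
  qed
  moreover have "inverse v powi (s - S.w s (2 * m)) = v powi (S.w s (2 * m) - s)"
    using power_int_minus[of v "s - S.w s (2 * m)"] by (simp add: power_int_inverse)
  ultimately show "csum v (cp s) = v powi ((THE y. lk s y \<and> \<beta> y = y) - s)"
    using m(3) by (simp only: csum_swap comp_swap[of g N \<beta> \<alpha>])
  show "\<not> outerloop g \<alpha> \<beta> N z n k"
  proof
    assume "outerloop g \<alpha> \<beta> N z n k"
    then interpret O: outerloop g \<alpha> \<beta> N z n k .
    show False
      by (rule O.no_through_path[OF _ s(2) m(1) m(2)]) (use s in \<open>simp_all add: fund_def\<close>)
  qed
qed

definition "loopcomp K \<longleftrightarrow> (\<forall>i\<in>K. \<alpha> i \<noteq> i \<and> \<beta> i \<noteq> i)"
definition "loops0 = {K \<in> cp ` fund g N. loopcomp K \<and> (\<exists>i\<in>K. finite {y. lk i y})}"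
definition "loopsT = {K \<in> cp ` fund g N. loopcomp K \<and> (\<exists>i\<in>K. infinite {y. lk i y})}"
definition "ends = {s \<in> fund g N. \<alpha> s = s}"

lemma loop_values:
  fixes v :: "'a::field"
  assumes v: "v \<noteq> 0"
  shows "K \<in> loops0 \<Longrightarrow> csum v K = - 2"
    and "K \<in> loopsT \<Longrightarrow> csum v K = v powi g + v powi (- g) \<and> (\<exists>z n k. outerloop g \<alpha> \<beta> N z n k)"
proof -
  have *: "\<exists>i\<in>fund g N. K = cp i \<and> Q {y. lk i y}"
    if "K \<in> cp ` fund g N" "\<exists>i\<in>K. Q {y. lk i y}" for K Q
    using that cp_eq cp_sub by blast
  show "csum v K = - 2" if K: "K \<in> loops0"
  proof -
    obtain i where i: "i \<in> fund g N" "K = cp i" "finite {y. lk i y}"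
      using K *[of K finite] unfolding loops0_def by blast
    then show ?thesis
      using comp_loop_value(1)[OF v i(1)] K unfolding loops0_def loopcomp_def by blast
  qed
  show "csum v K = v powi g + v powi (- g) \<and> (\<exists>z n k. outerloop g \<alpha> \<beta> N z n k)" if K: "K \<in> loopsT"
  proof -
    obtain i where i: "i \<in> fund g N" "K = cp i" "infinite {y. lk i y}"
      using K *[of K infinite] unfolding loopsT_def by blast
    then show ?thesis
      using comp_loop_value(2)[OF v i(1)] K unfolding loopsT_def loopcomp_def by blast
  qed
qed

text \<open>A path between the two ends would have to pass a loop around the cylinder. The rational
  value 1 is inserted for \<open>v\<close> just to reach the geometric conclusions of the two
  lemmas.\<close>

lemma loopsT_empty:
  assumes "\<not> bad_pair" "ends \<noteq> {}"
  shows "loopsT = {}"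
  using assms through_path(2)[of "1 :: rat"] loop_values(2)[of "1 :: rat"] unfolding ends_def by fastforce

theorem gram_sum:
  fixes v :: "'a::field"
  assumes v: "v \<noteq> 0"
  shows "csum v (fund g N) = (if bad_pair then 0 else
    (- 2) ^ card loops0 * (v powi g + v powi (- g)) ^ card loopsT *
      v powi (\<Sum>s\<in>ends. (THE y. lk s y \<and> \<beta> y = y) - s))"
proof (cases bad_pair)
  case True
  then obtain K where "K \<in> cp ` fund g N" "csum v K = 0"
    using bad_pair_sum[of v] by blast
  then have "(\<Prod>K\<in>cp ` fund g N. csum v K) = 0"
    using finite_fund by (intro prod_zero) auto
  then show ?thesis
    unfolding sum_valid using True by simp
next
  case False
  let ?C = "cp ` fund g N"
  have fin: "finite ?C" using finite_fund by blast
  have disj: "loops0 \<inter> loopsT = {}"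
  proof -
    have False if K: "K \<in> loops0" "K \<in> loopsT" for K
    proof -
      obtain i j where ij: "i \<in> K" "j \<in> K" "finite {y. lk i y}" "infinite {y. lk j y}" "K \<in> ?C"
        using K unfolding loops0_def loopsT_def by blast
      then obtain l where "K = cp l" by blast
      then show False
        using ij linked_finite_comp by blast
    qed
    then show ?thesis by blast
  qed
  define R where "R = {K \<in> ?C. \<not> loopcomp K}"
  have ne: "\<exists>i. i \<in> K" if "K \<in> ?C" for K
    using that cp_refl by blast
  have split: "?C = loops0 \<union> (loopsT \<union> R)"
    using ne unfolding loops0_def loopsT_def R_def by blast
  have dR: "loops0 \<inter> (loopsT \<union> R) = {}" "loopsT \<inter> R = {}"
    using disj unfolding R_def loops0_def loopsT_def by blast+
  \<comment> \<open>A component that is not a loop has a free end; if that end is a lower one, the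
    path leads to an upper one, because the pair is not bad.\<close>
  have R: "R = cp ` ends"
  proof
    show "cp ` ends \<subseteq> R"
    proof (rule image_subsetI)
      fix s assume "s \<in> ends"
      then show "cp s \<in> R"
        using cp_refl[of s] unfolding R_def loopcomp_def ends_def by blast
    qed
    show "R \<subseteq> cp ` ends"
    proof
      fix K assume K: "K \<in> R"
      then obtain l j where l: "K = cp l" "j \<in> cp l" "\<alpha> j = j \<or> \<beta> j = j"
        unfolding R_def loopcomp_def by blast
      have j: "j \<in> fund g N" "K = cp j"
        using l cp_sub cp_eq by blast+
      show "K \<in> cp ` ends"
      proof (cases "\<alpha> j = j")
        case True
        then show ?thesis using j by (auto simp: ends_def)
      next
        case False
        then have b: "\<beta> j = j" using l by blast
        have one: "z = j" if "lk j z" "\<beta> z = z" for z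
          using \<open>\<not> bad_pair\<close> that b j lk_refl[of j] unfolding bad_pair_def by blast
        obtain m where m: "\<alpha> (w j (2 * m)) = w j (2 * m)"
          using csum_one_end[OF v j(1) b one] by blast
        let ?s = "w j (2 * m) mod g"
        have "?s \<in> cp j"
          using cp_memI[OF lk_w] w_N j(1) by (simp add: fund_def)
        moreover have "\<alpha> ?s = ?s"
          using m by (simp only: a.mod_fixed)
        ultimately have "?s \<in> ends" "cp ?s = K"
          using cp_sub cp_eq j(2) unfolding ends_def by blast+
        then show ?thesis by blast
      qed
    qed
  qed
  have inj: "inj_on cp ends"
  proof (rule inj_onI)
    fix s t assume st: "s \<in> ends" "t \<in> ends" "cp s = cp t"
    then have "t \<in> cp s"
      using cp_refl[of t] by (auto simp: ends_def)
    then obtain m where "lk s (t + m * g)"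
      by (auto simp: cp_iff)
    moreover have "\<alpha> (t + m * g) = t + m * g"
      using st by (simp add: a.per_k ends_def)
    ultimately have "s = t + m * g"
      using False st(1) lk_refl[of s] unfolding bad_pair_def ends_def by blast
    then have "s mod g = t mod g" by simp
    then show "s = t"
      using st by (simp add: ends_def fund_def)
  qed
  have finE: "finite ends"
    using finite_fund by (simp add: ends_def)
  have powi_sum: "(\<Prod>s\<in>E. v powi h s) = v powi (\<Sum>s\<in>E. h s)" if "finite E" for E and h :: "int \<Rightarrow> int"
    using that by (induction E rule: finite_induct) (simp_all add: power_int_add v)
  have "csum v (fund g N) = (\<Prod>K\<in>loops0. csum v K) * ((\<Prod>K\<in>loopsT. csum v K) * (\<Prod>K\<in>R. csum v K))"
    unfolding sum_valid using split dR fin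
    by (metis (no_types, lifting) finite_Un prod.union_disjoint)
  also have "(\<Prod>K\<in>loops0. csum v K) = (- 2) ^ card loops0"
    using loop_values(1)[OF v] by simp
  also have "(\<Prod>K\<in>loopsT. csum v K) = (v powi g + v powi (- g)) ^ card loopsT"
    using loop_values(2)[OF v] by simp
  also have "(\<Prod>K\<in>R. csum v K) = (\<Prod>s\<in>ends. v powi ((THE y. lk s y \<and> \<beta> y = y) - s))"
    unfolding R prod.reindex[OF inj] o_def
    by (rule prod.cong[OF refl]) (use through_path(1)[OF v False] in \<open>auto simp: ends_def\<close>)
  also have "\<dots> = v powi (\<Sum>s\<in>ends. (THE y. lk s y \<and> \<beta> y = y) - s)"
    using finE by (rule powi_sum)
  finally show ?thesis
    using False by (simp add: mult.assoc)
qed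

end

section \<open>The Gram determinant\<close>

text \<open>The default value makes free nodes and plus signs fixed points, as \<open>ncinv\<close>
  expects.\<close>

definition mate :: "int \<Rightarrow> (int \<times> int) set \<Rightarrow> int \<Rightarrow> int" where
  "mate g A x = (if hasArc g A x then THE y. (x, y) \<in> lift g A \<or> (y, x) \<in> lift g A else x)"

definition cover :: "int \<Rightarrow> int set \<Rightarrow> int set" where
  "cover g P = {x. x mod g \<in> nodes g P}"

text \<open>The entries of the diagonal matrix by which the product of the two transition matrices
  is conjugated.\<close>

definition arcweight :: "'a::field \<Rightarrow> (int \<times> int) set \<Rightarrow> 'a" where
  "arcweight v A = (\<Prod>(i, j)\<in>A. v powi (i + j))"

lemma fund_cover: "g > 0 \<Longrightarrow> fund g (cover g P) = nodes g P"
  by (auto simp: fund_def cover_def nodes_def)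

context meander
begin

lemma mate_eq:
  assumes "(x, y) \<in> lift g A"
  shows "mate g A x = y" "mate g A y = x"
proof -
  have h: "hasArc g A x" "hasArc g A y"
    using assms hasArc_lift by blast+
  have "(THE z. (x, z) \<in> lift g A \<or> (z, x) \<in> lift g A) = y"
    using assms lift_left_unique lift_not_both by (intro the_equality) blast+
  then show "mate g A x = y" using h by (simp add: mate_def)
  have "(THE z. (y, z) \<in> lift g A \<or> (z, y) \<in> lift g A) = x"
    using assms lift_right_unique lift_not_both by (intro the_equality) blast+
  then show "mate g A y = x" using h by (simp add: mate_def)
qed

lemma mate_lift: "hasArc g A x \<Longrightarrow> (x, mate g A x) \<in> lift g A \<or> (mate g A x, x) \<in> lift g A"
  using mate_eq unfolding hasArc_def by blast

lemma mate_fixed: "mate g A x = x \<longleftrightarrow> \<not> hasArc g A x"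
proof
  assume m: "mate g A x = x"
  show "\<not> hasArc g A x"
  proof
    assume "hasArc g A x"
    then have "(x, x) \<in> lift g A" using mate_lift m by metis
    then show False using liftD(1) by blast
  qed
qed (simp add: mate_def)

lemma mate_ncinv: "ncinv g (mate g A) (cover g P)"
proof
  show "g > 0" by (rule g_pos)
  show "mate g A (x + g) = mate g A x + g" for x
  proof (cases "hasArc g A x")
    case True
    then show ?thesis
      using mate_lift[OF True] lift_shift[of x 1 g "mate g A x" A] lift_shift[of "mate g A x" 1 g x A]
        mate_eq[of "x + g" "mate g A x + g"] mate_eq[of "mate g A x + g" "x + g"] by auto
  next
    case False
    then show ?thesis
      using hasArc_shift[of g A x 1] by (simp add: mate_def)
  qed
  show "mate g A (mate g A x) = x" for x
  proof (cases "hasArc g A x")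
    case True
    then show ?thesis using mate_lift mate_eq by blast
  qed (simp add: mate_def)
  show "x \<in> cover g P" if "mate g A x \<noteq> x" for x
    using that hasArc_node unfolding mate_fixed cover_def by blast
  show "x + g \<in> cover g P \<longleftrightarrow> x \<in> cover g P" for x
    by (simp add: cover_def)
  show "mate g A y \<noteq> y \<and> x < mate g A y \<and> mate g A y < mate g A x"
    if x: "x < mate g A x" and y: "x < y" "y < mate g A x" "y \<in> cover g P" for x y
  proof -
    have "hasArc g A x" using x mate_fixed by force
    then have xl: "(x, mate g A x) \<in> lift g A"
      using mate_lift liftD(1) x by (metis less_asym')
    have hy: "hasArc g A y"
      using uncovered[OF _ _ xl, of y] y by (auto simp: cover_def)
    have ne: "mate g A y \<noteq> y" using hy mate_fixed by blast
    from mate_lift[OF hy] show ?thesis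
    proof
      assume yl: "(y, mate g A y) \<in> lift g A"
      have "mate g A y \<noteq> mate g A x"
        using lift_right_unique[OF xl] yl y by force
      moreover have "\<not> mate g A x < mate g A y"
        using noncrossing[OF xl yl] y by blast
      ultimately show ?thesis
        using ne liftD(1)[OF yl] y by linarith
    next
      assume yl: "(mate g A y, y) \<in> lift g A"
      have "mate g A y \<noteq> x"
        using lift_left_unique[OF xl] yl y by force
      moreover have "\<not> mate g A y < x"
        using noncrossing[OF yl xl] y by blast
      ultimately show ?thesis
        using ne liftD(1)[OF yl] y by linarith
    qed
  qed
qed

lemma transversal_iff:
  assumes S: "S \<subseteq> nodes g P"
  shows "transversal g A S \<longleftrightarrow> (\<forall>i\<in>nodes g P. alternating g (mate g A) S i)"
proof
  assume t: "transversal g A S"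
  show "\<forall>i\<in>nodes g P. alternating g (mate g A) S i"
  proof
    fix i assume i: "i \<in> nodes g P"
    have ib: "0 \<le> i" "i < g" "i mod g = i" using i by (auto simp: nodes_def)
    show "alternating g (mate g A) S i"
    proof (cases "hasArc g A i")
      case False
      then show ?thesis
        using t mate_fixed[of i] by (auto simp: alternating_def transversal_def)
    next
      case True
      have ne: "mate g A i \<noteq> i" using True mate_fixed by blast
      have "(i \<in> S) \<noteq> (mate g A i mod g \<in> S)"
        using mate_lift[OF True]
      proof
        assume "(i, mate g A i) \<in> lift g A"
        then have "(i, mate g A i) \<in> A" using lift_base ib by blast
        then show ?thesis using t unfolding transversal_def by blast
      next
        assume "(mate g A i, i) \<in> lift g A"
        then obtain a b m where ab: "(a, b) \<in> A" "mate g A i = a + m * g" "i = b + m * g"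
          by (rule liftE)
        then have "mate g A i mod g = a" "b mod g = i"
          using arc_mod[OF ab(1)] ib by auto
        then show ?thesis using t ab(1) unfolding transversal_def by blast
      qed
      then show ?thesis using ne by (simp add: alternating_def)
    qed
  qed
next
  assume a: "\<forall>i\<in>nodes g P. alternating g (mate g A) S i"
  have "hasArc g A s" if "s \<in> S" for s
  proof (rule ccontr)
    assume "\<not> hasArc g A s"
    then have "mate g A s = s" using mate_fixed by blast
    moreover have "alternating g (mate g A) S s" using a S that by blast
    ultimately show False using that by (simp add: alternating_def)
  qed
  moreover have "(i \<in> S) \<noteq> (j mod g \<in> S)" if "(i, j) \<in> A" for i j
  proof -
    have "mate g A i = j" using mate_eq lift_of_arc[OF that] by blast
    moreover have "j \<noteq> i" using arcD[OF that] by simp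
    moreover have "alternating g (mate g A) S i" using a arcD[OF that] by blast
    ultimately show ?thesis by (simp add: alternating_def)
  qed
  ultimately show "transversal g A S"
    by (auto simp: transversal_def)
qed

lemma transversal_card: "transversal g A S \<Longrightarrow> S \<subseteq> nodes g P \<Longrightarrow> card S = r"
proof -
  assume t: "transversal g A S" and "S \<subseteq> nodes g P"
  then have "S \<subseteq> {0..<g}" by (auto simp: nodes_def)
  then show ?thesis
    using bij_betw_same_card[OF choice_bij[OF t]] arcs_card by simp
qed

text \<open>At a chosen end s of the arc \<open>(i, j)\<close> the exponent is i + j - 2s, and the
  sign is that of s in the binomial. If s is a right end beyond the cut, its representative in the
  window is smaller by \<open>g\<close>, and the surplus of 2g in the exponent is what the value
  v^(-2g) of q absorbs.\<close>

lemma prod_mate: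
  fixes v :: "'a::field"
  assumes v: "v \<noteq> 0" and t: "transversal g A S" and S: "S \<subseteq> nodes g P"
  shows "(\<Prod>s\<in>S. of_int (sgn (mate g A s - s)) * v powi (mate g A s - s)) =
    arcweight v A * v powi (- 2 * \<Sum>S) * transition (v powi (- 2 * g)) g A S"
proof -
  interpret M: ncinv g "mate g A" "cover g P" by (rule mate_ncinv)
  have Sg: "S \<subseteq> {0..<g}" using S by (auto simp: nodes_def)
  define ch where "ch = (\<lambda>(i, j). if i \<in> S then i else j mod g)"
  have b: "bij_betw ch A S"
    unfolding ch_def using t Sg by (rule choice_bij)
  define q where "q = v powi (- 2 * g)"
  have powi_sum: "(\<Prod>a\<in>E. v powi h a) = v powi (\<Sum>a\<in>E. h a)" if "finite E" for E and h :: "int \<times> int \<Rightarrow> int"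
    using that by (induction E rule: finite_induct) (simp_all add: power_int_add v)
  have "(\<Prod>s\<in>S. of_int (sgn (mate g A s - s)) * v powi (mate g A s - s)) =
      (\<Prod>a\<in>A. of_int (sgn (mate g A (ch a) - ch a)) * v powi (mate g A (ch a) - ch a))"
    by (rule prod.reindex_bij_betw[OF b, symmetric])
  also have "\<dots> = (\<Prod>a\<in>A. (case a of (i, j) \<Rightarrow> v powi (i + j)) * v powi (- 2 * ch a) *
      (case a of (i, j) \<Rightarrow> if i \<in> S then 1 else - wrapq g q j))"
  proof (rule prod.cong[OF refl])
    fix a assume a: "a \<in> A"
    obtain i j where ij: "a = (i, j)" by (cases a)
    have A: "(i, j) \<in> A" using a ij by simp
    note d = arcD[OF A]
    have m: "mate g A i = j" "mate g A j = i" using mate_eq[OF lift_of_arc[OF A]] by auto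
    show "of_int (sgn (mate g A (ch a) - ch a)) * v powi (mate g A (ch a) - ch a) =
      (case a of (i, j) \<Rightarrow> v powi (i + j)) * v powi (- 2 * ch a) *
      (case a of (i, j) \<Rightarrow> if i \<in> S then 1 else - wrapq g q j)"
    proof (cases "i \<in> S")
      case True
      have "v powi (i + j) * v powi (- 2 * i) = v powi (j - i)"
        using power_int_add[of v "i + j" "- 2 * i"] v by simp
      then show ?thesis
        using True m(1) d(3) by (simp add: ij ch_def)
    next
      case False
      have e: "mate g A (j mod g) - j mod g = i - j"
        using M.mod_shift[of j] m(2) by simp
      have "v powi (i + j) * v powi (- 2 * (j mod g)) * wrapq g q j = v powi (i - j)"
      proof (cases "g \<le> j")
        case True
        have "j mod g = (j - g) mod g" by simp
        also have "\<dots> = j - g" using True d by (intro mod_pos_pos_trivial) auto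
        finally have jm: "j mod g = j - g" .
        have "v powi (i + j) * v powi (- 2 * (j - g)) * v powi (- 2 * g)
            = v powi (i + j + - 2 * (j - g) + - 2 * g)"
          by (simp only: power_int_add[OF disjI1[OF v]])
        then show ?thesis
          using True by (simp add: wrapq_def q_def jm algebra_simps)
      next
        case False
        then have "j mod g = j" using d by simp
        then show ?thesis
          using False power_int_add[of v "i + j" "- 2 * j"] v by (simp add: wrapq_def)
      qed
      then show ?thesis
        using False e d(3) by (simp add: ij ch_def)
    qed
  qed
  also have "\<dots> = arcweight v A * (\<Prod>a\<in>A. v powi (- 2 * ch a)) * transition q g A S"
    using t by (simp add: prod.distrib arcweight_def transition_def)
  also have "(\<Prod>a\<in>A. v powi (- 2 * ch a)) = v powi (- 2 * \<Sum>S)"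
  proof -
    have "\<Sum>S = (\<Sum>a\<in>A. ch a)"
      using sum.reindex_bij_betw[OF b, of "\<lambda>x. x"] by simp
    then show ?thesis
      unfolding powi_sum[OF arcs_finite] by (simp only: sum_distrib_left)
  qed
  finally show ?thesis by (simp only: q_def)
qed

end

section \<open>From two semi-meanders to the product of transition matrices\<close>

locale meander_pair = A: meander g P r A + B: meander g P r B for g P r A B
begin

abbreviation "\<alpha> \<equiv> mate g A"
abbreviation "\<beta> \<equiv> mate g B"

sublocale D: ncpair g \<alpha> \<beta> "cover g P"
  by (simp add: ncpair_def A.mate_ncinv B.mate_ncinv)

lemma dedge_iff: "dedge g A B x y \<longleftrightarrow> x \<noteq> y \<and> (y = \<alpha> x \<or> y = \<beta> x)"
proof -
  have 1: "(x, y) \<in> lift g A \<or> (y, x) \<in> lift g A \<longleftrightarrow> x \<noteq> y \<and> y = \<alpha> x"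
    using A.mate_eq A.mate_lift A.mate_fixed A.liftD(1) by (metis less_irrefl)
  have 2: "(x, y) \<in> lift g B \<or> (y, x) \<in> lift g B \<longleftrightarrow> x \<noteq> y \<and> y = \<beta> x"
    using B.mate_eq B.mate_lift B.mate_fixed B.liftD(1) by (metis less_irrefl)
  show ?thesis
    unfolding dedge_def using 1 2 by blast
qed

lemma conn_eq: "conn g A B = linked \<alpha> \<beta>"
proof -
  let ?R = "\<lambda>x y. y = \<alpha> x \<or> y = \<beta> x"
  have "(dedge g A B)\<^sup>*\<^sup>* \<le> ?R\<^sup>*\<^sup>*"
    by (rule rtranclp_mono) (auto simp: dedge_iff)
  moreover have "?R \<le> (dedge g A B)\<^sup>*\<^sup>*"
  proof (intro predicate2I)
    fix x y assume "?R x y"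
    then show "(dedge g A B)\<^sup>*\<^sup>* x y"
      using dedge_iff[of x y] by (cases "x = y") auto
  qed
  then have "?R\<^sup>*\<^sup>* \<le> (dedge g A B)\<^sup>*\<^sup>*"
    using rtranclp_mono rtranclp_idemp by metis
  ultimately show ?thesis
    unfolding conn_def linked_def by (rule antisym)
qed

lemma lcomp_eq: "lcomp g A B x = {y. linked \<alpha> \<beta> x y}"
  by (simp add: lcomp_def conn_eq)

lemma ccomps_eq: "ccomps g P A B = D.cp ` fund g (cover g P)"
proof -
  have "ccomp g P A B i = D.cp i" for i
    by (simp add: ccomp_def comp_def fund_cover[OF A.g_pos] conn_eq)
  then show ?thesis
    by (simp add: ccomps_def fund_cover[OF A.g_pos])
qed

lemma is_loop_eq: "is_loop g A B K \<longleftrightarrow> D.loopcomp K"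
  by (simp add: is_loop_def D.loopcomp_def A.mate_fixed B.mate_fixed)

lemma m0_eq: "m0 g P A B = card D.loops0"
  and mT_eq: "mT g P A B = card D.loopsT"
  by (simp_all add: m0_def mT_def D.loops0_def D.loopsT_def ccomps_eq is_loop_eq lcomp_eq)

lemma bad_eq: "bad g P A B \<longleftrightarrow> D.bad_pair"
  by (simp add: bad_def D.bad_pair_def fund_cover[OF A.g_pos] lcomp_eq A.mate_fixed B.mate_fixed)

lemma ends_eq: "D.ends = free_nodes g P A"
  by (simp add: D.ends_def free_nodes_def fund_cover[OF A.g_pos] A.mate_fixed)

lemma mv_eq: "mv g P A B = (\<Sum>s\<in>D.ends. (THE y. linked \<alpha> \<beta> s y \<and> \<beta> y = y) - s)"
  by (simp add: mv_def ends_eq free_nodes_def lcomp_eq B.mate_fixed)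

text \<open>Fewer than d/2 arcs leave a free node above, whose path to the bottom would meet the
  loop.\<close>

lemma no_winding_loops:
  assumes "2 * r < card (nodes g P)" "\<not> bad g P A B"
  shows "mT g P A B = 0"
proof -
  have "card (free_nodes g P A) > 0"
    using A.card_free_nodes assms(1) by simp
  then have "D.ends \<noteq> {}"
    unfolding ends_eq by auto
  then show ?thesis
    using D.loopsT_empty assms(2) by (simp add: mT_eq bad_eq)
qed

text \<open>The weight of a state splits into an upper factor in \<open>v\<close> and a lower factor
  in its inverse, which turns the parameter into v^(2g) and the diagonal weight into its reciprocal.
  The powers of \<open>v\<close> that depend on \<open>S\<close> cancel, and the minus signs of the
  \<open>r\<close> weights are collected in front.\<close>

lemma gram_formula:
  fixes v :: "'a::field"
  assumes v: "v \<noteq> 0"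
  shows "(if bad g P A B then 0 else (- 2) ^ m0 g P A B * (v powi g + v powi (- g)) ^ mT g P A B *
      v powi mv g P A B) = ((- 1) ^ r * arcweight v A) *
      (\<Sum>S\<in>rsets g P r. transition (v powi (- 2 * g)) g A S * transition (v powi (2 * g)) g B S) * inverse (arcweight v B)"
proof -
  let ?V = "{S. valid g \<alpha> \<beta> (nodes g P) S}"
  let ?XX = "\<lambda>S. transition (v powi (- 2 * g)) g A S * transition (v powi (2 * g)) g B S"
  have V: "?V = {S \<in> rsets g P r. transversal g A S \<and> transversal g B S}"
    using A.transversal_iff B.transversal_iff A.transversal_card unfolding valid_def rsets_def by blast
  have w: "(\<Prod>s\<in>S. weight v \<alpha> \<beta> s) = (- 1) ^ r * arcweight v A * ?XX S * inverse (arcweight v B)"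
    if S: "S \<in> ?V" for S
  proof -
    have S': "transversal g A S" "transversal g B S" "S \<subseteq> nodes g P" "card S = r"
      using S unfolding V by (auto simp: rsets_def)
    have iv: "inverse v \<noteq> 0" using v by simp
    have pi: "inverse v powi n = v powi (- n)" for n
      by (simp add: power_int_minus power_int_inverse)
    have "weight v \<alpha> \<beta> s = (- 1) * (of_int (sgn (\<alpha> s - s)) * v powi (\<alpha> s - s)) *
        (of_int (sgn (\<beta> s - s)) * inverse v powi (\<beta> s - s))" for s
    proof -
      have "v powi (\<alpha> s - \<beta> s) = v powi (\<alpha> s - s) * v powi (s - \<beta> s)"
        using power_int_add[of v "\<alpha> s - s" "s - \<beta> s"] v by simp
      then show ?thesis
        by (simp add: weight_def pi)
    qed
    then have "(\<Prod>s\<in>S. weight v \<alpha> \<beta> s) = (- 1) ^ r *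
        (\<Prod>s\<in>S. of_int (sgn (\<alpha> s - s)) * v powi (\<alpha> s - s)) *
        (\<Prod>s\<in>S. of_int (sgn (\<beta> s - s)) * inverse v powi (\<beta> s - s))"
      by (simp only: prod.distrib prod_constant S'(4))
    also have "\<dots> = (- 1) ^ r * (arcweight v A * v powi (- 2 * \<Sum>S) * transition (v powi (- 2 * g)) g A S) *
        (arcweight (inverse v) B * inverse v powi (- 2 * \<Sum>S) * transition (inverse v powi (- 2 * g)) g B S)"
      by (simp only: A.prod_mate[OF v S'(1,3)] B.prod_mate[OF iv S'(2,3)])
    also have "arcweight (inverse v) B = inverse (arcweight v B)"
      by (simp add: arcweight_def case_prod_beta power_int_inverse prod_inversef[symmetric] o_def)
    also have "inverse v powi (- 2 * g) = v powi (2 * g)"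
      by (simp add: pi)
    also have "inverse v powi (- 2 * \<Sum>S) = inverse (v powi (- 2 * \<Sum>S))"
      by (simp only: power_int_inverse)
    finally show ?thesis
      using v by (simp add: mult_ac)
  qed
  have "D.csum v (nodes g P) = (\<Sum>S\<in>?V. (- 1) ^ r * arcweight v A * ?XX S * inverse (arcweight v B))"
    using w by (intro sum.cong) auto
  also have "\<dots> = (\<Sum>S\<in>rsets g P r. (- 1) ^ r * arcweight v A * ?XX S * inverse (arcweight v B))"
    unfolding V by (rule sum.mono_neutral_left) (auto simp: finite_rsets transition_def)
  also have "\<dots> = (- 1) ^ r * arcweight v A * (\<Sum>S\<in>rsets g P r. ?XX S) * inverse (arcweight v B)"
    by (simp only: sum_distrib_left sum_distrib_right)
  finally show ?thesis
    using D.gram_sum[OF v] by (simp add: fund_cover[OF A.g_pos] m0_eq mT_eq mv_eq bad_eq)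
qed

end

text \<open>The assumption on \<open>G\<close> covers both cases at once: the generic
  \<open>v\<close>, for which no winding loops occur, and the values of T at special
  \<open>v\<close>, for which displacements are absent.\<close>

lemma setdet_gram:
  fixes v :: "'a::field"
  assumes g: "g > 0" and v: "v \<noteq> 0" and r: "2 * r \<le> card (nodes g P)"
    and G: "\<And>A B. A \<in> Bset g P r \<Longrightarrow> B \<in> Bset g P r \<Longrightarrow> G A B =
      (if bad g P A B then 0 else
        (- 2) ^ m0 g P A B * (v powi g + v powi (- g)) ^ mT g P A B * v powi mv g P A B)"
  shows "setdet G (Bset g P r) = (- 1) ^ (r * card (Bset g P r) + tdr (card (nodes g P)) r) *
    (v powi g - v powi (- g)) ^ (2 * tdr (card (nodes g P)) r)"
proof -
  let ?B = "Bset g P r" and ?t = "tdr (card (nodes g P)) r"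
  define p q where "p = v powi (- 2 * g)" and "q = v powi (2 * g)"
  note fin = finite_Bset[OF g, of P r]
  have aw: "arcweight v A \<noteq> 0" for A
    by (cases "finite A") (auto simp: arcweight_def v)
  have "setdet G ?B = setdet (\<lambda>A B. ((- 1) ^ r * arcweight v A) *
      (\<Sum>C\<in>?B. transition p g A (openers C) * transition q g B (openers C)) * inverse (arcweight v B)) ?B"
  proof (rule setdet_cong)
    fix A B assume AB: "A \<in> ?B" "B \<in> ?B"
    interpret meander_pair g P r A B
      using AB meander_Bset[OF g] by (simp add: meander_pair_def)
    show "G A B = ((- 1) ^ r * arcweight v A) *
      (\<Sum>C\<in>?B. transition p g A (openers C) * transition q g B (openers C)) * inverse (arcweight v B)"
      unfolding G[OF AB] gram_formula[OF v] p_def q_def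
        sum.reindex_bij_betw[OF bij_openers[OF g r], symmetric] ..
  qed
  also have "\<dots> = (\<Prod>A\<in>?B. inverse (arcweight v A)) * ((\<Prod>A\<in>?B. (- 1) ^ r * arcweight v A) *
      setdet (\<lambda>A B. \<Sum>C\<in>?B. transition p g A (openers C) * transition q g B (openers C)) ?B)"
    by (simp only: setdet_scale_cols[OF fin] setdet_scale_rows[OF fin])
  also have "setdet (\<lambda>A B. \<Sum>C\<in>?B. transition p g A (openers C) * transition q g B (openers C)) ?B = (1 - p) ^ ?t * (1 - q) ^ ?t"
    using setdet_mult[OF fin, of "\<lambda>A C. transition p g A (openers C)" "\<lambda>C B. transition q g B (openers C)"]
      setdet_transpose[OF fin, of "\<lambda>B C. transition q g B (openers C)"] det_transition[OF g r, of p] det_transition[OF g r, of q]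
    by simp
  also have "(\<Prod>A\<in>?B. inverse (arcweight v A)) * ((\<Prod>A\<in>?B. (- 1) ^ r * arcweight v A) *
      ((1 - p) ^ ?t * (1 - q) ^ ?t)) = (- 1) ^ (r * card ?B) * ((1 - p) * (1 - q)) ^ ?t"
  proof -
    have "(\<Prod>A\<in>?B. inverse (arcweight v A)) * (\<Prod>A\<in>?B. (- 1) ^ r * arcweight v A)
        = (\<Prod>A\<in>?B. (- 1) ^ r)"
      unfolding prod.distrib[symmetric] using aw by (intro prod.cong) auto
    also have "\<dots> = (- 1) ^ (r * card ?B)"
      by (simp add: power_mult)
    finally show ?thesis
      by (simp only: mult.assoc[symmetric] power_mult_distrib)
  qed
  \<comment> \<open>With x = v^g this is (1 - x^(-2)) (1 - x^2) = - (x - 1/x)^2, the source of the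
    exponent 2t and of the additional sign.\<close>
  also have "(1 - p) * (1 - q) = - ((v powi g - v powi (- g)) ^ 2)"
  proof -
    define x y where "x = v powi g" and "y = v powi (- g)"
    have xy: "x * y = 1"
      using power_int_add[of v g "- g"] v by (simp add: x_def y_def)
    have "p = y * y" "q = x * x"
      using power_int_add[of v "- g" "- g"] power_int_add[of v g g] v
      by (simp_all add: p_def q_def x_def y_def)
    then have "(1 - p) * (1 - q) = 1 - y * y - x * x + (x * y) * (x * y)"
      by (simp add: algebra_simps)
    also have "\<dots> = - ((x - y) ^ 2)"
      using xy by (simp add: power2_eq_square algebra_simps)
    finally show ?thesis by (simp add: x_def y_def)
  qed
  also have "(- ((v powi g - v powi (- g)) ^ 2)) ^ ?t = (- 1) ^ ?t * (v powi g - v powi (- g)) ^ (2 * ?t)"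
    by (simp add: power_minus[of "(v powi g - v powi (- g)) ^ 2"] power_mult)
  finally show ?thesis
    by (simp only: power_add mult.assoc)
qed

lemma varv_nonzero: "varv \<noteq> 0"
  by (simp add: varv_def Zero_fract_def eq_fract)

lemma setdet_gramv:
  assumes g: "g > 0" and r: "2 * r < card (nodes g P)"
  shows "setdet (gramv g P) (Bset g P r) = (- 1) ^ (r * card (Bset g P r) + tdr (card (nodes g P)) r) *
    (varv powi g - varv powi (- g)) ^ (2 * tdr (card (nodes g P)) r)"
proof (rule setdet_gram[OF g varv_nonzero])
  fix A B assume "A \<in> Bset g P r" "B \<in> Bset g P r"
  then interpret meander_pair g P r A B
    using meander_Bset[OF g] by (simp add: meander_pair_def)
  show "gramv g P A B = (if bad g P A B then 0 else (- 2) ^ m0 g P A B *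
      (varv powi g + varv powi (- g)) ^ mT g P A B * varv powi mv g P A B)"
    using no_winding_loops[OF r] by (simp add: gramv_def)
qed (use r in simp)

text \<open>Specialisation: every nonzero rational \<open>v\<close> gives the identity at T = v^g +
  v^(-g), and a nonzero polynomial cannot vanish at infinitely many values. As r = d/2, no node is
  free and the displacement sum is empty.\<close>

lemma setdet_gramT:
  assumes g: "g > 0" and r: "2 * r = card (nodes g P)"
  shows "setdet (gramT g P) (Bset g P r) = (- 1) ^ (r * card (Bset g P r) + tdr (card (nodes g P)) r) *
    (varT ^ 2 - 4) ^ tdr (card (nodes g P)) r" (is "?L = ?R")
proof (rule ccontr)
  assume ne: "?L \<noteq> ?R"
  define T where "T = (\<lambda>v :: rat. v powi g + v powi (- g))"
  have "poly (?L - ?R) (T v) = 0" if v: "v \<noteq> 0" for v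
  proof -
    have "poly ?L (T v) = setdet (\<lambda>A B. poly (gramT g P A B) (T v)) (Bset g P r)"
      by (rule poly_setdet)
    also have "\<dots> = (- 1) ^ (r * card (Bset g P r) + tdr (card (nodes g P)) r) *
        (v powi g - v powi (- g)) ^ (2 * tdr (card (nodes g P)) r)"
    proof (rule setdet_gram[OF g v])
      fix A B assume "A \<in> Bset g P r" "B \<in> Bset g P r"
      then interpret meander_pair g P r A B
        using meander_Bset[OF g] by (simp add: meander_pair_def)
      have "card (free_nodes g P A) = 0"
        using A.card_free_nodes r by simp
      then have "free_nodes g P A = {}"
        using A.finite_free_nodes by simp
      then have "mv g P A B = 0"
        unfolding mv_eq ends_eq by simp
      moreover have "poly varT (T v) = T v"
        by (simp add: varT_def)
      ultimately show "poly (gramT g P A B) (T v) = (if bad g P A B then 0 else (- 2) ^ m0 g P A B *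
          (v powi g + v powi (- g)) ^ mT g P A B * v powi mv g P A B)"
        by (simp add: gramT_def T_def poly_power)
    qed (use r in simp)
    also have "(v powi g - v powi (- g)) ^ (2 * tdr (card (nodes g P)) r) = (T v ^ 2 - 4) ^ tdr (card (nodes g P)) r"
    proof -
      have "v powi g * v powi (- g) = 1"
        using power_int_add[of v g "- g"] v by simp
      then have "(v powi g - v powi (- g)) ^ 2 = T v ^ 2 - 4"
        by (simp add: T_def power2_eq_square algebra_simps)
      then show ?thesis by (simp add: power_mult)
    qed
    also have "(- 1) ^ (r * card (Bset g P r) + tdr (card (nodes g P)) r) * (T v ^ 2 - 4) ^ tdr (card (nodes g P)) r = poly ?R (T v)"
      by (simp add: poly_power varT_def)
    finally show ?thesis by simp
  qed
  then have "T ` {v. v \<noteq> 0} \<subseteq> {x. poly (?L - ?R) x = 0}" by blast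
  then have fin: "finite (T ` {v. v \<noteq> 0})"
    using ne poly_roots_finite[of "?L - ?R"] finite_subset by auto
  \<comment> \<open>The offset 2 keeps \<open>v\<close> above 1, where x + 1/x no longer identifies
    x with its reciprocal.\<close>
  have "inj (\<lambda>k :: nat. T (of_nat (k + 2)))"
  proof (rule injI)
    fix k l :: nat
    assume T: "T (of_nat (k + 2)) = T (of_nat (l + 2))"
    define x y :: rat where "x = of_nat (k + 2) ^ nat g" and "y = of_nat (l + 2) ^ nat g"
    have x1: "x > 1" "y > 1"
      using g by (auto simp: x_def y_def intro!: one_less_power)
    have "x + inverse x = y + inverse y"
      using T g by (simp add: T_def power_int_def x_def y_def power_inverse)
    \<comment> \<open>The difference of the two sides, multiplied by \<open>x * y\<close>.\<close>
    then have "(x - y) * (x * y - 1) = 0"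
      using x1 by (simp add: field_simps)
    moreover have "x * y > 1"
      using x1 less_1_mult by blast
    ultimately have "x = y" by simp
    then have "(of_nat (k + 2) :: rat) = of_nat (l + 2)"
      unfolding x_def y_def using g by (subst (asm) power_eq_iff_eq_base) auto
    then show "k = l" by simp
  qed
  then have "infinite (range (\<lambda>k :: nat. T (of_nat (k + 2))))"
    using finite_imageD infinite_UNIV_nat by blast
  moreover have "range (\<lambda>k :: nat. T (of_nat (k + 2))) \<subseteq> T ` {v. v \<noteq> 0}"
    by (auto intro!: imageI)
  ultimately show False
    using fin finite_subset by blast
qed

lemma signed_cases: "x = (- 1) ^ n * y \<Longrightarrow> x = y \<or> x = - (y :: 'a::comm_ring_1)"
  by (cases "even n") auto

theorem mainTheorem1:
  fixes g :: int and P :: "int set"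
  assumes "g \<ge> 1" and "P \<subseteq> {0..<g}"
  shows "(even (card (nodes g P)) \<longrightarrow>
            (let d = card (nodes g P) in
             setdet (gramT g P) (Bset g P (d div 2)) = (varT ^ 2 - 4) ^ tdr d (d div 2) \<or>
             setdet (gramT g P) (Bset g P (d div 2)) = - ((varT ^ 2 - 4) ^ tdr d (d div 2))))
       \<and> (\<forall>r::nat. 2 * r < card (nodes g P) \<longrightarrow>
            (let d = card (nodes g P) in
             setdet (gramv g P) (Bset g P r) = (varv powi g - varv powi (- g)) ^ (2 * tdr d r) \<or>
             setdet (gramv g P) (Bset g P r) = - ((varv powi g - varv powi (- g)) ^ (2 * tdr d r))))"
proof -
  have g: "g > 0" using assms by simp
  show ?thesis
    unfolding Let_def
  proof (intro conjI impI allI)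
    assume "even (card (nodes g P))"
    then have "2 * (card (nodes g P) div 2) = card (nodes g P)" by simp
    from signed_cases[OF setdet_gramT[OF g this]]
    show "setdet (gramT g P) (Bset g P (card (nodes g P) div 2)) =
        (varT ^ 2 - 4) ^ tdr (card (nodes g P)) (card (nodes g P) div 2) \<or>
      setdet (gramT g P) (Bset g P (card (nodes g P) div 2)) =
        - ((varT ^ 2 - 4) ^ tdr (card (nodes g P)) (card (nodes g P) div 2))" .
  next
    fix r assume "2 * r < card (nodes g P)"
    from signed_cases[OF setdet_gramv[OF g this]]
    show "setdet (gramv g P) (Bset g P r) =
        (varv powi g - varv powi (- g)) ^ (2 * tdr (card (nodes g P)) r) \<or>
      setdet (gramv g P) (Bset g P r) =
        - ((varv powi g - varv powi (- g)) ^ (2 * tdr (card (nodes g P)) r))" .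
  qed
qed

end
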